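(* Let $G$ be a finite abelian group, $\rho\colon G\to GL(V)$ a faithful representation on a finite-dimensional complex vector space $V$ not containing the trivial representation, and let $\gamma(j,n)$ be the number of forests in $\mathcal F(n,G,V)$ with $j$ connected components ($j,n>0$). Set $\mathcal G(s,t)=\sum_{j>0,n>0}\gamma(j,n)s^j\frac{t^n}{n!}$. Then \[\mathcal G(s,t)=s\Big(\frac{1}{2-\Gamma(1,t)}-1\Big)\Gamma(s,t)+\overline{\Gamma}(s,t).\] Moreover, for each $n\ge1$ the number of nonempty nested sets of the building set $\mathcal B_n$ (defined in the context) equals the coefficient of $\frac{t^n}{n!}$ in $\mathcal G(1,t)$.
   Context: Closed subgroups: with $\mathrm{Fix}(K)=\{v\in V:\rho(k)v=v\ \forall k\in K\}$, let $\phi(H)$ be the maximal subgroup with $\mathrm{Fix}(\phi(H))=\mathrm{Fix}(H)$; $H$ is closed if $\phi(H)=H$. Let $\mathcal K$ be the set of closed subgroups, $\mathcal H=\mathcal K\setminus\{G\}$. Forests $\mathcal F(n,G,V)$: partition $\{1,\dots,n\}$ into blocks; for each block take a rooted tree (edges oriented away from the root) whose leaves are exactly labelled by the block (a block may be a lone leaf, a "fallen leaf"); label internal vertices by closed subgroups and each edge by a coset of the subgroup labelling its upper endpoint, such that: (1) a descendant internal vertex labelled $P$ of one labelled $Q$ has $P\subseteq Q$; (2) if an internal vertex labelled $P$ is the only child of one labelled $Q$ then $P\subsetneq Q$, and a vertex whose only child is a leaf is not labelled $\{e\}$; (3) $G$ labels vertices in at most one tree and a $G$-labelled vertex has at most one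 $G$-labelled child; (4) at each internal vertex labelled $K$ the edge towards the subtree containing the smallest leaf is labelled $eK$; and the forest has at least one internal vertex. $\mathcal F'(n,G,V)$: forests with no $G$-labelled vertex; $\mathcal F''(n,G,V)$: those in $\mathcal F'$ without fallen leaves. For $H\in\mathcal H$ and a forest in $\mathcal F'$, $a_H$ is the number of its non-fallen leaves whose parent is labelled $H$. $\gamma''(j,(a_H))$ = number of forests in $\mathcal F''(n,G,V)$, $n=\sum a_H$, with $j$ trees and these $a_H$; $\gamma'(h,j,(a_H))$ = number of forests in $\mathcal F'(n,G,V)$, $n=h+\sum a_H$, with $h$ fallen leaves, $j>h$ connected components and these $a_H$. Then $\tilde\Gamma(s,(t_H))=1+\sum_{\sum a_H\ge1}\gamma''(j,(a_H))s^j\prod t_H^{a_H}/(\sum a_H)!$ and $\overline\Gamma(s,t,(t_H))=\sum_{j>h\ge0,\sum a_H\ge1}\gamma'(h,j,(a_H))s^jt^h\prod t_H^{a_H}/(h+\sum a_H)!$. Let $\tilde\Gamma(s,t)$ and $\overline\Gamma(s,t)$ denote these series with $t_K=t$ for all $K\in\mathcal H$, and $\Gamma(s,t)=e^{st}\tilde\Gamma(s,t)$. Building and nested sets: for a finite set $\mathcal B$ of subspaces of a vector space, a subset $\mathcal S\subseteq\mathcal B$ is $\mathcal B$-nested if for every $p\ge2$ and pairwise inclusion-incomparable $S_1,\dots,S_p\in\mathcal S$, the $S_i$ are in direct sum and $S_1\oplus\dots\oplus S_p\notin\mathcal B$. $\mathcal B_n$ is the set of annihilators in $(V^n)^*$ of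 the subspaces of $V^n$: $\{(v_1,\dots,v_n): \exists v\in\mathrm{Fix}(K),\ v_{i_1}=\rho(g_1)v,\dots,v_{i_k}=\rho(g_k)v\}$ for $2\le k\le n$, $i_1<\dots<i_k$, $K\in\mathcal K$, $g_j\in G$; and $\{(v_1,\dots,v_n): v_i\in\mathrm{Fix}(K)\}$ for $1\le i\le n$, $K\in\mathcal K\setminus\{\{e\}\}$. ($\mathcal B_n$ is the minimal building set of the arrangement of subspaces $\{v_j=\rho(g)v_i\}$, $i<j$, $g\in G$, and $\{v_i=\rho(g)v_i\}$, $g\ne e$.)
   Formalization: The representation space V is assumed nonzero (equivalently G nontrivial): for V = 0, G = {e} the formula fails, since there is no forest for n = 1 while the right-hand side has coefficient 1 at st. *)

theory Defs
  imports
    Complex_Main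
    "HOL-Library.FSet"
    "HOL-Library.Function_Algebras"
    "HOL-Algebra.Coset"
    "HOL-Computational_Algebra.Polynomial"
    "HOL-Computational_Algebra.Formal_Power_Series"
begin

section \<open>Representations and closed subgroups\<close>

definition GL :: "(complex \<Rightarrow> 'v::ab_group_add \<Rightarrow> 'v) \<Rightarrow> ('v \<Rightarrow> 'v) monoid" where
  "GL scale = \<lparr>carrier = {f. Vector_Spaces.linear scale scale f \<and> bij f}, monoid.mult = (\<circ>), one = id\<rparr>"

definition Fix :: "('g \<Rightarrow> 'v \<Rightarrow> 'v) \<Rightarrow> 'g set \<Rightarrow> 'v set" where
  "Fix \<rho> K = {v. \<forall>k\<in>K. \<rho> k v = v}"

text \<open>\<open>Greatest\<close> is taken with respect to inclusion.\<close>

definition subgroup_closure ::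
    "('g, 'b) monoid_scheme \<Rightarrow> ('g \<Rightarrow> 'v \<Rightarrow> 'v) \<Rightarrow> 'g set \<Rightarrow> 'g set" where
  "subgroup_closure G \<rho> H = (GREATEST K. subgroup K G \<and> Fix \<rho> K = Fix \<rho> H)"

definition closed_subgroups ::
    "('g, 'b) monoid_scheme \<Rightarrow> ('g \<Rightarrow> 'v \<Rightarrow> 'v) \<Rightarrow> 'g set set" where
  "closed_subgroups G \<rho> = {H. subgroup H G \<and> subgroup_closure G \<rho> H = H}"

definition proper_closed_subgroups ::
    "('g, 'b) monoid_scheme \<Rightarrow> ('g \<Rightarrow> 'v \<Rightarrow> 'v) \<Rightarrow> 'g set set" where
  "proper_closed_subgroups G \<rho> = closed_subgroups G \<rho> - {carrier G}"


section \<open>Labelled forests\<close>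

text \<open>
  \<open>Node K C\<close> is an internal vertex labelled by the subgroup \<open>K\<close>; a pair \<open>(c, u)\<close> in \<open>C\<close> is an
  edge labelled by the coset \<open>c\<close> going down to the subtree \<open>u\<close>.  In the trees considered below no
  leaf label occurs twice, so sibling subtrees are always distinct (finite sets of children
  lose nothing against multisets), distinct vertices have distinct subtrees, and two
  trees are isomorphic by a label-preserving isomorphism iff they are equal.
\<close>

datatype 'g ltree = Leaf nat | Node "'g set" "('g set \<times> 'g ltree) fset"

text \<open>The full subtrees of \<open>t\<close>, one for each vertex of \<open>t\<close>.\<close>

inductive_set subtrees :: "'g ltree \<Rightarrow> 'g ltree set" for t where
  self: "t \<in> subtrees t"
| child: "Node K C \<in> subtrees t \<Longrightarrow> (c, u) \<in> fset C \<Longrightarrow> u \<in> subtrees t"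

definition leaves :: "'g ltree \<Rightarrow> nat set" where
  "leaves t = {i. Leaf i \<in> subtrees t}"

definition has_vertex_labelled :: "'g set \<Rightarrow> 'g ltree \<Rightarrow> bool" where
  "has_vertex_labelled K t \<longleftrightarrow> (\<exists>C. Node K C \<in> subtrees t)"

text \<open>
  \<open>K\<close> and \<open>C\<close> are the label and the children of an internal vertex.  \<open>C\<close> must be nonempty because
  leaves carry no subgroup.  Since \<open>P \<subseteq> K\<close> is required for every label \<open>P\<close> below this vertex, the
  strict inclusion concerns only vertices with exactly one child.  The last clause
  normalises the edge towards the smallest leaf.
\<close>

definition admissible_vertex ::
    "('g, 'b) monoid_scheme \<Rightarrow> ('g \<Rightarrow> 'v \<Rightarrow> 'v) \<Rightarrow> 'g set \<Rightarrow> ('g set \<times> 'g ltree) fset \<Rightarrow> bool" where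
  "admissible_vertex G \<rho> K C \<longleftrightarrow>
     C \<noteq> {||} \<and>
     K \<in> closed_subgroups G \<rho> \<and>
     (\<forall>(c, u)\<in>fset C. \<exists>g\<in>carrier G. c = g <#\<^bsub>G\<^esub> K) \<and>
     pairwise (\<lambda>e e'. leaves (snd e) \<inter> leaves (snd e') = {}) (fset C) \<and>
     (\<forall>(c, u)\<in>fset C. \<forall>P. has_vertex_labelled P u \<longrightarrow> P \<subseteq> K) \<and>
     (\<forall>c P D. C = {|(c, Node P D)|} \<longrightarrow> P \<subset> K) \<and>
     (\<forall>c i. C = {|(c, Leaf i)|} \<longrightarrow> K \<noteq> {\<one>\<^bsub>G\<^esub>}) \<and>
     (K = carrier G \<longrightarrow>
        (\<forall>c D c' D'. (c, Node (carrier G) D) \<in> fset C \<and> (c', Node (carrier G) D') \<in> fset C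
           \<longrightarrow> (c, D) = (c', D'))) \<and>
     (\<forall>(c, u)\<in>fset C. Min (leaves (Node K C)) \<in> leaves u \<longrightarrow> c = \<one>\<^bsub>G\<^esub> <#\<^bsub>G\<^esub> K)"

definition admissible_tree ::
    "('g, 'b) monoid_scheme \<Rightarrow> ('g \<Rightarrow> 'v \<Rightarrow> 'v) \<Rightarrow> 'g ltree \<Rightarrow> bool" where
  "admissible_tree G \<rho> t \<longleftrightarrow> (\<forall>K C. Node K C \<in> subtrees t \<longrightarrow> admissible_vertex G \<rho> K C)"

text \<open>
  A forest is the set of its trees, whose leaf sets are the blocks of the partition
  of \<open>{1..n}\<close>.  Its fallen leaves are the trees \<open>Leaf i\<close>.
\<close>

definition forests ::
    "nat \<Rightarrow> ('g, 'b) monoid_scheme \<Rightarrow> ('g \<Rightarrow> 'v \<Rightarrow> 'v) \<Rightarrow> 'g ltree set set" where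
  "forests n G \<rho> = {F.
     pairwise (\<lambda>t u. leaves t \<inter> leaves u = {}) F \<and>
     (\<Union>t\<in>F. leaves t) = {1..n} \<and>
     (\<forall>t\<in>F. admissible_tree G \<rho> t) \<and>
     (\<forall>t\<in>F. \<forall>u\<in>F. has_vertex_labelled (carrier G) t \<and> has_vertex_labelled (carrier G) u
        \<longrightarrow> t = u) \<and>
     (\<exists>t\<in>F. \<exists>K. has_vertex_labelled K t)}"

definition fallen_leaves :: "'g ltree set \<Rightarrow> nat set" where
  "fallen_leaves F = {i. Leaf i \<in> F}"

definition forests' ::
    "nat \<Rightarrow> ('g, 'b) monoid_scheme \<Rightarrow> ('g \<Rightarrow> 'v \<Rightarrow> 'v) \<Rightarrow> 'g ltree set set" where
  "forests' n G \<rho> = {F \<in> forests n G \<rho>. \<forall>t\<in>F. \<not> has_vertex_labelled (carrier G) t}"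

definition forests'' ::
    "nat \<Rightarrow> ('g, 'b) monoid_scheme \<Rightarrow> ('g \<Rightarrow> 'v \<Rightarrow> 'v) \<Rightarrow> 'g ltree set set" where
  "forests'' n G \<rho> = {F \<in> forests' n G \<rho>. fallen_leaves F = {}}"

text \<open>The non-fallen leaves whose parent is labelled \<open>H\<close>; their number is \<open>a\<^sub>H\<close>.\<close>

definition leaves_under :: "'g ltree set \<Rightarrow> 'g set \<Rightarrow> nat set" where
  "leaves_under F H = {i. \<exists>t\<in>F. \<exists>C c. Node H C \<in> subtrees t \<and> (c, Leaf i) \<in> fset C}"

definition gamma ::
    "('g, 'b) monoid_scheme \<Rightarrow> ('g \<Rightarrow> 'v \<Rightarrow> 'v) \<Rightarrow> nat \<Rightarrow> nat \<Rightarrow> nat" where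
  "gamma G \<rho> j n = card {F \<in> forests n G \<rho>. card F = j}"

definition gamma'' ::
    "('g, 'b) monoid_scheme \<Rightarrow> ('g \<Rightarrow> 'v \<Rightarrow> 'v) \<Rightarrow> nat \<Rightarrow> ('g set \<Rightarrow> nat) \<Rightarrow> nat" where
  "gamma'' G \<rho> j a =
     card {F \<in> forests'' (\<Sum>H\<in>proper_closed_subgroups G \<rho>. a H) G \<rho>.
       card F = j \<and> (\<forall>H\<in>proper_closed_subgroups G \<rho>. card (leaves_under F H) = a H)}"

definition gamma' ::
    "('g, 'b) monoid_scheme \<Rightarrow> ('g \<Rightarrow> 'v \<Rightarrow> 'v) \<Rightarrow> nat \<Rightarrow> nat \<Rightarrow> ('g set \<Rightarrow> nat) \<Rightarrow> nat" where
  "gamma' G \<rho> h j a =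
     card {F \<in> forests' (h + (\<Sum>H\<in>proper_closed_subgroups G \<rho>. a H)) G \<rho>.
       card (fallen_leaves F) = h \<and> card F = j \<and>
       (\<forall>H\<in>proper_closed_subgroups G \<rho>. card (leaves_under F H) = a H)}"


section \<open>Generating series\<close>

text \<open>
  Series in \<open>s\<close> and \<open>t\<close> are power series in \<open>t\<close> whose coefficients are polynomials in \<open>s\<close>:
  \<open>series c\<close> is the sum of all \<open>c j n s\<^sup>j t\<^sup>n\<close>.  A forest on \<open>n\<close> leaves has at most \<open>n\<close> trees,
  so for the families \<open>c\<close> used here only finitely many \<open>c j n\<close> with given \<open>n\<close> are nonzero.
\<close>

definition series :: "(nat \<Rightarrow> nat \<Rightarrow> rat) \<Rightarrow> rat poly fps" where
  "series c = Abs_fps (\<lambda>n. \<Sum>j | c j n \<noteq> 0. monom (c j n) j)"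

text \<open>The substitution \<open>s = 1\<close>, and the inclusion of the series in \<open>t\<close> alone.\<close>

definition at_s_1 :: "rat poly fps \<Rightarrow> rat fps" where
  "at_s_1 f = Abs_fps (\<lambda>n. poly (fps_nth f n) 1)"

definition fps_in_t :: "rat fps \<Rightarrow> rat poly fps" where
  "fps_in_t f = Abs_fps (\<lambda>n. [:fps_nth f n:])"

definition var_s :: "rat poly fps" where
  "var_s = fps_const [:0, 1:]"

definition exp_st :: "rat poly fps" where
  "exp_st = series (\<lambda>j n. if j = n then 1 / fact n else 0)"

definition G_series :: "('g, 'b) monoid_scheme \<Rightarrow> ('g \<Rightarrow> 'v \<Rightarrow> 'v) \<Rightarrow> rat poly fps" where
  "G_series G \<rho> =
     series (\<lambda>j n. if j > 0 \<and> n > 0 then of_nat (gamma G \<rho> j n) / fact n else 0)"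

text \<open>
  Coefficient of \<open>s\<^sup>j \<Prod>\<^sub>H t\<^sub>H\<^sup>a\<^sup>H\<close> (respectively \<open>s\<^sup>j t\<^sup>h \<Prod>\<^sub>H t\<^sub>H\<^sup>a\<^sup>H\<close>) in the two multivariate series.
\<close>

definition Gamma_tilde_coeff ::
    "('g, 'b) monoid_scheme \<Rightarrow> ('g \<Rightarrow> 'v \<Rightarrow> 'v) \<Rightarrow> nat \<Rightarrow> ('g set \<Rightarrow> nat) \<Rightarrow> rat" where
  "Gamma_tilde_coeff G \<rho> j a =
     (let m = (\<Sum>H\<in>proper_closed_subgroups G \<rho>. a H) in
      if m \<ge> 1 then of_nat (gamma'' G \<rho> j a) / fact m
      else if j = 0 then 1 else 0)"

definition Gamma_bar_coeff ::
    "('g, 'b) monoid_scheme \<Rightarrow> ('g \<Rightarrow> 'v \<Rightarrow> 'v) \<Rightarrow> nat \<Rightarrow> nat \<Rightarrow> ('g set \<Rightarrow> nat) \<Rightarrow> rat" where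
  "Gamma_bar_coeff G \<rho> h j a =
     (let m = (\<Sum>H\<in>proper_closed_subgroups G \<rho>. a H) in
      if j > h \<and> m \<ge> 1 then of_nat (gamma' G \<rho> h j a) / fact (h + m) else 0)"

text \<open>
  The specialisations \<open>t\<^sub>H = t\<close> for all \<open>H\<close>: the coefficient of \<open>s\<^sup>j t\<^sup>n\<close> collects all monomials
  whose total degree in the variables other than \<open>s\<close> is \<open>n\<close>.
\<close>

definition exponents ::
    "('g, 'b) monoid_scheme \<Rightarrow> ('g \<Rightarrow> 'v \<Rightarrow> 'v) \<Rightarrow> ('g set \<Rightarrow> nat) set" where
  "exponents G \<rho> = (proper_closed_subgroups G \<rho> \<rightarrow>\<^sub>E UNIV)"

definition Gamma_tilde :: "('g, 'b) monoid_scheme \<Rightarrow> ('g \<Rightarrow> 'v \<Rightarrow> 'v) \<Rightarrow> rat poly fps" where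
  "Gamma_tilde G \<rho> = series (\<lambda>j n.
     \<Sum>a | a \<in> exponents G \<rho> \<and> (\<Sum>H\<in>proper_closed_subgroups G \<rho>. a H) = n.
       Gamma_tilde_coeff G \<rho> j a)"

definition Gamma_bar :: "('g, 'b) monoid_scheme \<Rightarrow> ('g \<Rightarrow> 'v \<Rightarrow> 'v) \<Rightarrow> rat poly fps" where
  "Gamma_bar G \<rho> = series (\<lambda>j n.
     \<Sum>(h, a) | a \<in> exponents G \<rho> \<and> h + (\<Sum>H\<in>proper_closed_subgroups G \<rho>. a H) = n.
       Gamma_bar_coeff G \<rho> h j a)"

definition Gamma :: "('g, 'b) monoid_scheme \<Rightarrow> ('g \<Rightarrow> 'v \<Rightarrow> 'v) \<Rightarrow> rat poly fps" where
  "Gamma G \<rho> = exp_st * Gamma_tilde G \<rho>"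


section \<open>Nested sets\<close>

definition in_direct_sum :: "'w::ab_group_add set set \<Rightarrow> bool" where
  "in_direct_sum T \<longleftrightarrow>
     (\<forall>x. (\<forall>A\<in>T. x A \<in> A) \<and> (\<Sum>A\<in>T. x A) = 0 \<longrightarrow> (\<forall>A\<in>T. x A = 0))"

definition sum_of_subspaces :: "'w::ab_group_add set set \<Rightarrow> 'w set" where
  "sum_of_subspaces T = {(\<Sum>A\<in>T. x A) | x. \<forall>A\<in>T. x A \<in> A}"

text \<open>Pairwise incomparable \<open>S\<^sub>1, \<dots>, S\<^sub>p\<close> are distinct, hence form a \<open>p\<close>-element subset of \<open>S\<close>.\<close>

definition nested_set :: "'w::ab_group_add set set \<Rightarrow> 'w set set \<Rightarrow> bool" where
  "nested_set B S \<longleftrightarrow> S \<subseteq> B \<and>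
     (\<forall>T. T \<subseteq> S \<and> finite T \<and> card T \<ge> 2 \<and> pairwise (\<lambda>X Y. \<not> X \<subseteq> Y \<and> \<not> Y \<subseteq> X) T
        \<longrightarrow> in_direct_sum T \<and> sum_of_subspaces T \<notin> B)"

text \<open>
  \<open>V\<^sup>n\<close> is the space of families indexed by \<open>{1..n}\<close>, extended by \<open>0\<close>; likewise
  the elements of its dual are extended by \<open>0\<close> outside of \<open>V\<^sup>n\<close>.
\<close>

definition V_pow :: "nat \<Rightarrow> (nat \<Rightarrow> 'v::ab_group_add) set" where
  "V_pow n = {v. \<forall>i. i \<notin> {1..n} \<longrightarrow> v i = 0}"

definition dual_V_pow ::
    "(complex \<Rightarrow> 'v::ab_group_add \<Rightarrow> 'v) \<Rightarrow> nat \<Rightarrow> ((nat \<Rightarrow> 'v) \<Rightarrow> complex) set" where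
  "dual_V_pow scale n = {f.
     (\<forall>u\<in>V_pow n. \<forall>v\<in>V_pow n. f (\<lambda>i. u i + v i) = f u + f v) \<and>
     (\<forall>c. \<forall>v\<in>V_pow n. f (\<lambda>i. scale c (v i)) = c * f v) \<and>
     (\<forall>v. v \<notin> V_pow n \<longrightarrow> f v = 0)}"

definition annihilator ::
    "(complex \<Rightarrow> 'v::ab_group_add \<Rightarrow> 'v) \<Rightarrow> nat \<Rightarrow> (nat \<Rightarrow> 'v) set \<Rightarrow> ((nat \<Rightarrow> 'v) \<Rightarrow> complex) set" where
  "annihilator scale n W = {f \<in> dual_V_pow scale n. \<forall>v\<in>W. f v = 0}"

text \<open>The index set \<open>I\<close> is \<open>{i\<^sub>1 < \<dots> < i\<^sub>k}\<close>, and \<open>g i\<close> is the group element attached to \<open>i\<close>.\<close>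

definition building_set ::
    "(complex \<Rightarrow> 'v::ab_group_add \<Rightarrow> 'v) \<Rightarrow> ('g, 'b) monoid_scheme \<Rightarrow> ('g \<Rightarrow> 'v \<Rightarrow> 'v) \<Rightarrow> nat
       \<Rightarrow> ((nat \<Rightarrow> 'v) \<Rightarrow> complex) set set" where
  "building_set scale G \<rho> n =
     {annihilator scale n {v \<in> V_pow n. \<exists>w\<in>Fix \<rho> K. \<forall>i\<in>I. v i = \<rho> (g i) w} | I K g.
        I \<subseteq> {1..n} \<and> card I \<ge> 2 \<and> K \<in> closed_subgroups G \<rho> \<and> (\<forall>i\<in>I. g i \<in> carrier G)} \<union>
     {annihilator scale n {v \<in> V_pow n. v i \<in> Fix \<rho> K} | i K.
        i \<in> {1..n} \<and> K \<in> closed_subgroups G \<rho> - {{\<one>\<^bsub>G\<^esub>}}}"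

end

theory Submission
  imports Defs
begin

text \<open>
  A subspace \<open>{v. v\<^sub>i = \<rho>(g\<^sub>i) w (i \<in> I), w \<in> Fix K}\<close> with \<open>K\<close> closed is encoded by the set \<open>R\<close> of
  all equations \<open>v\<^sub>i = \<rho>(g) v\<^sub>j\<close> with \<open>i, j \<in> I\<close> that hold on it, a connected groupoid with object
  set \<open>I\<close> and isotropy group \<open>K\<close>.  Inclusion of annihilators becomes inclusion of these
  relations.  If two of them share an index, or both have isotropy \<open>G\<close>, the sum of the
  annihilators again belongs to the building set; if they are disjoint and not both have
  isotropy \<open>G\<close>, the sum is direct and does not.  Hence nested sets are the families of relations
  that are pairwise comparable, or disjoint and not both with isotropy \<open>G\<close>.

  An internal vertex of a labelled forest yields the relation on the leaves below it given by
  the products of the coset labels along the paths to them.  This identifies forests with the same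
  families: maximal members are the roots, and removing a maximal member leaves the forest of its
  children.

  The members with isotropy \<open>G\<close> form a chain.  If \<open>M\<close> counts the families containing the full
  relation on the whole index set and \<open>P = \<Gamma>(1, t)\<close> those without isotropy \<open>G\<close>, then splitting along
  the largest member with isotropy \<open>G\<close> gives \<open>s M(t) \<Gamma>(s, t)\<close> for all families with such a
  member, while deleting the full relation gives \<open>2 M = (P - 1) + M P\<close>, that is \<open>M = 1 / (2 - P) - 1\<close>.
\<close>

section \<open>Gain relations\<close>

text \<open>The obstacle is that forests and nested sets are given in unlike terms: recursive trees
  with normalised cosets on one side, sums of subspaces of a dual space on the other. A relation
  records all equations at once and involves no choice, so both sides reduce to statements about
  inclusions and supports. The normalisation towards the smallest leaf selects one forest for each
  family: it makes the path coset of the smallest leaf equal to the root label, after which every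
  other coset can be read off from the relation. Commutativity makes the isotropy groups at all
  indices of a relation agree, since they are conjugate, and makes each Fix K stable under G. The
  group G is exceptional because Fix G = 0: isotropy G says that coordinates vanish, and two such
  conditions on disjoint index sets combine into one of the same kind. Otherwise disjointness
  suffices: functionals in an annihilator depend only on the coordinates in the support, so sums are
  direct, and a vector that is nonzero on one support and zero on the others shows that no connected
  relation describes the sum.\<close>

definition supp :: "(nat \<times> nat \<times> 'g) set \<Rightarrow> nat set" where
  "supp R = fst ` R"

definition isotropy :: "(nat \<times> nat \<times> 'g) set \<Rightarrow> 'g set" where
  "isotropy R = {g. \<exists>i. (i, i, g) \<in> R}"

text \<open>Collects what the combinatorial half has to know about \<open>\<rho>\<close>; the vector
  space enters only in \<open>representation\<close>. The last assumption keeps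
  \<open>full {i}\<close> from being the excluded trivial relation.\<close>

locale gain_setup = comm_group G for G :: "('g, 'b) monoid_scheme" (structure) +
  fixes \<rho> :: "'g \<Rightarrow> 'v \<Rightarrow> 'v"
  assumes finite_carrier: "finite (carrier G)"
    and carrier_closed: "carrier G \<in> closed_subgroups G \<rho>"
    and carrier_nontrivial: "carrier G \<noteq> {\<one>}"
begin

text \<open>
  A triple \<open>(i, j, g)\<close> stands for the equation \<open>v\<^sub>i = \<rho> g v\<^sub>j\<close>, and \<open>(i, i, k)\<close> says that \<open>k\<close> fixes
  \<open>v\<^sub>i\<close>.  The relation \<open>{(i, i, \<one>)}\<close> is excluded since it imposes nothing.
\<close>

definition gains :: "nat set \<Rightarrow> (nat \<times> nat \<times> 'g) set set" where
  "gains A = {R. R \<noteq> {} \<and> R \<subseteq> A \<times> A \<times> carrier G \<and>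
     (\<forall>i j g. (i, j, g) \<in> R \<longrightarrow> (j, i, inv g) \<in> R) \<and>
     (\<forall>i j k g h. (i, j, g) \<in> R \<longrightarrow> (j, k, h) \<in> R \<longrightarrow> (i, k, g \<otimes> h) \<in> R) \<and>
     (\<forall>i\<in>supp R. \<forall>j\<in>supp R. \<exists>g. (i, j, g) \<in> R) \<and>
     isotropy R \<in> closed_subgroups G \<rho> \<and> (\<forall>i. R \<noteq> {(i, i, \<one>)})}"

definition compatible :: "(nat \<times> nat \<times> 'g) set \<Rightarrow> (nat \<times> nat \<times> 'g) set \<Rightarrow> bool" where
  "compatible R R' \<longleftrightarrow> R \<subseteq> R' \<or> R' \<subseteq> R \<or>
     supp R \<inter> supp R' = {} \<and> \<not> (isotropy R = carrier G \<and> isotropy R' = carrier G)"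

definition families :: "nat set \<Rightarrow> (nat \<times> nat \<times> 'g) set set set" where
  "families A = {S. S \<subseteq> gains A \<and> (\<forall>R\<in>S. \<forall>R'\<in>S. compatible R R')}"

lemma closed_subgroupD: "K \<in> closed_subgroups G \<rho> \<Longrightarrow> subgroup K G"
  by (simp add: closed_subgroups_def)

lemma gainsI:
  assumes "R \<noteq> {}" "R \<subseteq> A \<times> A \<times> carrier G"
    and "\<And>i j g. (i, j, g) \<in> R \<Longrightarrow> (j, i, inv g) \<in> R"
    and "\<And>i j k g h. (i, j, g) \<in> R \<Longrightarrow> (j, k, h) \<in> R \<Longrightarrow> (i, k, g \<otimes> h) \<in> R"
    and "\<And>i j. i \<in> supp R \<Longrightarrow> j \<in> supp R \<Longrightarrow> \<exists>g. (i, j, g) \<in> R"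
    and "isotropy R \<in> closed_subgroups G \<rho>" "\<And>i. R \<noteq> {(i, i, \<one>)}"
  shows "R \<in> gains A"
  unfolding gains_def mem_Collect_eq
proof (intro conjI)
  show "\<forall>i j g. (i, j, g) \<in> R \<longrightarrow> (j, i, inv g) \<in> R" using assms(3) by blast
  show "\<forall>i j k g h. (i, j, g) \<in> R \<longrightarrow> (j, k, h) \<in> R \<longrightarrow> (i, k, g \<otimes> h) \<in> R"
    using assms(4) by blast
qed (use assms in simp_all)

lemma supp_mono: "R \<subseteq> R' \<Longrightarrow> supp R \<subseteq> supp R'"
  by (auto simp: supp_def)

lemma isotropy_mono: "R \<subseteq> R' \<Longrightarrow> isotropy R \<subseteq> isotropy R'"
  by (auto simp: isotropy_def)

context
  fixes A R
  assumes R: "R \<in> gains A"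
begin

lemma gain_sym: "(i, j, g) \<in> R \<Longrightarrow> (j, i, inv g) \<in> R"
  using R by (simp add: gains_def)

lemma gain_trans: "(i, j, g) \<in> R \<Longrightarrow> (j, k, h) \<in> R \<Longrightarrow> (i, k, g \<otimes> h) \<in> R"
  using R unfolding gains_def by blast

lemma gain_carrier: "(i, j, g) \<in> R \<Longrightarrow> g \<in> carrier G"
  using R unfolding gains_def by blast

lemma gain_supp1: "(i, j, g) \<in> R \<Longrightarrow> i \<in> supp R"
  unfolding supp_def by force

lemma gain_supp2: "(i, j, g) \<in> R \<Longrightarrow> j \<in> supp R"
  using gain_sym gain_supp1 by blast

lemma gain_connected: "i \<in> supp R \<Longrightarrow> j \<in> supp R \<Longrightarrow> \<exists>g. (i, j, g) \<in> R"
  using R unfolding gains_def by blast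

lemma gain_refl: "i \<in> supp R \<Longrightarrow> (i, i, \<one>) \<in> R"
  using gain_connected[of i i] gain_sym gain_trans gain_carrier by (metis r_inv)

lemma supp_subset: "supp R \<subseteq> A"
  using R by (auto simp: gains_def supp_def)

lemma gain_subset: "R \<subseteq> supp R \<times> supp R \<times> carrier G"
  using gain_supp1 gain_supp2 gain_carrier by auto

lemma supp_nonempty: "supp R \<noteq> {}"
  using R by (auto simp: gains_def supp_def)

lemma isotropy_closed: "isotropy R \<in> closed_subgroups G \<rho>"
  using R by (simp add: gains_def)

lemma isotropy_subgroup: "subgroup (isotropy R) G"
  using isotropy_closed closed_subgroupD by blast

text \<open>A gain \<open>h\<close> from \<open>i\<close> to \<open>j\<close> carries a loop
  \<open>g\<close> at \<open>j\<close> to its conjugate by \<open>h\<close> at \<open>i\<close>,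
  which is \<open>g\<close> again by commutativity. So one subgroup describes the loops at every
  index.\<close>

lemma isotropy_at:
  assumes "i \<in> supp R"
  shows "isotropy R = {g. (i, i, g) \<in> R}"
proof -
  have "(i, i, g) \<in> R" if jg: "(j, j, g) \<in> R" for j g
  proof -
    obtain h where h: "(i, j, h) \<in> R"
      using gain_connected assms gain_supp1 jg by blast
    have "(i, i, (h \<otimes> g) \<otimes> inv h) \<in> R"
      using gain_trans[OF gain_trans[OF h jg] gain_sym[OF h]] .
    moreover have "(h \<otimes> g) \<otimes> inv h = g"
      using gain_carrier[OF h] gain_carrier[OF jg] by (simp add: m_assoc m_comm[of h])
    ultimately show ?thesis by simp
  qed
  then show ?thesis unfolding isotropy_def by blast
qed

text \<open>The exclusion of \<open>{(i, i, \<one>)}\<close> from \<open>gains\<close> pays off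
  here. It matches both the ban on the label {e} above a lone leaf and the restriction to nontrivial
  K for single coordinates in the building set.\<close>

lemma isotropy_singleton:
  assumes "supp R = {i}"
  shows "isotropy R \<noteq> {\<one>}"
proof
  assume K: "isotropy R = {\<one>}"
  have "R \<subseteq> {(i, i, \<one>)}"
  proof safe
    fix j k g assume jkg: "(j, k, g) \<in> R"
    then show "j = i" "k = i" using gain_supp1 gain_supp2 assms by blast+
    then show "g = \<one>" using jkg K unfolding isotropy_def by blast
  qed
  then show False using R by (auto simp: gains_def)
qed

text \<open>Two gains between the same indices differ by a loop, so they form one coset of the
  isotropy group. This is the dictionary between gains and the cosets on edges.\<close>

lemma gain_coset:
  assumes "(i, j, g) \<in> R"
  shows "(i, j, h) \<in> R \<longleftrightarrow> h \<in> g <# isotropy R"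
proof -
  have j: "j \<in> supp R" using assms gain_supp2 by blast
  show ?thesis
  proof
    assume h: "(i, j, h) \<in> R"
    have "(j, j, inv g \<otimes> h) \<in> R" using gain_trans[OF gain_sym[OF assms] h] .
    then have "inv g \<otimes> h \<in> isotropy R" using isotropy_at[OF j] by simp
    moreover have "h = g \<otimes> (inv g \<otimes> h)"
      using gain_carrier assms h by (simp add: m_assoc[symmetric])
    ultimately show "h \<in> g <# isotropy R" unfolding l_coset_def by blast
  next
    assume "h \<in> g <# isotropy R"
    then obtain k where "k \<in> isotropy R" "h = g \<otimes> k" unfolding l_coset_def by blast
    then show "(i, j, h) \<in> R" using gain_trans[OF assms] isotropy_at[OF j] by simp
  qed
qed

end

lemma gains_mono: "A \<subseteq> B \<Longrightarrow> gains A \<subseteq> gains B"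
  unfolding gains_def by blast

lemma gains_supp: "R \<in> gains A \<Longrightarrow> supp R \<subseteq> B \<Longrightarrow> R \<in> gains B"
  using gain_subset[of R A] unfolding gains_def by blast

text \<open>With equal support and isotropy, the gains between any two indices are cosets of the
  same group in \<open>R\<close> and \<open>R'\<close>. The inclusion makes these cosets meet, so
  they coincide.\<close>

lemma gain_eqI:
  assumes R: "R \<in> gains A" and R': "R' \<in> gains B" and sub: "R \<subseteq> R'"
    and "supp R = supp R'" "isotropy R = isotropy R'"
  shows "R = R'"
proof
  show "R' \<subseteq> R"
  proof safe
    fix i j g assume ijg: "(i, j, g) \<in> R'"
    then obtain h where h: "(i, j, h) \<in> R"
      using gain_connected[OF R] gain_supp1[OF R'] gain_supp2[OF R'] assms(4) by metis
    then have "(i, j, h) \<in> R'" using sub by blast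
    then show "(i, j, g) \<in> R"
      using gain_coset[OF R h] gain_coset[OF R'] ijg assms(5) by metis
  qed
qed fact

lemma finite_gains: "finite A \<Longrightarrow> finite (gains A)"
proof -
  assume "finite A"
  then have "finite (Pow (A \<times> A \<times> carrier G))" using finite_carrier by simp
  then show ?thesis by (rule finite_subset[rotated]) (auto simp: gains_def)
qed

lemma finite_families: "finite A \<Longrightarrow> finite (families A)"
  using finite_subset[of "families A" "Pow (gains A)"] finite_gains
  by (auto simp: families_def)

lemma families_sub: "S \<in> families A \<Longrightarrow> R \<in> S \<Longrightarrow> R \<in> gains A"
  by (auto simp: families_def)

lemma families_finite: "S \<in> families A \<Longrightarrow> finite A \<Longrightarrow> finite S"
  using finite_gains finite_subset by (auto simp: families_def)

lemma families_compatible: "S \<in> families A \<Longrightarrow> R \<in> S \<Longrightarrow> R' \<in> S \<Longrightarrow> compatible R R'"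
  by (auto simp: families_def)

lemma families_meet:
  assumes "S \<in> families A" "R \<in> S" "R' \<in> S" "i \<in> supp R" "i \<in> supp R'"
  shows "R \<subseteq> R' \<or> R' \<subseteq> R"
  using families_compatible[OF assms(1-3)] assms(4,5) by (auto simp: compatible_def)

lemma families_subset:
  assumes "S \<in> families A" "S' \<subseteq> S" "\<Union> (supp ` S') \<subseteq> B"
  shows "S' \<in> families B"
proof -
  have "R \<in> gains B" if "R \<in> S'" for R
    using gains_supp[of R A B] families_sub[OF assms(1)] assms(2,3) that by blast
  then show ?thesis using assms(1,2) unfolding families_def by blast
qed

lemma compatible_sym: "compatible R R' \<Longrightarrow> compatible R' R"
  unfolding compatible_def by blast

lemma gain_mono_supp:
  assumes "R \<in> gains A" "R \<subseteq> R'"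
  shows "supp R \<inter> supp R' \<noteq> {}"
  using supp_mono[OF assms(2)] supp_nonempty[OF assms(1)] by blast

end

section \<open>From forests to families of gain relations\<close>

lemma ltree_induct [case_names Leaf Node]:
  assumes "\<And>i. P (Leaf i)"
    and "\<And>K C. (\<And>c u. (c, u) \<in> fset C \<Longrightarrow> P u) \<Longrightarrow> P (Node K C)"
  shows "P t"
proof (induction t)
  case (Node K C)
  show ?case
  proof (rule assms(2))
    fix c u assume "(c, u) \<in> fset C"
    then show "P u" using Node[of "(c, u)" u] by simp
  qed
qed (rule assms(1))

lemma subtrees_Leaf [simp]: "subtrees (Leaf i) = {Leaf i}"
proof -
  have "u = Leaf i" if "u \<in> subtrees (Leaf i)" for u :: "'g ltree"
    using that by induction auto
  then show ?thesis by (auto intro: subtrees.self)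
qed

lemma subtrees_trans: "v \<in> subtrees u \<Longrightarrow> u \<in> subtrees t \<Longrightarrow> v \<in> subtrees t"
  by (induction rule: subtrees.induct) (auto intro: subtrees.child)

lemma subtrees_Node: "subtrees (Node K C) = insert (Node K C) (\<Union>(c, u)\<in>fset C. subtrees u)"
proof (intro equalityI subsetI)
  fix v assume "v \<in> subtrees (Node K C)"
  then show "v \<in> insert (Node K C) (\<Union>(c, u)\<in>fset C. subtrees u)"
  proof induction
    case self
    then show ?case by simp
  next
    case (child K' C' c u)
    then consider "Node K' C' = Node K C" | d w where "(d, w) \<in> fset C" "Node K' C' \<in> subtrees w"
      by auto
    then show ?case
    proof cases
      case 1
      then show ?thesis using child(2) subtrees.self by auto
    next
      case (2 d w)
      then show ?thesis using subtrees.child[OF 2(2) child(2)] by auto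
    qed
  qed
next
  fix v assume "v \<in> insert (Node K C) (\<Union>(c, u)\<in>fset C. subtrees u)"
  then consider "v = Node K C" | c u where "(c, u) \<in> fset C" "v \<in> subtrees u" by auto
  then show "v \<in> subtrees (Node K C)"
    by cases (auto intro: subtrees.self subtrees_trans[OF _ subtrees.child[OF subtrees.self]])
qed

lemma leaves_Leaf [simp]: "leaves (Leaf i) = {i}"
  by (auto simp: leaves_def)

lemma leaves_Node: "leaves (Node K C) = (\<Union>(c, u)\<in>fset C. leaves u)"
  by (auto simp: leaves_def subtrees_Node)

lemma leaves_child: "(c, u) \<in> fset C \<Longrightarrow> leaves u \<subseteq> leaves (Node K C)"
  by (auto simp: leaves_Node)

lemma finite_leaves: "finite (leaves t)"
  by (induction t rule: ltree_induct) (auto simp: leaves_Node)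

lemma not_labelled_Leaf [simp]: "\<not> has_vertex_labelled P (Leaf i)"
  by (simp add: has_vertex_labelled_def)

lemma labelled_root [simp]: "has_vertex_labelled K (Node K C)"
  unfolding has_vertex_labelled_def using subtrees.self by blast

lemma admissible_Leaf [simp]: "admissible_tree G \<rho> (Leaf i)"
  by (simp add: admissible_tree_def)

lemma admissible_Node:
  "admissible_tree G \<rho> (Node K C) \<longleftrightarrow>
     admissible_vertex G \<rho> K C \<and> (\<forall>(c, u)\<in>fset C. admissible_tree G \<rho> u)"
  by (auto simp: admissible_tree_def subtrees_Node)

lemma admissible_child:
  "admissible_tree G \<rho> (Node K C) \<Longrightarrow> (c, u) \<in> fset C \<Longrightarrow> admissible_tree G \<rho> u"
  by (auto simp: admissible_Node)

lemma admissible_subtree: "admissible_tree G \<rho> t \<Longrightarrow> u \<in> subtrees t \<Longrightarrow> admissible_tree G \<rho> u"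
  unfolding admissible_tree_def using subtrees_trans by blast

lemma leaves_nonempty: "admissible_tree G \<rho> t \<Longrightarrow> leaves t \<noteq> {}"
proof (induction t rule: ltree_induct)
  case (Node K C)
  then have "C \<noteq> {||}" by (simp add: admissible_Node admissible_vertex_def)
  then obtain c u where "(c, u) \<in> fset C" by (metis ex_fin_conv surj_pair)
  then show ?case
    using Node.IH[of c u] admissible_child[OF Node.prems] leaves_child by blast
qed simp

lemma children_disjoint:
  assumes "admissible_tree G \<rho> (Node K C)" "(c, u) \<in> fset C" "(c', u') \<in> fset C"
    "i \<in> leaves u" "i \<in> leaves u'"
  shows "c' = c" "u' = u"
proof -
  have "pairwise (\<lambda>e e'. leaves (snd e) \<inter> leaves (snd e') = {}) (fset C)"
    using assms(1) by (simp add: admissible_Node admissible_vertex_def)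
  from pairwiseD[OF this assms(2,3)] have "(c, u) = (c', u')"
    using assms(4,5) by auto
  then show "c' = c" "u' = u" by simp_all
qed

lemma admissible_NodeD:
  fixes G (structure)
  assumes "admissible_tree G \<rho> (Node K C)"
  shows "C \<noteq> {||}" "K \<in> closed_subgroups G \<rho>"
    "(c, u) \<in> fset C \<Longrightarrow> \<exists>g\<in>carrier G. c = g <# K"
    "(c, u) \<in> fset C \<Longrightarrow> has_vertex_labelled P u \<Longrightarrow> P \<subseteq> K"
    "C = {|(c, Node P D)|} \<Longrightarrow> P \<subset> K"
    "C = {|(c, Leaf i)|} \<Longrightarrow> K \<noteq> {\<one>}"
    "K = carrier G \<Longrightarrow> (c, Node (carrier G) D) \<in> fset C \<Longrightarrow> (c', Node (carrier G) D') \<in> fset C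
       \<Longrightarrow> c = c' \<and> D = D'"
    "(c, u) \<in> fset C \<Longrightarrow> Min (leaves (Node K C)) \<in> leaves u \<Longrightarrow> c = \<one> <# K"
proof -
  note v = assms[unfolded admissible_Node admissible_vertex_def]
  show "C \<noteq> {||}" using v by (elim conjE)
  show "K \<in> closed_subgroups G \<rho>" using v by (elim conjE)
  have "\<forall>(c, u)\<in>fset C. \<exists>g\<in>carrier G. c = g <# K" using v by (elim conjE)
  then show "(c, u) \<in> fset C \<Longrightarrow> \<exists>g\<in>carrier G. c = g <# K" by (rule ballE) auto
  have "\<forall>(c, u)\<in>fset C. \<forall>P. has_vertex_labelled P u \<longrightarrow> P \<subseteq> K" using v by (elim conjE)
  from bspec[OF this, of "(c, u)"]
  show "(c, u) \<in> fset C \<Longrightarrow> has_vertex_labelled P u \<Longrightarrow> P \<subseteq> K" by simp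
  have "\<forall>c P D. C = {|(c, Node P D)|} \<longrightarrow> P \<subset> K" using v by (elim conjE)
  then show "C = {|(c, Node P D)|} \<Longrightarrow> P \<subset> K" by (elim allE impE)
  have "\<forall>c i. C = {|(c, Leaf i)|} \<longrightarrow> K \<noteq> {\<one>}" using v by (elim conjE)
  then show "C = {|(c, Leaf i)|} \<Longrightarrow> K \<noteq> {\<one>}" by (elim allE impE)
  have "K = carrier G \<longrightarrow>
        (\<forall>c D c' D'. (c, Node (carrier G) D) \<in> fset C \<and> (c', Node (carrier G) D') \<in> fset C
           \<longrightarrow> (c, D) = (c', D'))" using v by (elim conjE)
  then show "K = carrier G \<Longrightarrow> (c, Node (carrier G) D) \<in> fset C \<Longrightarrow>
      (c', Node (carrier G) D') \<in> fset C \<Longrightarrow> c = c' \<and> D = D'" by blast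
  have "\<forall>(c, u)\<in>fset C. Min (leaves (Node K C)) \<in> leaves u \<longrightarrow> c = \<one> <# K"
    using v by (elim conjE)
  from bspec[OF this, of "(c, u)"]
  show "(c, u) \<in> fset C \<Longrightarrow> Min (leaves (Node K C)) \<in> leaves u \<Longrightarrow> c = \<one> <# K" by simp
qed

text \<open>A leaf carries no subgroup. Giving it the trivial one makes labels weakly decrease along
  every edge and every path product a coset of the root label, without a separate treatment of
  leaves.\<close>

primrec root_label :: "('g, 'b) monoid_scheme \<Rightarrow> 'g ltree \<Rightarrow> 'g set" where
  "root_label G (Leaf i) = {\<one>\<^bsub>G\<^esub>}"
| "root_label G (Node K C) = K"

section \<open>Path cosets and the relation of a vertex\<close>

context gain_setup
begin

text \<open>
  \<open>lab t i\<close> is the product of the cosets on the path from the root of \<open>t\<close> to the leaf \<open>i\<close>.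
\<close>

primrec lab :: "'g ltree \<Rightarrow> nat \<Rightarrow> 'g set" where
  "lab (Leaf i) = (\<lambda>j. if j = i then {\<one>} else {})"
| "lab (Node K C) = (\<lambda>j. \<Union> ((\<lambda>(c, f). c <#> f j) ` fset (map_prod id lab |`| C)))"

text \<open>Writing \<open>lab t i\<close> as g_i K, the root vertex stands for v_i = rho(g_i) w
  with w in Fix K. On such vectors v_i = rho(g) v_j holds when g_i K = g g_j K, which is the stated
  equality of cosets.\<close>

definition rel :: "'g ltree \<Rightarrow> (nat \<times> nat \<times> 'g) set" where
  "rel t = {(i, j, g). i \<in> leaves t \<and> j \<in> leaves t \<and> g \<in> carrier G \<and> lab t i = g <# lab t j}"

definition fam :: "'g ltree \<Rightarrow> (nat \<times> nat \<times> 'g) set set" where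
  "fam t = {rel (Node K C) | K C. Node K C \<in> subtrees t}"

definition forest_family :: "'g ltree set \<Rightarrow> (nat \<times> nat \<times> 'g) set set" where
  "forest_family F = \<Union> (fam ` F)"

text \<open>The conditions of \<open>forests\<close>, for an arbitrary leaf set and without the
  demand for an internal vertex. Both changes serve the recursion: the children of a vertex form
  such a forest, possibly one of leaves only.\<close>

definition forest_on :: "nat set \<Rightarrow> 'g ltree set \<Rightarrow> bool" where
  "forest_on A F \<longleftrightarrow> pairwise (\<lambda>t u. leaves t \<inter> leaves u = {}) F \<and> (\<Union>t\<in>F. leaves t) = A \<and>
     (\<forall>t\<in>F. admissible_tree G \<rho> t) \<and>
     (\<forall>t\<in>F. \<forall>u\<in>F. has_vertex_labelled (carrier G) t \<and> has_vertex_labelled (carrier G) u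
        \<longrightarrow> t = u)"

text \<open>Primitive recursion through finite sets of pairs forces the form with
  \<open>map_prod\<close>; this is the form in which the recursion is used.\<close>

lemma lab_Node: "lab (Node K C) j = (\<Union>(c, u)\<in>fset C. c <#> lab u j)"
  by (auto simp: case_prod_beta)

declare lab.simps(2) [simp del]

lemma lab_outside: "j \<notin> leaves t \<Longrightarrow> lab t j = {}"
  by (induction t rule: ltree_induct) (auto simp: lab_Node leaves_Node set_mult_def)

lemma lab_child:
  assumes "admissible_tree G \<rho> (Node K C)" "(c, u) \<in> fset C" "i \<in> leaves u"
  shows "lab (Node K C) i = c <#> lab u i"
proof -
  have "c' <#> lab u' i \<subseteq> c <#> lab u i" if "(c', u') \<in> fset C" for c' u'
  proof (cases "i \<in> leaves u'")
    case True
    then show ?thesis using children_disjoint[OF assms(1,2) that assms(3)] by simp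
  next
    case False
    then show ?thesis by (simp add: lab_outside set_mult_def)
  qed
  then show ?thesis using assms(2) unfolding lab_Node by fast
qed

lemma subgroup_root_label: "admissible_tree G \<rho> t \<Longrightarrow> subgroup (root_label G t) G"
  by (cases t) (auto simp: triv_subgroup dest!: admissible_NodeD(2) closed_subgroupD)

lemma root_label_child:
  assumes "admissible_tree G \<rho> (Node K C)" "(c, u) \<in> fset C"
  shows "root_label G u \<subseteq> K"
proof (cases u)
  case (Leaf i)
  then show ?thesis using subgroup_root_label[OF assms(1)] by (simp add: subgroup.one_closed)
next
  case (Node P D)
  then show ?thesis using admissible_NodeD(4)[OF assms] labelled_root by simp
qed

lemma edge_coset:
  assumes "admissible_tree G \<rho> (Node K C)" "(c, u) \<in> fset C"
  obtains g where "g \<in> carrier G" "c = g <# K"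
  using admissible_NodeD(3)[OF assms] by blast

text \<open>Commutativity moves both representatives to the front, and K P = K because the subgroup
  P lies in K.\<close>

lemma coset_mult_coset:
  assumes "subgroup K G" "subgroup P G" "P \<subseteq> K" "g \<in> carrier G" "h \<in> carrier G"
  shows "(g <# K) <#> (h <# P) = (g \<otimes> h) <# K"
proof -
  interpret K: subgroup K G by fact
  interpret P: subgroup P G by fact
  have "(g \<otimes> k) \<otimes> (h \<otimes> p) = (g \<otimes> h) \<otimes> (k \<otimes> p)" if "k \<in> K" "p \<in> P" for k p
    using that assms(4,5) by (simp add: m_ac)
  then have "(g <# K) <#> (h <# P) = (\<Union>k\<in>K. \<Union>p\<in>P. {(g \<otimes> h) \<otimes> (k \<otimes> p)})"
    unfolding l_coset_def set_mult_def by auto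
  also have "\<dots> = (g \<otimes> h) <# K"
  proof -
    have "\<exists>k'\<in>K. \<exists>p\<in>P. (g \<otimes> h) \<otimes> k = (g \<otimes> h) \<otimes> (k' \<otimes> p)" if "k \<in> K" for k
      using that P.one_closed K.mem_carrier by (metis r_one)
    moreover have "k \<otimes> p \<in> K" if "k \<in> K" "p \<in> P" for k p
      using that assms(3) by auto
    ultimately show ?thesis unfolding l_coset_def by auto
  qed
  finally show ?thesis .
qed

lemma coset_absorb:
  assumes "subgroup K G" "subgroup P G" "P \<subseteq> K" "g \<in> carrier G"
  shows "(g <# K) <#> P = g <# K"
  using coset_mult_coset[OF assms one_closed] assms(2,4)
  by (simp add: lcos_mult_one subgroup.subset)

lemma lab_coset:
  assumes "admissible_tree G \<rho> t" "i \<in> leaves t"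
  shows "\<exists>g\<in>carrier G. lab t i = g <# root_label G t"
  using assms
proof (induction t rule: ltree_induct)
  case (Leaf j)
  then show ?case by (auto simp: l_coset_def intro!: bexI[of _ \<one>])
next
  case (Node K C)
  then obtain c u where cu: "(c, u) \<in> fset C" "i \<in> leaves u" by (auto simp: leaves_Node)
  have u: "admissible_tree G \<rho> u" using admissible_child Node.prems(1) cu(1) .
  obtain h where "h \<in> carrier G" "lab u i = h <# root_label G u" using Node.IH[OF cu(1) u cu(2)] ..
  moreover obtain g where "g \<in> carrier G" "c = g <# K"
    using edge_coset[OF Node.prems(1) cu(1)] .
  moreover have "subgroup K G" using subgroup_root_label[OF Node.prems(1)] by simp
  ultimately have "lab (Node K C) i = (g \<otimes> h) <# K"
    using coset_mult_coset[OF _ subgroup_root_label[OF u] root_label_child[OF Node.prems(1) cu(1)]]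
    by (simp add: lab_child[OF Node.prems(1) cu])
  then show ?case using \<open>g \<in> carrier G\<close> \<open>h \<in> carrier G\<close> by auto
qed

lemma lab_child_min:
  assumes "admissible_tree G \<rho> (Node K C)" "(c, u) \<in> fset C" "i \<in> leaves u"
    and "lab u i = root_label G u"
  shows "lab (Node K C) i = c"
proof -
  have "subgroup K G" using subgroup_root_label[OF assms(1)] by simp
  moreover have "subgroup (root_label G u) G"
    using subgroup_root_label[OF admissible_child[OF assms(1,2)]] .
  moreover obtain g where "g \<in> carrier G" "c = g <# K" using edge_coset[OF assms(1,2)] .
  ultimately show ?thesis
    using coset_absorb root_label_child[OF assms(1,2)] lab_child[OF assms(1-3)] assms(4) by simp
qed

text \<open>Every edge on the path to the smallest leaf is normalised by the last clause of
  \<open>admissible_vertex\<close>, so the product along this path is the root label itself.\<close>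

lemma lab_min: "admissible_tree G \<rho> t \<Longrightarrow> lab t (Min (leaves t)) = root_label G t"
proof (induction t rule: ltree_induct)
  case (Node K C)
  let ?m = "Min (leaves (Node K C))"
  have "?m \<in> leaves (Node K C)"
    using Min_in[OF finite_leaves leaves_nonempty[OF Node.prems]] .
  then obtain c u where cu: "(c, u) \<in> fset C" "?m \<in> leaves u" by (auto simp: leaves_Node)
  have u: "admissible_tree G \<rho> u" using admissible_child Node.prems(1) cu(1) .
  have "Min (leaves u) = ?m"
    by (intro Min_eqI finite_leaves cu Min_le) (use leaves_child[OF cu(1)] in blast)
  then have "lab u ?m = root_label G u" using Node.IH[OF cu(1) u] by simp
  then have "lab (Node K C) ?m = c" using lab_child_min[OF Node.prems cu] by simp
  moreover have "c = \<one> <# K" using admissible_NodeD(8)[OF Node.prems cu] .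
  moreover have "subgroup K G" using subgroup_root_label[OF Node.prems] by simp
  ultimately show ?case by (simp add: lcos_mult_one subgroup.subset)
qed simp

lemma lab_subset:
  assumes "admissible_tree G \<rho> t"
  shows "lab t i \<subseteq> carrier G"
proof (cases "i \<in> leaves t")
  case True
  then obtain g where "g \<in> carrier G" "lab t i = g <# root_label G t"
    using lab_coset[OF assms] by blast
  then show ?thesis
    using l_coset_subset_G[OF subgroup.subset[OF subgroup_root_label[OF assms]]] by simp
qed (simp add: lab_outside)

text \<open>Left multiplication by \<open>g\<close> permutes the cosets of \<open>K\<close>, and
  commutativity makes the stabiliser of each of them \<open>K\<close> itself. This is what
  identifies isotropy with the root label in \<open>isotropy_rel\<close>.\<close>

lemma coset_stabilizer:
  assumes "subgroup K G" "a \<in> carrier G" "g \<in> carrier G"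
  shows "a <# K = g <# (a <# K) \<longleftrightarrow> g \<in> K"
proof -
  interpret K: subgroup K G by fact
  have *: "g <# (a <# K) = a <# (g <# K)"
    using assms K.subset by (simp add: lcos_m_assoc m_comm)
  show ?thesis
  proof
    assume "a <# K = g <# (a <# K)"
    then have "inv a <# (a <# K) = inv a <# (a <# (g <# K))" using * by simp
    moreover have "inv a \<otimes> (a \<otimes> g) = g" using assms by (simp add: m_assoc[symmetric])
    ultimately have "K = g <# K"
      using assms K.subset by (simp add: lcos_m_assoc lcos_mult_one)
    then show "g \<in> K" using assms(3) K.one_closed by (force simp: l_coset_def)
  next
    assume "g \<in> K"
    then show "a <# K = g <# (a <# K)" using * coset_join3[OF assms(3,1)] by simp
  qed
qed



text \<open>Passing from a child to its parent multiplies both path cosets by the same edge coset,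
  which preserves the equation between them.\<close>

lemma rel_child:
  assumes "admissible_tree G \<rho> (Node K C)" "(c, u) \<in> fset C"
  shows "rel u \<subseteq> rel (Node K C)"
proof safe
  fix i j g assume "(i, j, g) \<in> rel u"
  then have *: "i \<in> leaves u" "j \<in> leaves u" "g \<in> carrier G" "lab u i = g <# lab u j"
    by (auto simp: rel_def)
  obtain x where x: "x \<in> carrier G" "c = x <# K" using edge_coset[OF assms] .
  have u: "admissible_tree G \<rho> u" using admissible_child[OF assms] .
  have K: "subgroup K G" using subgroup_root_label[OF assms(1)] by simp
  have P: "subgroup (root_label G u) G" using subgroup_root_label[OF u] .
  have PK: "root_label G u \<subseteq> K" using root_label_child[OF assms] .
  obtain y where y: "y \<in> carrier G" "lab u j = y <# root_label G u" using lab_coset[OF u *(2)] ..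
  have "lab u i = (g \<otimes> y) <# root_label G u"
    using * y P by (simp add: lcos_m_assoc subgroup.subset)
  then have "lab (Node K C) i = (x \<otimes> (g \<otimes> y)) <# K"
    using lab_child[OF assms *(1)] coset_mult_coset[OF K P PK] x * y by simp
  moreover have "lab (Node K C) j = (x \<otimes> y) <# K"
    using lab_child[OF assms *(2)] coset_mult_coset[OF K P PK] x y by simp
  moreover have "x \<otimes> (g \<otimes> y) = g \<otimes> (x \<otimes> y)" using x y * by (simp add: m_lcomm)
  ultimately have "lab (Node K C) i = g <# lab (Node K C) j"
    using x y * K by (simp add: lcos_m_assoc subgroup.subset)
  then show "(i, j, g) \<in> rel (Node K C)"
    using * leaves_child[OF assms(2)] unfolding rel_def by blast
qed

lemma only_child:
  assumes "admissible_tree G \<rho> (Node K C)" "(c, u) \<in> fset C" "leaves u = leaves (Node K C)"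
  shows "C = {|(c, u)|}"
proof -
  have "(c', u') = (c, u)" if e: "(c', u') \<in> fset C" for c' u'
  proof -
    obtain i where "i \<in> leaves u'"
      using leaves_nonempty[OF admissible_child[OF assms(1) e]] by blast
    then show ?thesis
      using children_disjoint[OF assms(1) assms(2) e] leaves_child[OF e, of K] assms(3) by blast
  qed
  then have "fset C \<subseteq> {(c, u)}" by (intro subrelI) simp
  then have "fset C = {(c, u)}" using assms(2) by blast
  then show ?thesis by (metis bot_fset.rep_eq finsert.rep_eq fset_inject)
qed

lemma supp_rel:
  assumes "admissible_tree G \<rho> t"
  shows "supp (rel t) = leaves t"
proof -
  have "(i, i, \<one>) \<in> rel t" if "i \<in> leaves t" for i
    using that lcos_mult_one[OF lab_subset[OF assms]] by (simp add: rel_def)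
  then show ?thesis by (force simp: supp_def rel_def)
qed

lemma isotropy_rel:
  assumes "admissible_tree G \<rho> t"
  shows "isotropy (rel t) = root_label G t"
proof -
  note K = subgroup_root_label[OF assms]
  have "(i, i, g) \<in> rel t \<longleftrightarrow> g \<in> root_label G t" if i: "i \<in> leaves t" for i g
  proof -
    obtain a where "a \<in> carrier G" "lab t i = a <# root_label G t"
      using lab_coset[OF assms i] by blast
    then show ?thesis
      using i coset_stabilizer[OF K] subgroup.mem_carrier[OF K] by (auto simp: rel_def)
  qed
  moreover have "(i, i, g) \<in> rel t \<Longrightarrow> i \<in> leaves t" for i g by (simp add: rel_def)
  ultimately show ?thesis using leaves_nonempty[OF assms] by (auto simp: isotropy_def)
qed

lemma rel_gains:
  assumes t: "admissible_tree G \<rho> (Node K C)"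
  shows "rel (Node K C) \<in> gains (leaves (Node K C))"
proof -
  let ?t = "Node K C"
  have K: "subgroup K G" using subgroup_root_label[OF t] by simp
  note sub = lab_subset[OF t]
  have 1: "(j, i, inv g) \<in> rel ?t" if "(i, j, g) \<in> rel ?t" for i j g
    using that sub by (auto simp: rel_def lcos_m_assoc lcos_mult_one)
  have 2: "(i, k, g \<otimes> h) \<in> rel ?t" if "(i, j, g) \<in> rel ?t" "(j, k, h) \<in> rel ?t" for i j k g h
    using that sub by (auto simp: rel_def lcos_m_assoc)
  have 3: "\<exists>g. (i, j, g) \<in> rel ?t" if ij: "i \<in> leaves ?t" "j \<in> leaves ?t" for i j
  proof -
    obtain a b where ab: "a \<in> carrier G" "lab ?t i = a <# K" "b \<in> carrier G" "lab ?t j = b <# K"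
      using lab_coset[OF t] ij by (metis root_label.simps(2))
    then have "lab ?t i = (a \<otimes> inv b) <# lab ?t j"
      using K by (simp add: lcos_m_assoc subgroup.subset m_assoc)
    moreover have "a \<otimes> inv b \<in> carrier G" using ab by simp
    ultimately have "(i, j, a \<otimes> inv b) \<in> rel ?t" using ij by (simp add: rel_def)
    then show ?thesis ..
  qed
  \<comment> \<open>Both conditions on an only child are used here. A trivial relation has one leaf
    and label {e}, so the root has an only child. It cannot be a leaf below {e}, and an internal
    vertex would need a label strictly inside {e}.\<close>
  have 4: "rel ?t \<noteq> {(i, i, \<one>)}" for i
  proof
    assume *: "rel ?t = {(i, i, \<one>)}"
    have "K = {\<one>}" using isotropy_rel[OF t] by (simp add: * isotropy_def)
    have l: "leaves ?t = {i}" using supp_rel[OF t] by (simp add: * supp_def)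
    then have "i \<in> leaves ?t" by simp
    then obtain c u where cu: "(c, u) \<in> fset C" "i \<in> leaves u" by (auto simp: leaves_Node)
    then have "leaves u = leaves ?t" using leaves_child[OF cu(1), of K] unfolding l by blast
    from only_child[OF t cu(1) this] have C: "C = {|(c, u)|}" .
    show False
    proof (cases u)
      case (Leaf j)
      then show ?thesis using admissible_NodeD(6)[OF t] C \<open>K = {\<one>}\<close> by blast
    next
      case (Node P D)
      then have "P \<subset> K" using admissible_NodeD(5)[OF t] C by blast
      moreover have "\<one> \<in> P"
        using subgroup_root_label[OF admissible_child[OF t cu(1)]] Node
        by (simp add: subgroup.one_closed)
      ultimately show ?thesis using \<open>K = {\<one>}\<close> by blast
    qed
  qed
  have 5: "rel ?t \<noteq> {}" using supp_rel[OF t] leaves_nonempty[OF t] by (auto simp: supp_def)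
  have 6: "rel ?t \<subseteq> leaves ?t \<times> leaves ?t \<times> carrier G" by (auto simp: rel_def)
  have 7: "isotropy (rel ?t) \<in> closed_subgroups G \<rho>"
    using isotropy_rel[OF t] admissible_NodeD(2)[OF t] by simp
  show ?thesis by (rule gainsI) (use 1 2 3 4 5 6 7 supp_rel[OF t] in simp_all)
qed

text \<open>Equal relations have equal leaf sets, so the child is an only child; then its label,
  which is the isotropy group, is strictly smaller.\<close>

lemma rel_child_strict:
  assumes t: "admissible_tree G \<rho> (Node K C)" and e: "(c, Node P D) \<in> fset C"
  shows "rel (Node P D) \<noteq> rel (Node K C)"
proof
  assume *: "rel (Node P D) = rel (Node K C)"
  have u: "admissible_tree G \<rho> (Node P D)" using admissible_child[OF t e] .
  have "leaves (Node P D) = leaves (Node K C)" using * supp_rel[OF t] supp_rel[OF u] by simp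
  then have "P \<subset> K" using only_child[OF t e] admissible_NodeD(5)[OF t] by blast
  then show False using * isotropy_rel[OF t] isotropy_rel[OF u] by simp
qed

lemma fam_Leaf [simp]: "fam (Leaf i) = {}"
  by (simp add: fam_def)

lemma fam_Node: "fam (Node K C) = insert (rel (Node K C)) (forest_family (snd ` fset C))"
  unfolding fam_def forest_family_def subtrees_Node by fastforce

lemma rel_in_fam [simp]: "rel (Node K C) \<in> fam (Node K C)"
  by (simp add: fam_Node)

lemma children_forest:
  assumes t: "admissible_tree G \<rho> (Node K C)"
  shows "forest_on (leaves (Node K C)) (snd ` fset C)"
proof -
  have "pairwise (\<lambda>t u. leaves t \<inter> leaves u = {}) (snd ` fset C)"
    using children_disjoint[OF t] by (fastforce simp: pairwise_def)
  moreover have "(\<Union>u\<in>snd ` fset C. leaves u) = leaves (Node K C)" by (force simp: leaves_Node)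
  moreover have "\<forall>u\<in>snd ` fset C. admissible_tree G \<rho> u" using admissible_child[OF t] by auto
  moreover have "u = u'"
    if e: "(c, u) \<in> fset C" "has_vertex_labelled (carrier G) u"
      and e': "(c', u') \<in> fset C" "has_vertex_labelled (carrier G) u'" for c u c' u'
  proof -
    \<comment> \<open>Labels only grow towards the root, so a vertex labelled
      \<open>carrier G\<close> forces this label on the root of its subtree and on the parent. The
      parent then allows only one such child.\<close>
    have root: "\<exists>D. u = Node (carrier G) D"
      if e: "(c, u) \<in> fset C" "has_vertex_labelled (carrier G) u" for c u
    proof -
      obtain P D where [simp]: "u = Node P D" using e(2) by (cases u) auto
      have u: "admissible_tree G \<rho> (Node P D)" using admissible_child[OF t e(1)] by simp
      have "carrier G = P \<or> (\<exists>(c, u)\<in>fset D. has_vertex_labelled (carrier G) u)"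
        using e(2) unfolding has_vertex_labelled_def by (auto simp: subtrees_Node)
      then have "carrier G \<subseteq> P" using admissible_NodeD(4)[OF u] by blast
      moreover have "P \<subseteq> carrier G" using subgroup_root_label[OF u] subgroup.subset by force
      ultimately show ?thesis by simp
    qed
    obtain D where D: "u = Node (carrier G) D" using root[OF e] ..
    obtain D' where D': "u' = Node (carrier G) D'" using root[OF e'] ..
    have "carrier G \<subseteq> K" using root_label_child[OF t e(1)] D by simp
    then have "K = carrier G" using subgroup_root_label[OF t] subgroup.subset by force
    then have "D = D'" using admissible_NodeD(7)[OF t] e(1) e'(1) D D' by blast
    then show ?thesis using D D' by simp
  qed
  ultimately show ?thesis unfolding forest_on_def by force
qed

lemma labelled_iff_fam:
  assumes "admissible_tree G \<rho> t"
  shows "has_vertex_labelled K t \<longleftrightarrow> (\<exists>R\<in>fam t. isotropy R = K)"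
  using isotropy_rel[OF admissible_subtree[OF assms]]
  unfolding fam_def has_vertex_labelled_def by fastforce

text \<open>Distinct trees have disjoint leaves and at most one tree carries the label G, which is
  the third alternative of \<open>compatible\<close>. The hypothesis \<open>fam\<close> lets
  \<open>fam_families\<close> apply this inside its induction;
  \<open>forest_family_in_families\<close> discharges it afterwards.\<close>

lemma forest_family_families:
  assumes F: "forest_on A F" and fam: "\<And>t. t \<in> F \<Longrightarrow> fam t \<in> families (leaves t)"
  shows "forest_family F \<in> families A"
proof -
  have gain: "R \<in> gains A" if "t \<in> F" "R \<in> fam t" for t R
    using families_sub[OF fam[OF that(1)] that(2)] gains_mono[of "leaves t" A] F that(1)
    unfolding forest_on_def by blast
  have "compatible R R'" if t: "t \<in> F" "R \<in> fam t" and t': "t' \<in> F" "R' \<in> fam t'" for t t' R R'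
  proof (cases "t = t'")
    case True
    then show ?thesis using families_compatible[OF fam[OF t(1)] t(2)] t'(2) by simp
  next
    case False
    have "leaves t \<inter> leaves t' = {}"
      using F t(1) t'(1) False by (auto simp: forest_on_def pairwise_def)
    then have "supp R \<inter> supp R' = {}"
      using supp_subset[OF families_sub[OF fam[OF t(1)] t(2)]]
        supp_subset[OF families_sub[OF fam[OF t'(1)] t'(2)]] by blast
    moreover have "admissible_tree G \<rho> t" "admissible_tree G \<rho> t'"
      using F t(1) t'(1) by (auto simp: forest_on_def)
    then have "\<not> (isotropy R = carrier G \<and> isotropy R' = carrier G)"
      using F t t' False unfolding forest_on_def by (metis labelled_iff_fam)
    ultimately show ?thesis unfolding compatible_def by blast
  qed
  then show ?thesis unfolding families_def forest_family_def using gain by blast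
qed

lemma fam_families:
  "admissible_tree G \<rho> t \<Longrightarrow> fam t \<in> families (leaves t)"
  "admissible_tree G \<rho> t \<Longrightarrow> R \<in> fam t \<Longrightarrow> R \<subseteq> rel t"
proof (induction t arbitrary: R rule: ltree_induct)
  case (Leaf i)
  { case 1 then show ?case by (simp add: families_def) }
  { case 2 then show ?case by simp }
next
  case (Node K C)
  have le: "R \<subseteq> rel (Node K C)"
    if t: "admissible_tree G \<rho> (Node K C)" and R: "R \<in> fam (Node K C)" for R
  proof -
    consider "R = rel (Node K C)" | c u where "(c, u) \<in> fset C" "R \<in> fam u"
      using R by (auto simp: fam_Node forest_family_def)
    then show ?thesis
    proof cases
      case (2 c u)
      then show ?thesis
        using Node(2)[OF 2(1) admissible_child[OF t 2(1)] 2(2)] rel_child[OF t 2(1)] by simp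
    qed simp
  qed
  { case 2 then show ?case by (rule le) }
  { case 1
    have "forest_family (snd ` fset C) \<in> families (leaves (Node K C))"
      using Node(1) admissible_child[OF 1]
      by (intro forest_family_families[OF children_forest[OF 1]]) auto
    then show ?case
      using rel_gains[OF 1] le[OF 1] compatible_sym
      unfolding families_def fam_Node by (auto simp: compatible_def) }
qed


section \<open>The correspondence is a bijection\<close>

definition maxes :: "(nat \<times> nat \<times> 'g) set set \<Rightarrow> (nat \<times> nat \<times> 'g) set set" where
  "maxes S = {R \<in> S. \<forall>R'\<in>S. R \<subseteq> R' \<longrightarrow> R' = R}"

lemma fam_gains: "admissible_tree G \<rho> t \<Longrightarrow> R \<in> fam t \<Longrightarrow> R \<in> gains (leaves t)"
  using fam_families(1) families_sub by blast

lemma forest_family_in_families: "forest_on A F \<Longrightarrow> forest_family F \<in> families A"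
  by (rule forest_family_families) (auto simp: forest_on_def fam_families)

lemma rel_in_forest_family: "Node K C \<in> F \<Longrightarrow> rel (Node K C) \<in> forest_family F"
  unfolding forest_family_def by (erule UN_I) (rule rel_in_fam)

lemma forest_onD:
  assumes "forest_on A F" "t \<in> F"
  shows "admissible_tree G \<rho> t" "leaves t \<subseteq> A"
  using assms by (auto simp: forest_on_def)

lemma forest_unique:
  assumes "forest_on A F" "t \<in> F" "u \<in> F" "i \<in> leaves t" "i \<in> leaves u"
  shows "u = t"
proof (rule ccontr)
  assume "u \<noteq> t"
  then have "leaves t \<inter> leaves u = {}" using assms(1-3) by (auto simp: forest_on_def pairwise_def)
  then show False using assms(4,5) by blast
qed

lemma forest_obtain:
  assumes "forest_on A F" "i \<in> A"
  obtains t where "t \<in> F" "i \<in> leaves t"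
  using assms by (auto simp: forest_on_def)

lemma forest_family_obtain:
  assumes "forest_on A F" "R \<in> forest_family F"
  obtains K C where "Node K C \<in> F" "R \<in> fam (Node K C)" "R \<subseteq> rel (Node K C)"
proof -
  obtain t where t: "t \<in> F" "R \<in> fam t" using assms(2) by (auto simp: forest_family_def)
  then show ?thesis
    using that fam_families(2)[OF forest_onD(1)[OF assms(1) t(1)] t(2)] by (cases t) auto
qed

lemma forest_finite:
  assumes "forest_on A F" "finite A"
  shows "finite F"
proof (rule inj_on_finite)
  show "inj_on leaves F"
  proof (rule inj_onI)
    fix t u assume tu: "t \<in> F" "u \<in> F" "leaves t = leaves u"
    obtain i where "i \<in> leaves t"
      using leaves_nonempty[OF forest_onD(1)[OF assms(1) tu(1)]] by blast
    then show "t = u" using forest_unique[OF assms(1) tu(2,1), of i] tu(3) by simp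
  qed
  show "leaves ` F \<subseteq> Pow A" using forest_onD(2)[OF assms(1)] by blast
qed (use assms(2) in simp)

text \<open>A member below the root relation of a tree shares a leaf with that tree, and the trees
  of a forest are disjoint. So each tree's own family can be cut out of the family of the
  forest.\<close>

lemma fam_eq_below:
  assumes F: "forest_on A F" and t: "Node K C \<in> F"
  shows "fam (Node K C) = {X \<in> forest_family F. X \<subseteq> rel (Node K C)}"
proof (intro equalityI subsetI)
  fix X assume "X \<in> fam (Node K C)"
  then show "X \<in> {X \<in> forest_family F. X \<subseteq> rel (Node K C)}"
    using fam_families(2)[OF forest_onD(1)[OF F t]] t by (auto simp: forest_family_def)
next
  fix X assume "X \<in> {X \<in> forest_family F. X \<subseteq> rel (Node K C)}"
  then have X: "X \<in> forest_family F" "X \<subseteq> rel (Node K C)" by simp_all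
  obtain u where u: "u \<in> F" "X \<in> fam u" using X(1) by (auto simp: forest_family_def)
  have g: "X \<in> gains (leaves u)" using fam_gains[OF forest_onD(1)[OF F u(1)] u(2)] .
  obtain i where i: "i \<in> supp X" using supp_nonempty[OF g] by blast
  have "i \<in> leaves u" using supp_subset[OF g] i by blast
  moreover have "i \<in> leaves (Node K C)"
    using supp_mono[OF X(2)] supp_rel[OF forest_onD(1)[OF F t]] i by blast
  ultimately have "u = Node K C" using forest_unique[OF F t u(1)] by blast
  then show "X \<in> fam (Node K C)" using u(2) by simp
qed

lemma rel_maximal:
  assumes F: "forest_on A F" and t: "Node K C \<in> F"
    and R: "R \<in> forest_family F" "rel (Node K C) \<subseteq> R"
  shows "R = rel (Node K C)"
proof -
  obtain K' C' where u: "Node K' C' \<in> F" "R \<subseteq> rel (Node K' C')"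
    using forest_family_obtain[OF F R(1)] by metis
  have a: "admissible_tree G \<rho> (Node K C)" "admissible_tree G \<rho> (Node K' C')"
    using forest_onD(1)[OF F] t u by auto
  obtain i where "i \<in> leaves (Node K C)" using leaves_nonempty[OF a(1)] by blast
  moreover from this have "i \<in> leaves (Node K' C')"
    using supp_mono[of "rel (Node K C)" "rel (Node K' C')"] R(2) u(2) supp_rel[OF a(1)]
      supp_rel[OF a(2)] by auto
  ultimately have "Node K' C' = Node K C" using forest_unique[OF F t u(1)] by blast
  then show ?thesis using R(2) u(2) by simp
qed

text \<open>Lifts injectivity from trees to forests. It is taken as the hypothesis
  \<open>inj\<close> because \<open>fam_inj\<close> applies this to the children of a vertex, where
  only the induction hypothesis is available. Roots are matched as maximal members, fallen leaves as
  indices outside all supports.\<close>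

lemma forest_inj_step:
  assumes F: "forest_on A F" and F': "forest_on A F'"
    and eq: "forest_family F' = forest_family F"
    and inj: "\<And>t t'. t \<in> F \<Longrightarrow> admissible_tree G \<rho> t' \<Longrightarrow> leaves t' = leaves t \<Longrightarrow> fam t' = fam t
      \<Longrightarrow> t' = t"
  shows "F' = F"
proof -
  have sub: "t \<in> F'" if t: "t \<in> F" for t
  proof (cases t)
    case (Leaf i)
    have "i \<in> A" using forest_onD(2)[OF F t] Leaf by simp
    then obtain u where u: "u \<in> F'" "i \<in> leaves u" using forest_obtain[OF F'] by blast
    show ?thesis
    proof (cases u)
      case (Node P D)
      have au: "admissible_tree G \<rho> u" using forest_onD(1)[OF F' u(1)] .
      have "rel u \<in> forest_family F"
        using u(1) Node eq rel_in_forest_family[of P D F'] by simp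
      then obtain v where v: "v \<in> F" "rel u \<in> fam v" by (auto simp: forest_family_def)
      have "supp (rel u) \<subseteq> leaves v"
        using supp_subset[OF fam_gains[OF forest_onD(1)[OF F v(1)] v(2)]] .
      then have "i \<in> leaves v" using u(2) supp_rel[OF au] by blast
      then have "v = t" using forest_unique[OF F t v(1)] Leaf by simp
      then show ?thesis using v(2) Leaf by simp
    qed (use u Leaf in auto)
  next
    case (Node P D)
    have at: "admissible_tree G \<rho> t" using forest_onD(1)[OF F t] .
    have "rel t \<in> forest_family F'"
      using t Node eq rel_in_forest_family[of P D F] by simp
    then obtain P' D' where u: "Node P' D' \<in> F'" "rel t \<subseteq> rel (Node P' D')"
      using forest_family_obtain[OF F'] by metis
    let ?u = "Node P' D'"
    have au: "admissible_tree G \<rho> ?u" using forest_onD(1)[OF F' u(1)] .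
    have "rel ?u \<in> forest_family F"
      using rel_in_forest_family[OF u(1)] eq by simp
    then have r: "rel ?u = rel t" using rel_maximal[OF F] t Node u(2) by blast
    have "fam ?u = {X \<in> forest_family F'. X \<subseteq> rel ?u}" using fam_eq_below[OF F' u(1)] .
    also have "\<dots> = {X \<in> forest_family F. X \<subseteq> rel t}" using eq r by simp
    also have "\<dots> = fam t" using fam_eq_below[OF F] t Node by blast
    finally have "fam ?u = fam t" .
    moreover have "leaves ?u = leaves t" using r supp_rel[OF at] supp_rel[OF au] by simp
    ultimately have "?u = t" using inj[OF t au] by blast
    then show ?thesis using u(1) by simp
  qed
  have "u \<in> F" if u: "u \<in> F'" for u
  proof -
    obtain i where i: "i \<in> leaves u" using leaves_nonempty[OF forest_onD(1)[OF F' u]] by blast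
    then have "i \<in> A" using forest_onD(2)[OF F' u] by blast
    then obtain t where t: "t \<in> F" "i \<in> leaves t" using forest_obtain[OF F] by blast
    then have "u = t" using forest_unique[OF F' sub[OF t(1)] u t(2) i] by simp
    then show ?thesis using t(1) by simp
  qed
  then show ?thesis using sub by blast
qed

lemma coset_self: "subgroup K G \<Longrightarrow> a \<in> carrier G \<Longrightarrow> g \<in> carrier G \<Longrightarrow>
  a <# K = g <# K \<longleftrightarrow> g \<in> a <# K"
  using l_repr_independence[of g a K] subgroup.one_closed[of K G]
  by (force simp: l_coset_def)

text \<open>By \<open>lab_min\<close> the smallest leaf has path coset \<open>K\<close>. A triple
  from \<open>i\<close> to it with gain g thus says that the path coset of \<open>i\<close> is g K,
  that is, contains g.\<close>

lemma lab_from_rel: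
  assumes "admissible_tree G \<rho> (Node K C)" "i \<in> leaves (Node K C)"
  shows "lab (Node K C) i = {g. (i, Min (leaves (Node K C)), g) \<in> rel (Node K C)}"
proof -
  obtain a where a: "a \<in> carrier G" "lab (Node K C) i = a <# K"
    using lab_coset[OF assms] by auto
  have K: "subgroup K G" using subgroup_root_label[OF assms(1)] by simp
  have "Min (leaves (Node K C)) \<in> leaves (Node K C)"
    using Min_in[OF finite_leaves leaves_nonempty[OF assms(1)]] .
  then show ?thesis
    using a K lab_min[OF assms(1)] assms(2) coset_self[OF K a(1)] l_coset_carrier[OF _ a(1) K]
    by (auto simp: rel_def)
qed

text \<open>Inside \<open>u\<close> the smallest leaf has the root label of \<open>u\<close> as path
  coset, and the edge coset absorbs this smaller group. So edge cosets are no extra data: they are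
  values of the path cosets seen from the parent.\<close>

lemma edge_label:
  assumes "admissible_tree G \<rho> (Node K C)" "(c, u) \<in> fset C"
  shows "c = lab (Node K C) (Min (leaves u))"
proof -
  have u: "admissible_tree G \<rho> u" using admissible_child[OF assms] .
  show ?thesis
    using lab_child_min[OF assms Min_in[OF finite_leaves leaves_nonempty[OF u]] lab_min[OF u]]
    by simp
qed

lemma children_from_lab:
  assumes "admissible_tree G \<rho> (Node K C)"
  shows "fset C = (\<lambda>u. (lab (Node K C) (Min (leaves u)), u)) ` snd ` fset C"
proof -
  have "(\<lambda>u. (lab (Node K C) (Min (leaves u)), u)) (snd e) = e" if "e \<in> fset C" for e
    using edge_label[OF assms, of "fst e" "snd e"] that by (simp add: prod_eq_iff)
  then show ?thesis unfolding image_image by simp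
qed

lemma rel_notin_children:
  assumes "admissible_tree G \<rho> (Node K C)"
  shows "rel (Node K C) \<notin> forest_family (snd ` fset C)"
proof
  assume "rel (Node K C) \<in> forest_family (snd ` fset C)"
  then obtain P D where u: "Node P D \<in> snd ` fset C" "rel (Node K C) \<subseteq> rel (Node P D)"
    using forest_family_obtain[OF children_forest[OF assms]] by metis
  then obtain c where "(c, Node P D) \<in> fset C" by force
  then show False using rel_child[OF assms] rel_child_strict[OF assms] u(2) by blast
qed

text \<open>The root relation is the greatest member, hence common to both trees. It yields the
  label as its isotropy group and all path cosets by \<open>lab_from_rel\<close>. Cancelling it
  leaves the families of the children, settled by induction, and \<open>children_from_lab\<close>
  restores the edges.\<close>

lemma fam_inj:
  "admissible_tree G \<rho> t \<Longrightarrow> admissible_tree G \<rho> t' \<Longrightarrow> leaves t' = leaves t \<Longrightarrow> fam t' = fam t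
    \<Longrightarrow> t' = t"
proof (induction t arbitrary: t' rule: ltree_induct)
  case (Leaf i)
  then show ?case by (cases t') (auto simp: fam_Node)
next
  case (Node K C)
  let ?t = "Node K C"
  note t = Node.prems(1) and t' = Node.prems(2)
  obtain K' C' where t'_eq [simp]: "t' = Node K' C'"
    using Node.prems(4) by (cases t') (auto simp: fam_Node)
  have "rel ?t \<in> fam t'" "rel t' \<in> fam ?t" using Node.prems(4) rel_in_fam t'_eq by metis+
  then have "rel ?t \<subseteq> rel t'" "rel t' \<subseteq> rel ?t"
    using fam_families(2)[OF t'] fam_families(2)[OF t] by blast+
  then have r: "rel t' = rel ?t" by blast
  have K: "K' = K" using isotropy_rel[OF t] isotropy_rel[OF t'] r by simp
  have l: "lab t' i = lab ?t i" if "i \<in> leaves ?t" for i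
    using lab_from_rel[OF t that] lab_from_rel[of K' C' i] that t' Node.prems(3) r by simp
  have lab: "lab t' = lab ?t"
    using l lab_outside[of _ t'] lab_outside[of _ ?t] Node.prems(3) by fastforce
  have ff: "forest_family (snd ` fset C') = forest_family (snd ` fset C)"
    using Node.prems(4) rel_notin_children[OF t] rel_notin_children[of K' C'] t' r
    by (simp add: fam_Node insert_ident)
  have "snd ` fset C' = snd ` fset C"
  proof (rule forest_inj_step[OF children_forest[OF t] _ ff])
    show "forest_on (leaves ?t) (snd ` fset C')"
      using children_forest[of K' C'] t' Node.prems(3) by simp
    fix u u' assume u: "u \<in> snd ` fset C" "admissible_tree G \<rho> u'" "leaves u' = leaves u"
      "fam u' = fam u"
    then obtain c where c: "(c, u) \<in> fset C" by force
    then show "u' = u" using Node.IH[OF c admissible_child[OF t c] u(2-4)] by simp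
  qed
  then have "fset C' = fset C"
    using children_from_lab[OF t] children_from_lab[of K' C'] t' lab by simp
  then show ?case using K by (simp add: fset_inject)
qed

lemma forest_family_inj:
  assumes "forest_on A F" "forest_on A F'" "forest_family F' = forest_family F"
  shows "F' = F"
  using forest_inj_step[OF assms] fam_inj forest_onD(1)[OF assms(1)] by blast

text \<open>Inverts the passage to children: a vertex for \<open>R\<close> is put above a forest
  whose relations lie strictly below \<open>R\<close>. Its data are forced, namely the isotropy
  group as label and, by \<open>edge_label\<close> and \<open>lab_from_rel\<close>, the coset of
  gains from the least leaf of each subtree to the least index.\<close>

lemma graft:
  assumes R: "R \<in> gains A" and fin: "finite (supp R)" and F: "forest_on (supp R) F"
    and below: "\<And>X. X \<in> forest_family F \<Longrightarrow> X \<subset> R"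
  shows "\<exists>t. admissible_tree G \<rho> t \<and> leaves t = supp R \<and> fam t = insert R (forest_family F)"
proof -
  define m where "m = Min (supp R)"
  define L where "L i = {g. (i, m, g) \<in> R}" for i
  define C where "C = Abs_fset ((\<lambda>u. (L (Min (leaves u)), u)) ` F)"
  define K where "K = isotropy R"
  define t where "t = Node K C"
  note adm = forest_onD(1)[OF F]
  have m: "m \<in> supp R" unfolding m_def using Min_in[OF fin supp_nonempty[OF R]] .
  have C: "fset C = (\<lambda>u. (L (Min (leaves u)), u)) ` F"
    unfolding C_def using forest_finite[OF F fin] by (simp add: Abs_fset_inverse)
  have lt: "leaves t = supp R" using F by (simp add: t_def leaves_Node C forest_on_def)
  have K: "subgroup K G" unfolding K_def using isotropy_subgroup[OF R] .
  have L_coset: "\<exists>g\<in>carrier G. (i, m, g) \<in> R \<and> L i = g <# K" if i: "i \<in> supp R" for i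
  proof -
    obtain g where g: "(i, m, g) \<in> R" using gain_connected[OF R i m] ..
    then have "L i = g <# K" using gain_coset[OF R g] by (auto simp: L_def K_def)
    then show ?thesis using g gain_carrier[OF R g] by blast
  qed
  have minleaf: "Min (leaves u) \<in> leaves u" if "u \<in> F" for u
    using Min_in[OF finite_leaves leaves_nonempty[OF adm[OF that]]] .
  have le: "P \<subseteq> K" if u: "u \<in> F" and P: "has_vertex_labelled P u" for u P
  proof -
    obtain X where X: "X \<in> fam u" "isotropy X = P" using labelled_iff_fam[OF adm[OF u]] P by blast
    then have "X \<subset> R" using below u by (auto simp: forest_family_def)
    then show ?thesis using isotropy_mono[of X R] X(2) by (simp add: K_def psubset_imp_subset)
  qed
  have single: "F = {u}" if "C = {|(c, u)|}" for c u
  proof -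
    have "fset C = {(c, u)}" using that by simp
    then have "snd ` fset C = {u}" by simp
    then show ?thesis unfolding C image_image by simp
  qed
  have "admissible_vertex G \<rho> K C"
    unfolding admissible_vertex_def
  proof (intro conjI)
    have "F \<noteq> {}" using F m by (auto simp: forest_on_def)
    then have "fset C \<noteq> {}" using C by simp
    then show "C \<noteq> {||}" by auto
    show "K \<in> closed_subgroups G \<rho>" unfolding K_def using isotropy_closed[OF R] .
    have "\<exists>g\<in>carrier G. L (Min (leaves u)) = g <# K" if u: "u \<in> F" for u
      using L_coset[of "Min (leaves u)"] minleaf[OF u] forest_onD(2)[OF F u] by blast
    then show "\<forall>(c, u)\<in>fset C. \<exists>g\<in>carrier G. c = g <# K" unfolding C by auto
    have "leaves u \<inter> leaves u' = {}" if "u \<in> F" "u' \<in> F" "u \<noteq> u'" for u u'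
      using forest_unique[OF F] that by blast
    then show "pairwise (\<lambda>e e'. leaves (snd e) \<inter> leaves (snd e') = {}) (fset C)"
      unfolding C pairwise_def by auto
    show "\<forall>(c, u)\<in>fset C. \<forall>P. has_vertex_labelled P u \<longrightarrow> P \<subseteq> K" unfolding C using le by auto
    have "P \<subset> K" if "C = {|(c, Node P D)|}" for c P D
    proof -
      let ?u = "Node P D"
      have F1: "F = {?u}" using single[OF that] .
      have u: "admissible_tree G \<rho> ?u" using adm F1 by simp
      have "leaves ?u = supp R" using F F1 by (simp add: forest_on_def)
      then have s: "supp (rel ?u) = supp R" using supp_rel[OF u] by simp
      have r: "rel ?u \<subset> R" using below rel_in_forest_family[of P D F] F1 by simp
      have "P \<subseteq> K" using le[of ?u P] F1 by simp
      \<comment> \<open>An only child has the same support as \<open>R\<close>; the same isotropy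
        group would make its relation equal to \<open>R\<close>.\<close>
      moreover have "P \<noteq> K"
        using gain_eqI[OF rel_gains[OF u] R _ s] r isotropy_rel[OF u] by (auto simp: K_def)
      ultimately show ?thesis by blast
    qed
    then show "\<forall>c P D. C = {|(c, Node P D)|} \<longrightarrow> P \<subset> K" by blast
    have "K \<noteq> {\<one>}" if "C = {|(c, Leaf i)|}" for c i
    proof -
      have "supp R = {i}" using F single[OF that] by (simp add: forest_on_def)
      then show ?thesis unfolding K_def by (rule isotropy_singleton[OF R])
    qed
    then show "\<forall>c i. C = {|(c, Leaf i)|} \<longrightarrow> K \<noteq> {\<one>}" by blast
    have "(c, D) = (c', D')"
      if "(c, Node (carrier G) D) \<in> fset C" "(c', Node (carrier G) D') \<in> fset C" for c D c' D'
    proof -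
      have e: "Node (carrier G) D \<in> F" "Node (carrier G) D' \<in> F"
        "c = L (Min (leaves (Node (carrier G) D)))" "c' = L (Min (leaves (Node (carrier G) D')))"
        using that unfolding C by auto
      then have "Node (carrier G) D = Node (carrier G) D'"
        using F unfolding forest_on_def by (meson labelled_root)
      then show ?thesis using e(3,4) by simp
    qed
    then show "K = carrier G \<longrightarrow>
        (\<forall>c D c' D'. (c, Node (carrier G) D) \<in> fset C \<and> (c', Node (carrier G) D') \<in> fset C
           \<longrightarrow> (c, D) = (c', D'))" by blast
    \<comment> \<open>The least leaf of this subtree is \<open>m\<close> itself, and the gains from
      \<open>m\<close> to \<open>m\<close> form the isotropy group.\<close>
    have "L (Min (leaves u)) = \<one> <# K" if u: "u \<in> F" "m \<in> leaves u" for u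
    proof -
      have "Min (leaves u) = m"
        by (intro Min_eqI finite_leaves u) (use forest_onD(2)[OF F u(1)] fin in \<open>auto simp: m_def\<close>)
      then show ?thesis
        using isotropy_at[OF R m] K by (simp add: L_def K_def lcos_mult_one subgroup.subset)
    qed
    then show "\<forall>(c, u)\<in>fset C. Min (leaves (Node K C)) \<in> leaves u \<longrightarrow> c = \<one> <# K"
      using lt unfolding C t_def m_def by auto
  qed
  then have t: "admissible_tree G \<rho> t" unfolding t_def admissible_Node C using adm by auto
  have lab: "lab t i = L i" if i: "i \<in> supp R" for i
  proof -
    obtain u where u: "u \<in> F" "i \<in> leaves u" using forest_obtain[OF F i] .
    note a = adm[OF u(1)]
    let ?k = "Min (leaves u)" and ?P = "root_label G u"
    have e: "(L ?k, u) \<in> fset C" using u(1) by (simp add: C)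
    have k: "?k \<in> supp R" using minleaf[OF u(1)] forest_onD(2)[OF F u(1)] by blast
    obtain g where g: "g \<in> carrier G" "(?k, m, g) \<in> R" "L ?k = g <# K" using L_coset[OF k] by blast
    obtain h where h: "h \<in> carrier G" "lab u i = h <# ?P" using lab_coset[OF a u(2)] by blast
    \<comment> \<open>Inside \<open>u\<close> the least leaf \<open>?k\<close> has the root label as
      path coset, so \<open>h\<close> is a gain from \<open>i\<close> to \<open>?k\<close> in the
      relation of \<open>u\<close>, which lies below \<open>R\<close>. If \<open>u\<close> is a leaf
      there is no relation, but then \<open>h = \<one>\<close>.\<close>
    have "(i, ?k, h) \<in> R"
    proof (cases u)
      case (Leaf j)
      then have "h = \<one>" using h u(2) by (simp add: l_coset_def)
      then show ?thesis using Leaf u(2) gain_refl[OF R i] by simp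
    next
      case (Node P D)
      have "(i, ?k, h) \<in> rel u"
        using h u(2) minleaf[OF u(1)] lab_min[OF a] by (simp add: rel_def)
      moreover have "rel u \<subset> R"
        using below rel_in_forest_family[of P D F] u(1) Node by simp
      ultimately show ?thesis by blast
    qed
    then have "(i, m, h \<otimes> g) \<in> R" using gain_trans[OF R _ g(2)] by blast
    then have "L i = (h \<otimes> g) <# K" using gain_coset[OF R] unfolding L_def K_def by blast
    moreover have "lab t i = (g \<otimes> h) <# K"
      using lab_child[OF t[unfolded t_def] e u(2)] g h
        coset_mult_coset[OF K subgroup_root_label[OF a] root_label_child[OF t[unfolded t_def] e]]
      by (simp add: t_def)
    ultimately show ?thesis using g h by (simp add: m_comm)
  qed
  have "rel t = R"
  proof (intro equalityI subsetI)
    fix x assume "x \<in> rel t"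
    then obtain i j g where x: "x = (i, j, g)" and *: "i \<in> supp R" "j \<in> supp R" "g \<in> carrier G"
      "L i = g <# L j"
      using lt lab by (auto simp: rel_def)
    obtain y where y: "(j, m, y) \<in> R" using gain_connected[OF R *(2) m] ..
    have yc: "y \<in> carrier G" using gain_carrier[OF R y] .
    have "g \<otimes> y \<in> L i" using y * unfolding *(4) l_coset_def L_def by blast
    then have "(i, j, (g \<otimes> y) \<otimes> inv y) \<in> R"
      using gain_trans[OF R _ gain_sym[OF R y]] by (simp add: L_def)
    then show "x \<in> R" using x * yc by (simp add: m_assoc)
  next
    fix x assume xR: "x \<in> R"
    obtain i j g where x: "x = (i, j, g)" by (metis prod_cases3)
    have ijg: "(i, j, g) \<in> R" using xR x by simp
    have gc: "g \<in> carrier G" using gain_carrier[OF R ijg] .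
    have "y \<in> g <# L j" if "y \<in> L i" for y
    proof -
      have y: "(i, m, y) \<in> R" using that by (simp add: L_def)
      then have "inv g \<otimes> y \<in> L j" using gain_trans[OF R gain_sym[OF R ijg]] by (simp add: L_def)
      moreover have "y = g \<otimes> (inv g \<otimes> y)"
        using gc gain_carrier[OF R y] by (simp add: m_assoc[symmetric])
      ultimately show ?thesis unfolding l_coset_def by blast
    qed
    moreover have "y \<in> L i" if "y \<in> g <# L j" for y
      using that gain_trans[OF R ijg] by (auto simp: l_coset_def L_def)
    ultimately have "L i = g <# L j" by blast
    then show "x \<in> rel t"
      using x gc lt lab gain_supp1[OF R ijg] gain_supp2[OF R ijg] by (simp add: rel_def)
  qed
  moreover have "snd ` fset C = F" unfolding C image_image by simp
  ultimately have "fam t = insert R (forest_family F)" unfolding t_def fam_Node by simp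
  then show ?thesis using t lt by blast
qed

lemma below_maxes:
  assumes "finite S" "R \<in> S"
  shows "\<exists>M\<in>maxes S. R \<subseteq> M"
proof -
  have "finite {X \<in> S. R \<subseteq> X}" "R \<in> {X \<in> S. R \<subseteq> X}" using assms by auto
  from finite_has_maximal2[OF this] obtain M where M: "M \<in> {X \<in> S. R \<subseteq> X}"
    "\<forall>b\<in>{X \<in> S. R \<subseteq> X}. M \<le> b \<longrightarrow> M = b" by blast
  then have "M \<in> maxes S" unfolding maxes_def by blast
  then show ?thesis using M(1) by blast
qed

lemma maxes_disjoint:
  assumes "S \<in> families A" "R \<in> maxes S" "R' \<in> maxes S" "i \<in> supp R" "i \<in> supp R'"
  shows "R' = R"
  using families_meet[OF assms(1) _ _ assms(4,5)] assms(2,3) by (auto simp: maxes_def)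

text \<open>The induction is on the size of the family. The members strictly below a maximal member
  \<open>R\<close> form a smaller family on \<open>supp R\<close>; the forest that it yields is
  grafted under \<open>R\<close>. Distinct maximal members have disjoint supports, so the resulting
  trees fit together.\<close>

lemma forest_family_surj:
  assumes "finite A" "S \<in> families A"
  shows "\<exists>F. forest_on A F \<and> forest_family F = S"
  using assms
proof (induction "card S" arbitrary: S A rule: less_induct)
  case less
  note S = less.prems(2)
  have finS: "finite S" using families_finite[OF S less.prems(1)] .
  have "\<exists>t. admissible_tree G \<rho> t \<and> leaves t = supp R \<and> fam t = {X \<in> S. X \<subseteq> R}"
    if R: "R \<in> maxes S" for R
  proof -
    let ?S = "{X \<in> S. X \<subset> R}"
    have RS: "R \<in> S" using R by (simp add: maxes_def)
    have Rg: "R \<in> gains A" using families_sub[OF S RS] .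
    have fin: "finite (supp R)" using supp_subset[OF Rg] less.prems(1) finite_subset by blast
    have "?S \<subset> S" using RS by blast
    then have "card ?S < card S" using finS psubset_card_mono by blast
    moreover have "?S \<in> families (supp R)"
      by (rule families_subset[OF S]) (use supp_mono in blast)+
    ultimately obtain F where F: "forest_on (supp R) F" "forest_family F = ?S"
      using less.hyps fin by blast
    have "insert R ?S = {X \<in> S. X \<subseteq> R}" using RS by blast
    then show ?thesis using graft[OF Rg fin F(1)] F(2) by simp
  qed
  then have "\<forall>R\<in>maxes S. \<exists>t. admissible_tree G \<rho> t \<and> leaves t = supp R \<and>
      fam t = {X \<in> S. X \<subseteq> R}" by (rule ballI)
  from bchoice[OF this] obtain T where
    T': "\<forall>R\<in>maxes S. admissible_tree G \<rho> (T R) \<and> leaves (T R) = supp R \<and>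
      fam (T R) = {X \<in> S. X \<subseteq> R}" ..
  have T: "\<And>R. R \<in> maxes S \<Longrightarrow> admissible_tree G \<rho> (T R)"
    "\<And>R. R \<in> maxes S \<Longrightarrow> leaves (T R) = supp R"
    "\<And>R. R \<in> maxes S \<Longrightarrow> fam (T R) = {X \<in> S. X \<subseteq> R}"
    using T' by simp_all
  let ?U = "\<Union> (supp ` S)"
  \<comment> \<open>Indices that lie in no support become fallen leaves.\<close>
  define F where "F = T ` maxes S \<union> Leaf ` (A - ?U)"
  have max: "R \<in> S" if "R \<in> maxes S" for R using that by (simp add: maxes_def)
  have "leaves t \<inter> leaves u = {}" if "t \<in> F" "u \<in> F" "t \<noteq> u" for t u
  proof (rule ccontr)
    assume "leaves t \<inter> leaves u \<noteq> {}"
    then obtain i where i: "i \<in> leaves t" "i \<in> leaves u" by blast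
    show False
      using that i T(2) max unfolding F_def by (auto dest: maxes_disjoint[OF S])
  qed
  moreover have "(\<Union>t\<in>F. leaves t) = A"
  proof -
    have "(\<Union>R\<in>maxes S. supp R) = ?U"
    proof
      show "?U \<subseteq> (\<Union>R\<in>maxes S. supp R)"
      proof
        fix i assume "i \<in> ?U"
        then obtain X where X: "X \<in> S" "i \<in> supp X" by blast
        then obtain M where "M \<in> maxes S" "X \<subseteq> M" using below_maxes[OF finS] by blast
        then show "i \<in> (\<Union>R\<in>maxes S. supp R)" using supp_mono[of X M] X(2) by blast
      qed
    qed (use max in blast)
    moreover have "?U \<subseteq> A" using supp_subset[OF families_sub[OF S]] by blast
    ultimately show ?thesis unfolding F_def using T(2) by auto
  qed
  moreover have "admissible_tree G \<rho> t" if "t \<in> F" for t using that T(1) by (auto simp: F_def)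
  moreover have "t = u" if t: "t \<in> F" "has_vertex_labelled (carrier G) t"
    and u: "u \<in> F" "has_vertex_labelled (carrier G) u" for t u
  proof -
    have *: "\<exists>R\<in>maxes S. t = T R \<and> (\<exists>X\<in>S. X \<subseteq> R \<and> isotropy X = carrier G)"
      if t: "t \<in> F" "has_vertex_labelled (carrier G) t" for t
    proof -
      obtain R where R: "R \<in> maxes S" "t = T R" using t by (auto simp: F_def)
      then show ?thesis using t(2) labelled_iff_fam[OF T(1)[OF R(1)]] T(3)[OF R(1)] by auto
    qed
    obtain R X where R: "R \<in> maxes S" "t = T R" "X \<in> S" "X \<subseteq> R" "isotropy X = carrier G"
      using *[OF t] by blast
    obtain R' X' where R': "R' \<in> maxes S" "u = T R'" "X' \<in> S" "X' \<subseteq> R'" "isotropy X' = carrier G"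
      using *[OF u] by blast
    \<comment> \<open>Two members with isotropy \<open>carrier G\<close> are not compatible by
      disjointness, so they are comparable and lie under the same maximal member.\<close>
    have "X \<subseteq> X' \<or> X' \<subseteq> X"
      using families_compatible[OF S R(3) R'(3)] R(5) R'(5) by (simp add: compatible_def)
    then obtain i where "i \<in> supp X" "i \<in> supp X'"
      using gain_mono_supp[OF families_sub[OF S R(3)]] gain_mono_supp[OF families_sub[OF S R'(3)]]
      by blast
    then have "i \<in> supp R" "i \<in> supp R'" using supp_mono R(4) R'(4) by blast+
    then show ?thesis using maxes_disjoint[OF S R(1) R'(1)] R(2) R'(2) by blast
  qed
  ultimately have "forest_on A F" unfolding forest_on_def pairwise_def by blast
  moreover have "forest_family F = S"
  proof -
    have "forest_family F = (\<Union>R\<in>maxes S. {X \<in> S. X \<subseteq> R})"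
      unfolding forest_family_def F_def using T(3) by auto
    also have "\<dots> = S" using below_maxes[OF finS] by blast
    finally show ?thesis .
  qed
  ultimately show ?case by blast
qed

lemma bij_forest_family:
  assumes "finite A"
  shows "bij_betw forest_family {F. forest_on A F} (families A)"
  by (rule bij_betwI')
    (use forest_family_inj forest_family_in_families in \<open>auto dest: forest_family_surj[OF assms]\<close>)

lemma fallen_leaves_family:
  assumes F: "forest_on A F"
  shows "fallen_leaves F = A - \<Union> (supp ` forest_family F)"
proof (intro equalityI subsetI)
  fix i assume "i \<in> fallen_leaves F"
  then have i: "Leaf i \<in> F" by (simp add: fallen_leaves_def)
  have "i \<notin> supp X" if X: "X \<in> forest_family F" for X
  proof
    assume iX: "i \<in> supp X"
    obtain K C where t: "Node K C \<in> F" "X \<in> fam (Node K C)"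
      using forest_family_obtain[OF F X] by metis
    have "i \<in> leaves (Node K C)"
      using supp_subset[OF fam_gains[OF forest_onD(1)[OF F t(1)] t(2)]] iX by blast
    then show False using forest_unique[OF F i t(1), of i] by simp
  qed
  then show "i \<in> A - \<Union> (supp ` forest_family F)" using forest_onD(2)[OF F i] by simp
next
  fix i assume i: "i \<in> A - \<Union> (supp ` forest_family F)"
  then obtain t where t: "t \<in> F" "i \<in> leaves t" using forest_obtain[OF F] by blast
  show "i \<in> fallen_leaves F"
  proof (cases t)
    case (Leaf j)
    then show ?thesis using t by (simp add: fallen_leaves_def)
  next
    case (Node K C)
    then have "rel t \<in> forest_family F" using rel_in_forest_family t(1) by simp
    then show ?thesis using supp_rel[OF forest_onD(1)[OF F t(1)]] t(2) i by blast
  qed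
qed

text \<open>A tree with an internal vertex contributes its root relation, and these are exactly the
  maximal members; every other tree is a fallen leaf.\<close>

lemma card_forest:
  assumes F: "forest_on A F" and A: "finite A"
  shows "card F = card (maxes (forest_family F)) + card (A - \<Union> (supp ` forest_family F))"
proof -
  let ?N = "{t \<in> F. \<exists>K C. t = Node K C}"
  have F_eq: "F = ?N \<union> Leaf ` fallen_leaves F"
  proof (intro equalityI subsetI)
    fix t assume "t \<in> F"
    then show "t \<in> ?N \<union> Leaf ` fallen_leaves F" by (cases t) (auto simp: fallen_leaves_def)
  qed (auto simp: fallen_leaves_def)
  have fin: "finite F" using forest_finite[OF F A] .
  have sub: "Leaf ` fallen_leaves F \<subseteq> F" by (auto simp: fallen_leaves_def)
  have "card F = card ?N + card (Leaf ` fallen_leaves F :: 'g ltree set)"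
    by (subst F_eq, rule card_Un_disjoint) (use fin finite_subset[OF sub fin] in auto)
  moreover have "card (Leaf ` fallen_leaves F :: 'g ltree set) = card (fallen_leaves F)"
    by (rule card_image) (simp add: inj_on_def)
  moreover have "bij_betw rel ?N (maxes (forest_family F))"
    unfolding bij_betw_def
  proof
    show "inj_on rel ?N"
    proof (rule inj_onI)
      fix t u assume tu: "t \<in> ?N" "u \<in> ?N" "rel t = rel u"
      have a: "admissible_tree G \<rho> t" "admissible_tree G \<rho> u" using forest_onD(1)[OF F] tu by auto
      obtain i where "i \<in> leaves t" using leaves_nonempty[OF a(1)] by blast
      moreover have "leaves t = leaves u" using supp_rel[OF a(1)] supp_rel[OF a(2)] tu(3) by simp
      ultimately show "t = u" using forest_unique[OF F, of u t i] tu by simp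
    qed
    show "rel ` ?N = maxes (forest_family F)"
    proof (intro equalityI subsetI)
      fix R assume "R \<in> rel ` ?N"
      then obtain K C where t: "Node K C \<in> F" "R = rel (Node K C)" by blast
      then have "R \<in> forest_family F" using rel_in_forest_family by simp
      then show "R \<in> maxes (forest_family F)"
        using rel_maximal[OF F t(1)] t(2) by (auto simp: maxes_def)
    next
      fix R assume "R \<in> maxes (forest_family F)"
      then have R: "R \<in> forest_family F" "\<And>R'. R' \<in> forest_family F \<Longrightarrow> R \<subseteq> R' \<Longrightarrow> R' = R"
        by (auto simp: maxes_def)
      obtain K C where t: "Node K C \<in> F" "R \<subseteq> rel (Node K C)"
        using forest_family_obtain[OF F R(1)] by metis
      then have "rel (Node K C) \<in> forest_family F" using rel_in_forest_family by simp
      then have "R = rel (Node K C)" using R(2)[symmetric] t(2) by blast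
      then show "R \<in> rel ` ?N" using t(1) by blast
    qed
  qed
  then have "card ?N = card (maxes (forest_family F))" by (rule bij_betw_same_card)
  ultimately show ?thesis using fallen_leaves_family[OF F] by simp
qed

end

section \<open>Linear algebra\<close>

context vector_space
begin

text \<open>A basis of \<open>W\<close> stays independent when \<open>v\<close> is added, so a
  functional can be prescribed as 0 on the basis and 1 at \<open>v\<close>.\<close>

lemma separating_functional:
  assumes "subspace W" "v \<notin> W"
  obtains f where "Vector_Spaces.linear scale (*) f" "\<And>x. x \<in> W \<Longrightarrow> f x = 0" "f v \<noteq> 0"
proof -
  interpret p: vector_space_pair scale "(*)" by unfold_locales (simp_all add: algebra_simps)
  obtain B where B: "B \<subseteq> W" "independent B" "W \<subseteq> span B"
    using maximal_independent_subset by metis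
  have sB: "span B = W" using B assms(1) span_minimal by blast
  then have "independent (insert v B)" using independent_insertI assms(2) B(2) by blast
  from p.linear_independent_extend[OF this, of "\<lambda>x. if x = v then 1 else 0"]
  obtain f where f: "Vector_Spaces.linear scale (*) f"
    "\<forall>x\<in>insert v B. f x = (if x = v then 1 else 0)" by blast
  interpret f: Vector_Spaces.linear scale "(*)" f by fact
  have "f x = 0" if "x \<in> B" for x using f(2) that B(1) assms(2) by auto
  then have "f x = 0" if "x \<in> W" for x using f.eq_0_on_span that sB by blast
  moreover have "f v \<noteq> 0" using f(2) by simp
  ultimately show ?thesis using that f(1) by blast
qed

text \<open>Serves to split functionals in \<open>annihilator_Int\<close>. A basis of
  \<open>D1\<close> is extended by vectors of \<open>D2\<close> until it spans both. Sending the new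
  vectors to 0 changes each vector of the span by an element of \<open>D2\<close>, so
  \<open>D2\<close> is preserved.\<close>

lemma relative_projection:
  assumes D1: "subspace D1" and D2: "subspace D2"
  obtains p where "Vector_Spaces.linear scale scale p" "\<And>x. p x \<in> D1" "\<And>x. x \<in> D1 \<Longrightarrow> p x = x"
    "\<And>x. x \<in> D2 \<Longrightarrow> p x \<in> D2"
proof -
  interpret q: vector_space_pair scale scale by unfold_locales
  obtain B1 where B1: "B1 \<subseteq> D1" "independent B1" "D1 \<subseteq> span B1"
    using maximal_independent_subset by metis
  obtain B where B: "B1 \<subseteq> B" "B \<subseteq> B1 \<union> D2" "independent B" "B1 \<union> D2 \<subseteq> span B"
    using maximal_independent_subset_extend[of B1 "B1 \<union> D2"] B1(2) by blast
  obtain p where p: "Vector_Spaces.linear scale scale p"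
    "\<forall>x\<in>B. p x = (if x \<in> B1 then x else 0)"
    "range p = span ((\<lambda>x. if x \<in> B1 then x else 0) ` B)"
    using q.linear_independent_extend_subspace[OF B(3), of "\<lambda>x. if x \<in> B1 then x else 0"] by blast
  interpret p: Vector_Spaces.linear scale scale p by fact
  \<comment> \<open>The range of the extension is the span of these images, so \<open>p\<close> maps
    the whole space into \<open>D1\<close>, not only the span of \<open>B\<close>.\<close>
  have "(\<lambda>x. if x \<in> B1 then x else 0) ` B \<subseteq> D1" using B1(1) subspace_0[OF D1] by auto
  then have r: "p x \<in> D1" for x using p(3) span_minimal[OF _ D1] by blast
  have i: "p x = x" if "x \<in> D1" for x
  proof -
    have "x \<in> span B1" using that B1(3) by blast
    then show ?thesis
      by (rule span_induct_alt) (use p(2) B(1) in \<open>auto simp: p.zero p.add p.scale\<close>)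
  qed
  have "x - p x \<in> D2" if "x \<in> span B" for x
    using that
  proof (rule span_induct_alt)
    fix c b y assume b: "b \<in> B" and y: "y - p y \<in> D2"
    have "b - p b \<in> D2" using b p(2) B(2) subspace_0[OF D2] by auto
    then have "scale c (b - p b) + (y - p y) \<in> D2"
      using y D2 by (simp add: subspace_add subspace_scale)
    moreover have "scale c b + y - p (scale c b + y) = scale c (b - p b) + (y - p y)"
      by (simp add: p.add p.scale scale_right_diff_distrib)
    ultimately show "scale c b + y - p (scale c b + y) \<in> D2" by metis
  qed (use subspace_0[OF D2] p.zero in simp)
  then have "p x \<in> D2" if "x \<in> D2" for x
    using subspace_diff[OF D2 that, of "x - p x"] B(4) that by auto
  then show ?thesis using that p(1) r i by blast
qed

end

section \<open>Stabilisers, fixed spaces and closed subgroups\<close>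

locale representation = comm_group G + vector_space scale
  for G :: "('g, 'b) monoid_scheme" (structure)
    and scale :: "complex \<Rightarrow> 'v::ab_group_add \<Rightarrow> 'v" +
  fixes \<rho> :: "'g \<Rightarrow> 'v \<Rightarrow> 'v"
  assumes fin_carrier: "finite (carrier G)"
    and nontrivial: "(UNIV :: 'v set) \<noteq> {0}"
    and hom: "\<rho> \<in> hom G (GL scale)"
    and faithful: "inj_on \<rho> (carrier G)"
    and Fix_carrier: "Fix \<rho> (carrier G) = {0}"
begin

lemma rho_linear: "g \<in> carrier G \<Longrightarrow> module_hom scale scale (\<rho> g)"
  using hom by (auto simp: hom_def GL_def Vector_Spaces.linear_def)

lemma rho_0: "g \<in> carrier G \<Longrightarrow> \<rho> g 0 = 0"
  and rho_add: "g \<in> carrier G \<Longrightarrow> \<rho> g (v + w) = \<rho> g v + \<rho> g w"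
  and rho_scale: "g \<in> carrier G \<Longrightarrow> \<rho> g (scale c v) = scale c (\<rho> g v)"
  using module_hom.zero[OF rho_linear] module_hom.add[OF rho_linear]
    module_hom.scale[OF rho_linear] by auto

lemma rho_mult: "g \<in> carrier G \<Longrightarrow> h \<in> carrier G \<Longrightarrow> \<rho> (g \<otimes> h) v = \<rho> g (\<rho> h v)"
  using hom by (auto simp: hom_def GL_def)

lemma rho_one: "\<rho> \<one> v = v"
proof -
  have "bij (\<rho> \<one>)" using hom by (auto simp: hom_def GL_def)
  moreover have "\<rho> \<one> (\<rho> \<one> v) = \<rho> \<one> v" using rho_mult[of \<one> \<one> v] by simp
  ultimately show ?thesis by (metis bij_is_inj injD)
qed

lemma rho_inv: "g \<in> carrier G \<Longrightarrow> \<rho> (inv g) (\<rho> g v) = v"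
  using rho_mult[of "inv g" g v] by (simp add: rho_one)

lemma rho_inv': "g \<in> carrier G \<Longrightarrow> \<rho> g (\<rho> (inv g) v) = v"
  using rho_mult[of g "inv g" v] by (simp add: rho_one)

lemma rho_eq_iff: "g \<in> carrier G \<Longrightarrow> h \<in> carrier G \<Longrightarrow>
  \<rho> g v = \<rho> h v \<longleftrightarrow> \<rho> (inv h \<otimes> g) v = v"
  by (metis inv_closed rho_inv rho_inv' rho_mult)

definition stab :: "'v set \<Rightarrow> 'g set" where
  "stab W = {g \<in> carrier G. \<forall>w\<in>W. \<rho> g w = w}"

lemma subgroup_stab: "subgroup (stab W) G"
proof
  show "stab W \<subseteq> carrier G" by (auto simp: stab_def)
  show "\<one> \<in> stab W" by (simp add: stab_def rho_one)
  show "g \<otimes> h \<in> stab W" if "g \<in> stab W" "h \<in> stab W" for g h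
    using that by (simp add: stab_def rho_mult)
  show "inv g \<in> stab W" if g: "g \<in> stab W" for g
  proof -
    have "\<rho> (inv g) w = w" if "w \<in> W" for w
      using rho_inv[of g w] g that by (simp add: stab_def)
    then show ?thesis using g by (simp add: stab_def)
  qed
qed

lemma subset_Fix_stab: "W \<subseteq> Fix \<rho> (stab W)"
  by (auto simp: Fix_def stab_def)

text \<open>\<open>Fix\<close> and \<open>stab\<close> form a Galois connection. Together with
  \<open>stab_Fix\<close> this identifies the closed subgroups with the pointwise stabilisers and
  frees later arguments from the definition of the closure as a greatest element.\<close>

lemma stab_closed: "stab W \<in> closed_subgroups G \<rho>"
proof -
  have "subgroup_closure G \<rho> (stab W) = stab W"
    unfolding subgroup_closure_def
  proof (rule Greatest_equality)
    fix K assume K: "subgroup K G \<and> Fix \<rho> K = Fix \<rho> (stab W)"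
    then have "W \<subseteq> Fix \<rho> K" using subset_Fix_stab by blast
    then show "K \<subseteq> stab W" using K subgroup.mem_carrier by (fastforce simp: Fix_def stab_def)
  qed (simp add: subgroup_stab)
  then show ?thesis by (simp add: closed_subgroups_def subgroup_stab)
qed

lemma stab_Fix:
  assumes "K \<in> closed_subgroups G \<rho>"
  shows "stab (Fix \<rho> K) = K"
proof -
  have K: "subgroup K G" "subgroup_closure G \<rho> K = K"
    using assms by (auto simp: closed_subgroups_def)
  have "K \<subseteq> stab (Fix \<rho> K)" using subgroup.mem_carrier[OF K(1)] by (auto simp: Fix_def stab_def)
  then have "Fix \<rho> (stab (Fix \<rho> K)) \<subseteq> Fix \<rho> K" by (auto simp: Fix_def)
  then have F: "Fix \<rho> (stab (Fix \<rho> K)) = Fix \<rho> K" using subset_Fix_stab by blast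
  have "subgroup_closure G \<rho> K = stab (Fix \<rho> K)"
    unfolding subgroup_closure_def
  proof (rule Greatest_equality)
    fix H assume H: "subgroup H G \<and> Fix \<rho> H = Fix \<rho> K"
    then show "H \<subseteq> stab (Fix \<rho> K)"
      using subgroup.mem_carrier by (fastforce simp: Fix_def stab_def)
  qed (simp add: subgroup_stab F)
  then show ?thesis using K(2) by simp
qed

sublocale gain_setup G \<rho>
proof
  show "finite (carrier G)" by (rule fin_carrier)
  have "stab {0} = carrier G" by (auto simp: stab_def rho_0)
  then show "carrier G \<in> closed_subgroups G \<rho>" using stab_closed by metis
  show "carrier G \<noteq> {\<one>}"
  proof
    assume *: "carrier G = {\<one>}"
    have "Fix \<rho> (carrier G) = UNIV" unfolding * by (auto simp: Fix_def rho_one)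
    then show False using Fix_carrier nontrivial by simp
  qed
qed

lemma stab_UNIV: "g \<in> carrier G \<Longrightarrow> (\<And>v. \<rho> g v = v) \<Longrightarrow> g = \<one>"
  using inj_onD[OF faithful, of g \<one>] rho_one by (auto simp: fun_eq_iff)

text \<open>A zero fixed space would equal that of the whole group, and a closed subgroup is
  determined by its fixed space.\<close>

lemma Fix_nonzero:
  assumes "K \<in> closed_subgroups G \<rho>" "K \<noteq> carrier G"
  obtains w where "w \<in> Fix \<rho> K" "w \<noteq> 0"
proof -
  have "0 \<in> Fix \<rho> K"
    using subgroup.mem_carrier[OF closed_subgroupD[OF assms(1)]] by (auto simp: Fix_def rho_0)
  moreover have "Fix \<rho> K \<noteq> {0}"
    using stab_Fix[OF assms(1)] stab_Fix[OF carrier_closed] Fix_carrier assms(2) by auto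
  ultimately show ?thesis using that by blast
qed

section \<open>Solution spaces of relations and their annihilators\<close>

definition D :: "nat \<Rightarrow> (nat \<times> nat \<times> 'g) set \<Rightarrow> (nat \<Rightarrow> 'v) set" where
  "D n R = {v \<in> V_pow n. \<forall>(i, j, g)\<in>R. v i = \<rho> g (v j)}"

definition ann :: "nat \<Rightarrow> (nat \<times> nat \<times> 'g) set \<Rightarrow> ((nat \<Rightarrow> 'v) \<Rightarrow> complex) set" where
  "ann n R = annihilator scale n (D n R)"

text \<open>No type depends on \<open>n\<close>, so linear algebra is done on all families indexed
  by \<open>nat\<close>, with \<open>V_pow n\<close> as a subspace.\<close>

sublocale pw: vector_space "\<lambda>c (v :: nat \<Rightarrow> 'v) i. scale c (v i)"
  by unfold_locales
    (simp_all add: fun_eq_iff scale_right_distrib scale_left_distrib)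

lemma V_pow_subspace: "pw.subspace (V_pow n)"
  unfolding pw.subspace_def by (auto simp: V_pow_def)

lemma D_eq: "v \<in> D n R \<Longrightarrow> (i, j, g) \<in> R \<Longrightarrow> v i = \<rho> g (v j)"
  by (auto simp: D_def)

lemma D_I: "v \<in> V_pow n \<Longrightarrow> (\<And>i j g. (i, j, g) \<in> R \<Longrightarrow> v i = \<rho> g (v j)) \<Longrightarrow> v \<in> D n R"
  by (auto simp: D_def)

lemma D_V_pow: "D n R \<subseteq> V_pow n"
  by (auto simp: D_def)

lemma D_subspace:
  assumes "R \<in> gains A"
  shows "pw.subspace (D n R)"
proof -
  note c = gain_carrier[OF assms] and V = V_pow_subspace[of n, unfolded pw.subspace_def]
  show ?thesis
    unfolding pw.subspace_def
  proof (intro conjI ballI allI)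
    show "0 \<in> D n R" by (rule D_I) (use V c in \<open>auto simp: rho_0\<close>)
    show "v + w \<in> D n R" if "v \<in> D n R" "w \<in> D n R" for v w
      by (rule D_I)
        (use V c subsetD[OF D_V_pow that(1)] subsetD[OF D_V_pow that(2)] D_eq[OF that(1)]
          D_eq[OF that(2)] in \<open>auto simp: rho_add\<close>)
    show "(\<lambda>i. scale c (v i)) \<in> D n R" if "v \<in> D n R" for c v
      by (rule D_I)
        (use V c subsetD[OF D_V_pow that] D_eq[OF that] in \<open>auto simp: rho_scale\<close>)
  qed
qed

lemma D_mono: "R \<subseteq> R' \<Longrightarrow> D n R' \<subseteq> D n R"
  by (auto simp: D_def)

lemma dual_0: "0 \<in> dual_V_pow scale n"
  by (auto simp: dual_V_pow_def)

lemma dual_of_linear: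
  assumes "Vector_Spaces.linear (\<lambda>c (v :: nat \<Rightarrow> 'v) i. scale c (v i)) (*) f"
  shows "(\<lambda>v. if v \<in> V_pow n then f v else 0) \<in> dual_V_pow scale n"
proof -
  interpret f: Vector_Spaces.linear "\<lambda>c (v :: nat \<Rightarrow> 'v) i. scale c (v i)" "(*)" f by fact
  have "f (\<lambda>i. u i + v i) = f u + f v" for u v
    using f.add[of u v] by (simp add: plus_fun_def)
  then show ?thesis
    using V_pow_subspace[of n] f.scale
    unfolding dual_V_pow_def pw.subspace_def plus_fun_def by auto
qed

lemma annihilator_separates:
  assumes "pw.subspace W" "v \<in> V_pow n" "v \<notin> W"
  obtains f where "f \<in> annihilator scale n W" "f v \<noteq> 0"
proof -
  obtain f where f: "Vector_Spaces.linear (\<lambda>c (v :: nat \<Rightarrow> 'v) i. scale c (v i)) (*) f"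
    "\<And>x. x \<in> W \<Longrightarrow> f x = 0" "f v \<noteq> 0"
    using pw.separating_functional[OF assms(1,3)] by blast
  have "(\<lambda>v. if v \<in> V_pow n then f v else 0) \<in> annihilator scale n W"
    using dual_of_linear[OF f(1)] f(2) by (auto simp: annihilator_def)
  then show ?thesis by (rule that) (use f(3) assms(2) in simp)
qed

text \<open>With \<open>p\<close> from \<open>relative_projection\<close>, the composite of
  \<open>f\<close> with \<open>p\<close> kills \<open>D2\<close>, which \<open>p\<close> maps into
  \<open>D1 \<inter> D2\<close>; the difference of \<open>f\<close> and this composite kills
  \<open>D1\<close>, where \<open>p\<close> is the identity. Both are 0 outside
  \<open>V_pow n\<close>, as \<open>dual_V_pow\<close> demands.\<close>

lemma annihilator_Int:
  assumes D1: "pw.subspace D1" "D1 \<subseteq> V_pow n" and D2: "pw.subspace D2"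
    and f: "f \<in> annihilator scale n (D1 \<inter> D2)"
  obtains f1 f2 where "f1 \<in> annihilator scale n D1" "f2 \<in> annihilator scale n D2" "f = f1 + f2"
proof -
  obtain p where p: "Vector_Spaces.linear (\<lambda>c (v :: nat \<Rightarrow> 'v) i. scale c (v i))
      (\<lambda>c (v :: nat \<Rightarrow> 'v) i. scale c (v i)) p"
    "\<And>x. p x \<in> D1" "\<And>x. x \<in> D1 \<Longrightarrow> p x = x" "\<And>x. x \<in> D2 \<Longrightarrow> p x \<in> D2"
    using pw.relative_projection[OF D1(1) D2] by blast
  interpret p: Vector_Spaces.linear "\<lambda>c (v :: nat \<Rightarrow> 'v) i. scale c (v i)"
    "\<lambda>c (v :: nat \<Rightarrow> 'v) i. scale c (v i)" p by fact
  have f_add: "f (\<lambda>i. u i + v i) = f u + f v" if "u \<in> V_pow n" "v \<in> V_pow n" for u v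
    using f that by (auto simp: annihilator_def dual_V_pow_def)
  have f_scale: "f (\<lambda>i. scale c (v i)) = c * f v" if "v \<in> V_pow n" for c v
    using f that by (auto simp: annihilator_def dual_V_pow_def)
  have f_out: "f v = 0" if "v \<notin> V_pow n" for v
    using f that by (auto simp: annihilator_def dual_V_pow_def)
  have f_zero: "f x = 0" if "x \<in> D1" "x \<in> D2" for x using f that by (auto simp: annihilator_def)
  have pV: "p x \<in> V_pow n" for x using p(2) D1(2) by blast
  have p_add: "p (\<lambda>i. u i + v i) = (\<lambda>i. p u i + p v i)" for u v
    using p.add[of u v] by (simp add: plus_fun_def)
  have p_scale: "p (\<lambda>i. scale c (v i)) = (\<lambda>i. scale c (p v i))" for c v
    using p.scale[of c v] .
  have V_add: "(\<lambda>i. u i + v i) \<in> V_pow n" if "u \<in> V_pow n" "v \<in> V_pow n" for u v :: "nat \<Rightarrow> 'v"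
    using that by (simp add: V_pow_def)
  have V_scale: "(\<lambda>i. scale c (v i)) \<in> V_pow n" if "v \<in> V_pow n" for c and v :: "nat \<Rightarrow> 'v"
    using that by (simp add: V_pow_def)
  define f2 where "f2 = (\<lambda>v. if v \<in> V_pow n then f (p v) else 0)"
  define f1 where "f1 = (\<lambda>v. f v - f2 v)"
  have f2: "f2 \<in> dual_V_pow scale n"
    unfolding dual_V_pow_def f2_def
    by (auto simp: V_add V_scale p_add p_scale f_add f_scale pV)
  have f1: "f1 \<in> dual_V_pow scale n"
    unfolding dual_V_pow_def f1_def f2_def
    by (auto simp: V_add V_scale p_add p_scale f_add f_scale pV f_out algebra_simps)
  have "f1 \<in> annihilator scale n D1"
    unfolding annihilator_def using f1 D1(2) p(3) by (auto simp: f1_def f2_def)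
  moreover have "f2 \<in> annihilator scale n D2"
    unfolding annihilator_def using f2 f_zero p(2,4) by (auto simp: f2_def)
  moreover have "f = f1 + f2" by (auto simp: f1_def)
  ultimately show ?thesis by (rule that)
qed

lemma annihilator_add:
  assumes "f \<in> annihilator scale n D1" "h \<in> annihilator scale n D2"
  shows "f + h \<in> annihilator scale n (D1 \<inter> D2)"
  using assms by (auto simp: annihilator_def dual_V_pow_def algebra_simps)

lemma annihilator_antimono: "W \<subseteq> W' \<Longrightarrow> annihilator scale n W' \<subseteq> annihilator scale n W"
  by (auto simp: annihilator_def)

lemma annihilator_subset_iff:
  assumes "pw.subspace W" "pw.subspace W'" "W' \<subseteq> V_pow n"
  shows "annihilator scale n W \<subseteq> annihilator scale n W' \<longleftrightarrow> W' \<subseteq> W"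
proof
  assume *: "annihilator scale n W \<subseteq> annihilator scale n W'"
  show "W' \<subseteq> W"
  proof (rule ccontr)
    assume "\<not> W' \<subseteq> W"
    then obtain v where v: "v \<in> W'" "v \<notin> W" by blast
    then obtain f where "f \<in> annihilator scale n W" "f v \<noteq> 0"
      using annihilator_separates[OF assms(1), of v n] assms(3) by blast
    then show False using * v(1) by (auto simp: annihilator_def)
  qed
qed (rule annihilator_antimono)

lemma in_D_outside:
  assumes "R \<in> gains A" "v \<in> V_pow n" "\<And>i. i \<in> supp R \<Longrightarrow> v i = 0"
  shows "v \<in> D n R"
  by (rule D_I)
    (use assms(2,3) gain_carrier[OF assms(1)] gain_supp1[OF assms(1)] gain_supp2[OF assms(1)]
      in \<open>auto simp: rho_0\<close>)

text \<open>A vector fixed by the isotropy group can be prescribed at one index and transported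
  along gains. The result is well defined because two gains between the same indices differ by an
  isotropy element.\<close>

lemma D_witness:
  assumes R: "R \<in> gains {1..n}" and j: "j \<in> supp R" and w: "w \<in> Fix \<rho> (isotropy R)"
  obtains v where "v \<in> D n R" "v j = w" "\<And>i. i \<notin> supp R \<Longrightarrow> v i = 0"
proof -
  have "\<forall>i\<in>supp R. \<exists>g. (i, j, g) \<in> R" using gain_connected[OF R] j by blast
  from bchoice[OF this] obtain c where c: "\<And>i. i \<in> supp R \<Longrightarrow> (i, j, c i) \<in> R" by blast
  define v where "v i = (if i \<in> supp R then \<rho> (c i) w else 0)" for i
  have fix_eq: "\<rho> g w = \<rho> h w" if gh: "(i, j, g) \<in> R" "(i, j, h) \<in> R" for i g h
  proof -
    have "inv h \<otimes> g \<in> isotropy R"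
      using gain_trans[OF R gain_sym[OF R gh(2)] gh(1)] isotropy_at[OF R j] by simp
    then have "\<rho> (inv h \<otimes> g) w = w" using w by (simp add: Fix_def)
    then show ?thesis using rho_eq_iff gain_carrier[OF R] gh by blast
  qed
  have "v i = \<rho> g (v k)" if ikg: "(i, k, g) \<in> R" for i k g
  proof -
    have ik: "i \<in> supp R" "k \<in> supp R" using gain_supp1[OF R ikg] gain_supp2[OF R ikg] .
    have "\<rho> (c i) w = \<rho> (g \<otimes> c k) w"
      using fix_eq[OF c[OF ik(1)] gain_trans[OF R ikg c[OF ik(2)]]] .
    then show ?thesis
      using ik rho_mult gain_carrier[OF R ikg] gain_carrier[OF R c[OF ik(2)]] by (simp add: v_def)
  qed
  moreover have "v \<in> V_pow n" using supp_subset[OF R] by (auto simp: V_pow_def v_def)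
  ultimately have "v \<in> D n R" by (auto simp: D_def)
  moreover have "v j = w" using fix_eq[OF c[OF j] gain_refl[OF R j]] j by (simp add: v_def rho_one)
  ultimately show ?thesis using that by (simp add: v_def)
qed

text \<open>Converse of \<open>D_mono\<close>: a relation can be recovered from its solution space.
  This is what turns inclusion of annihilators into inclusion of relations.\<close>

lemma subset_if_D_subset:
  assumes R: "R \<in> gains {1..n}" and R': "R' \<in> gains {1..n}" and sub: "D n R' \<subseteq> D n R"
  shows "R \<subseteq> R'"
proof -
  have eq: "v i = \<rho> g (v j)" if "(i, j, g) \<in> R" "v \<in> D n R'" for i j g v
    using that sub by (auto simp: D_def)
  have supp: "i \<in> supp R'" if i: "i \<in> supp R" for i
  proof (rule ccontr)
    assume n: "i \<notin> supp R'"
    have i1: "i \<in> {1..n}" using supp_subset[OF R] i by blast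
    \<comment> \<open>A vector concentrated at \<open>i\<close> solves \<open>R'\<close>, hence
      \<open>R\<close>. Another index in \<open>supp R\<close> would force every value
      \<open>x\<close> to be 0, and a loop at \<open>i\<close> acts trivially, so it is
      \<open>\<one>\<close> by faithfulness. Then \<open>R\<close> would be the excluded trivial
      relation.\<close>
    define e where "e x k = (if k = i then x else 0)" for x :: 'v and k
    have e: "e x \<in> D n R'" for x
      by (rule in_D_outside[OF R']) (use n i1 in \<open>auto simp: e_def V_pow_def\<close>)
    have "(j, k, g) = (i, i, \<one>)" if jkg: "(j, k, g) \<in> R" for j k g
    proof -
      have no: "m = i" if m: "m \<in> supp R" for m
      proof (rule ccontr)
        assume "m \<noteq> i"
        obtain h where h: "(i, m, h) \<in> R" using gain_connected[OF R i m] by blast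
        have "x = 0" for x :: 'v
          using eq[OF h e[of x]] \<open>m \<noteq> i\<close> gain_carrier[OF R h] by (simp add: e_def rho_0)
        then show False using nontrivial by blast
      qed
      have jk: "j = i" "k = i" using no gain_supp1[OF R jkg] gain_supp2[OF R jkg] by auto
      have "\<rho> g x = x" for x using eq[OF jkg e[of x]] jk by (simp add: e_def)
      then have "g = \<one>" using stab_UNIV gain_carrier[OF R jkg] by blast
      then show ?thesis using jk by simp
    qed
    then have "R \<subseteq> {(i, i, \<one>)}" by (metis prod_cases3 singletonI subsetI)
    then show False using R by (auto simp: gains_def)
  qed
  show ?thesis
  proof safe
    fix i j g assume ijg: "(i, j, g) \<in> R"
    have ij: "i \<in> supp R'" "j \<in> supp R'"
      using supp gain_supp1[OF R ijg] gain_supp2[OF R ijg] by auto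
    obtain h where h: "(i, j, h) \<in> R'" using gain_connected[OF R' ij] by blast
    note gh = gain_carrier[OF R ijg] gain_carrier[OF R' h]
    \<comment> \<open>\<open>D_witness\<close> realises every such \<open>w\<close> at
      \<open>j\<close>. So \<open>inv h \<otimes> g\<close> fixes the whole fixed space of the
      isotropy group of \<open>R'\<close>, and a closed group contains every element that does
      so.\<close>
    have "\<rho> (inv h \<otimes> g) w = w" if w: "w \<in> Fix \<rho> (isotropy R')" for w
    proof -
      obtain v where v: "v \<in> D n R'" "v j = w" using D_witness[OF R' ij(2) w] by blast
      have "\<rho> g w = v i" using eq[OF ijg v(1)] v(2) by simp
      also have "\<dots> = \<rho> h w" using v h by (auto simp: D_def)
      finally show ?thesis using rho_eq_iff[OF gh] by simp
    qed
    then have "inv h \<otimes> g \<in> stab (Fix \<rho> (isotropy R'))" using gh by (simp add: stab_def)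
    then have "inv h \<otimes> g \<in> isotropy R'" using stab_Fix[OF isotropy_closed[OF R']] by simp
    then have "(j, j, inv h \<otimes> g) \<in> R'" using isotropy_at[OF R' ij(2)] by simp
    from gain_trans[OF R' h this] have "(i, j, h \<otimes> (inv h \<otimes> g)) \<in> R'" .
    then show "(i, j, g) \<in> R'" using gh by (simp add: m_assoc[symmetric])
  qed
qed

lemma ann_subset_iff:
  assumes "R \<in> gains {1..n}" "R' \<in> gains {1..n}"
  shows "ann n R \<subseteq> ann n R' \<longleftrightarrow> R \<subseteq> R'"
  unfolding ann_def
  using annihilator_subset_iff[OF D_subspace[OF assms(1)] D_subspace[OF assms(2)] D_V_pow]
    subset_if_D_subset[OF assms] D_mono by blast

lemma inj_on_ann: "inj_on (ann n) (gains {1..n})"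
  using ann_subset_iff by (intro inj_onI) blast

section \<open>The building set and its nested sets\<close>

text \<open>The gains on the space v_i = rho(c_i) w with w in Fix K: there v_i = rho(h) v_j says
  that c_i^-1 h c_j fixes w. This is the parametrisation by which \<open>building_set\<close>
  describes its members.\<close>

definition gain_of :: "nat set \<Rightarrow> 'g set \<Rightarrow> (nat \<Rightarrow> 'g) \<Rightarrow> (nat \<times> nat \<times> 'g) set" where
  "gain_of I K c = {(i, j, h). i \<in> I \<and> j \<in> I \<and> h \<in> carrier G \<and> inv (c i) \<otimes> h \<otimes> c j \<in> K}"

context
  fixes I :: "nat set" and K :: "'g set" and c :: "nat \<Rightarrow> 'g"
  assumes K: "K \<in> closed_subgroups G \<rho>" and I: "I \<noteq> {}" and c: "\<forall>i\<in>I. c i \<in> carrier G"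
begin

lemma gain_of_diag: "i \<in> I \<Longrightarrow> (i, i, h) \<in> gain_of I K c \<longleftrightarrow> h \<in> K"
  using c subgroup.mem_carrier[OF closed_subgroupD[OF K], of h]
  by (auto simp: gain_of_def m_comm[of "inv (c i)"] m_assoc)

lemma isotropy_gain_of: "isotropy (gain_of I K c) = K"
proof -
  have "(i, i, h) \<in> gain_of I K c \<Longrightarrow> i \<in> I" for i h by (simp add: gain_of_def)
  then show ?thesis using gain_of_diag I unfolding isotropy_def by blast
qed

lemma supp_gain_of: "supp (gain_of I K c) = I"
proof -
  have "(i, i, \<one>) \<in> gain_of I K c" if "i \<in> I" for i
    using gain_of_diag[OF that] subgroup.one_closed[OF closed_subgroupD[OF K]] by simp
  then show ?thesis by (force simp: supp_def gain_of_def)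
qed

lemma gain_of_gains:
  assumes "I \<subseteq> A" and nt: "card I \<ge> 2 \<or> K \<noteq> {\<one>}"
  shows "gain_of I K c \<in> gains A"
proof -
  interpret K: subgroup K G using closed_subgroupD[OF K] .
  let ?R = "gain_of I K c"
  have 1: "(j, i, inv g) \<in> ?R" if "(i, j, g) \<in> ?R" for i j g
  proof -
    have ij: "i \<in> I" "j \<in> I" "g \<in> carrier G" "inv (c i) \<otimes> g \<otimes> c j \<in> K"
      using that by (auto simp: gain_of_def)
    have "inv (inv (c i) \<otimes> g \<otimes> c j) = inv (c j) \<otimes> inv g \<otimes> c i"
      using ij c by (simp add: inv_mult_group m_assoc)
    then show ?thesis using K.m_inv_closed[OF ij(4)] ij by (simp add: gain_of_def)
  qed
  have 2: "(i, k, g \<otimes> h) \<in> ?R" if "(i, j, g) \<in> ?R" "(j, k, h) \<in> ?R" for i j k g h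
  proof -
    have *: "i \<in> I" "j \<in> I" "k \<in> I" "g \<in> carrier G" "h \<in> carrier G"
      "inv (c i) \<otimes> g \<otimes> c j \<in> K" "inv (c j) \<otimes> h \<otimes> c k \<in> K"
      using that by (auto simp: gain_of_def)
    have cc: "c i \<in> carrier G" "c j \<in> carrier G" "c k \<in> carrier G" using * c by auto
    have "c j \<otimes> (inv (c j) \<otimes> (h \<otimes> c k)) = h \<otimes> c k"
      using * cc by (simp add: m_assoc[symmetric])
    then have "(inv (c i) \<otimes> g \<otimes> c j) \<otimes> (inv (c j) \<otimes> h \<otimes> c k) = inv (c i) \<otimes> (g \<otimes> h) \<otimes> c k"
      using * cc by (simp add: m_assoc)
    then show ?thesis using K.m_closed[OF *(6,7)] * by (simp add: gain_of_def)
  qed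
  have 3: "\<exists>g. (i, j, g) \<in> ?R" if ij: "i \<in> I" "j \<in> I" for i j
  proof
    have cc: "c i \<in> carrier G" "c j \<in> carrier G" using ij c by auto
    have "inv (c i) \<otimes> (c i \<otimes> inv (c j)) \<otimes> c j = \<one>"
      using cc by (simp add: m_assoc[symmetric])
    then show "(i, j, c i \<otimes> inv (c j)) \<in> ?R" using ij cc by (simp add: gain_of_def)
  qed
  have 4: "?R \<noteq> {(i, i, \<one>)}" for i
  proof
    assume *: "?R = {(i, i, \<one>)}"
    have "K = {\<one>}" using isotropy_gain_of by (simp add: * isotropy_def)
    moreover have "I = {i}" using supp_gain_of by (simp add: * supp_def)
    ultimately show False using nt by simp
  qed
  have 5: "?R \<noteq> {}" using supp_gain_of I by (auto simp: supp_def)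
  have 6: "?R \<subseteq> A \<times> A \<times> carrier G" using assms(1) by (auto simp: gain_of_def)
  show ?thesis by (rule gainsI) (use 1 2 3 4 5 6 supp_gain_of isotropy_gain_of K in simp_all)
qed

lemma D_gain_of: "D n (gain_of I K c) = {v \<in> V_pow n. \<exists>w\<in>Fix \<rho> K. \<forall>i\<in>I. v i = \<rho> (c i) w}"
proof (intro equalityI subsetI)
  fix v assume v: "v \<in> D n (gain_of I K c)"
  obtain i0 where i0: "i0 \<in> I" using I by blast
  have c0: "c i0 \<in> carrier G" using c i0 by blast
  define w where "w = \<rho> (inv (c i0)) (v i0)"
  have "v i = \<rho> (c i) w" if i: "i \<in> I" for i
  proof -
    have ci: "c i \<in> carrier G" using c i by blast
    have "inv (c i) \<otimes> (c i \<otimes> inv (c i0)) \<otimes> c i0 = \<one>"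
      using c0 ci by (simp add: m_assoc[symmetric])
    then have "(i, i0, c i \<otimes> inv (c i0)) \<in> gain_of I K c"
      using i i0 c0 ci subgroup.one_closed[OF closed_subgroupD[OF K]] by (simp add: gain_of_def)
    from D_eq[OF v this] show ?thesis using c0 ci by (simp add: rho_mult w_def)
  qed
  moreover have "w \<in> Fix \<rho> K"
  proof -
    have "\<rho> k w = w" if k: "k \<in> K" for k
    proof -
      have kc: "k \<in> carrier G" using subgroup.mem_carrier[OF closed_subgroupD[OF K] k] .
      have e: "v i0 = \<rho> k (v i0)" using D_eq[OF v] gain_of_diag[OF i0] k by blast
      have "\<rho> k w = \<rho> (inv (c i0)) (\<rho> k (v i0))"
        using rho_mult[of k "inv (c i0)"] rho_mult[of "inv (c i0)" k] c0 kc m_comm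
        by (simp add: w_def)
      then show ?thesis using e by (simp add: w_def)
    qed
    then show ?thesis by (simp add: Fix_def)
  qed
  ultimately show "v \<in> {v \<in> V_pow n. \<exists>w\<in>Fix \<rho> K. \<forall>i\<in>I. v i = \<rho> (c i) w}"
    using subsetD[OF D_V_pow v] by blast
next
  fix v assume "v \<in> {v \<in> V_pow n. \<exists>w\<in>Fix \<rho> K. \<forall>i\<in>I. v i = \<rho> (c i) w}"
  then obtain w where v: "v \<in> V_pow n" "w \<in> Fix \<rho> K" "\<And>i. i \<in> I \<Longrightarrow> v i = \<rho> (c i) w" by blast
  show "v \<in> D n (gain_of I K c)"
  proof (rule D_I[OF v(1)])
    fix i j h assume "(i, j, h) \<in> gain_of I K c"
    then have *: "i \<in> I" "j \<in> I" "h \<in> carrier G" "inv (c i) \<otimes> h \<otimes> c j \<in> K"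
      by (auto simp: gain_of_def)
    have cc: "c i \<in> carrier G" "c j \<in> carrier G" using * c by auto
    have "\<rho> (inv (c i) \<otimes> (h \<otimes> c j)) w = w" using v(2) * cc by (simp add: Fix_def m_assoc)
    then have "\<rho> (h \<otimes> c j) w = \<rho> (c i) w" using rho_eq_iff[of "h \<otimes> c j" "c i" w] * cc by simp
    then show "v i = \<rho> h (v j)" using v(3) * cc by (simp add: rho_mult)
  qed
qed

end

text \<open>The gains from each index to a fixed base index serve as \<open>c\<close>.\<close>

lemma gains_gain_of:
  assumes R: "R \<in> gains A"
  obtains c where "\<forall>i\<in>supp R. c i \<in> carrier G" "R = gain_of (supp R) (isotropy R) c"
proof -
  obtain i0 where i0: "i0 \<in> supp R" using supp_nonempty[OF R] by blast
  have "\<forall>i\<in>supp R. \<exists>g. (i, i0, g) \<in> R" using gain_connected[OF R] i0 by blast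
  from bchoice[OF this] obtain c where c: "\<And>i. i \<in> supp R \<Longrightarrow> (i, i0, c i) \<in> R" by blast
  have cc: "c i \<in> carrier G" if "i \<in> supp R" for i using gain_carrier[OF R c[OF that]] .
  have "(i, j, h) \<in> R \<longleftrightarrow> inv (c i) \<otimes> h \<otimes> c j \<in> isotropy R"
    if ij: "i \<in> supp R" "j \<in> supp R" "h \<in> carrier G" for i j h
  proof
    assume "(i, j, h) \<in> R"
    from gain_trans[OF R gain_trans[OF R gain_sym[OF R c[OF ij(1)]] this] c[OF ij(2)]]
    show "inv (c i) \<otimes> h \<otimes> c j \<in> isotropy R" using isotropy_at[OF R i0] by simp
  next
    assume "inv (c i) \<otimes> h \<otimes> c j \<in> isotropy R"
    then have "(i0, i0, inv (c i) \<otimes> h \<otimes> c j) \<in> R" using isotropy_at[OF R i0] by simp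
    from gain_trans[OF R gain_trans[OF R c[OF ij(1)] this] gain_sym[OF R c[OF ij(2)]]]
    have "(i, j, c i \<otimes> (inv (c i) \<otimes> h \<otimes> c j) \<otimes> inv (c j)) \<in> R" .
    moreover have "c i \<otimes> (inv (c i) \<otimes> h \<otimes> c j) \<otimes> inv (c j) = h"
    proof -
      have "c i \<otimes> (inv (c i) \<otimes> h \<otimes> c j) = h \<otimes> c j"
        using cc ij by (simp add: m_assoc[symmetric])
      then show ?thesis using cc ij by (simp add: m_assoc)
    qed
    ultimately show "(i, j, h) \<in> R" by simp
  qed
  then have "R = gain_of (supp R) (isotropy R) c"
    using gain_subset[OF R] unfolding gain_of_def by auto
  then show ?thesis using that cc by blast
qed

lemma building_set_eq: "building_set scale G \<rho> n = ann n ` gains {1..n}"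
proof (intro equalityI subsetI)
  fix X assume "X \<in> building_set scale G \<rho> n"
  then consider
    I K c where "X = annihilator scale n {v \<in> V_pow n. \<exists>w\<in>Fix \<rho> K. \<forall>i\<in>I. v i = \<rho> (c i) w}"
      "I \<subseteq> {1..n}" "card I \<ge> 2" "K \<in> closed_subgroups G \<rho>" "\<forall>i\<in>I. c i \<in> carrier G"
  | i K where "X = annihilator scale n {v \<in> V_pow n. v i \<in> Fix \<rho> K}"
      "i \<in> {1..n}" "K \<in> closed_subgroups G \<rho>" "K \<noteq> {\<one>}"
    unfolding building_set_def by blast
  then show "X \<in> ann n ` gains {1..n}"
  proof cases
    case (1 I K c)
    have "I \<noteq> {}" using 1(3) by auto
    from D_gain_of[OF 1(4) this 1(5)] gain_of_gains[OF 1(4) this 1(5) 1(2)] 1(1,3)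
    show ?thesis unfolding ann_def by (intro image_eqI[of _ _ "gain_of I K c"]) simp_all
  next
    case (2 i K)
    have c: "\<forall>j\<in>{i}. (\<lambda>_. \<one>) j \<in> carrier G" by simp
    have "{v \<in> V_pow n. \<exists>w\<in>Fix \<rho> K. \<forall>j\<in>{i}. v j = \<rho> \<one> w} = {v \<in> V_pow n. v i \<in> Fix \<rho> K}"
      by (auto simp: rho_one)
    with D_gain_of[OF 2(3) _ c] gain_of_gains[OF 2(3) _ c, of "{1..n}"] 2
    show ?thesis unfolding ann_def by (intro image_eqI[of _ _ "gain_of {i} K (\<lambda>_. \<one>)"]) simp_all
  qed
next
  fix X assume "X \<in> ann n ` gains {1..n}"
  then obtain R where R: "R \<in> gains {1..n}" "X = ann n R" by blast
  obtain c where c: "\<forall>i\<in>supp R. c i \<in> carrier G" "R = gain_of (supp R) (isotropy R) c"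
    using gains_gain_of[OF R(1)] .
  let ?I = "supp R" and ?K = "isotropy R"
  note K = isotropy_closed[OF R(1)] and I = supp_nonempty[OF R(1)] and sub = supp_subset[OF R(1)]
  have fin: "finite ?I" using sub finite_subset by blast
  have X: "X = annihilator scale n {v \<in> V_pow n. \<exists>w\<in>Fix \<rho> ?K. \<forall>i\<in>?I. v i = \<rho> (c i) w}"
    using D_gain_of[OF K I c(1), of n] c(2) R(2) by (simp add: ann_def)
  show "X \<in> building_set scale G \<rho> n"
  proof (cases "card ?I \<ge> 2")
    case True
    then show ?thesis unfolding building_set_def using X K c(1) sub by blast
  next
    case False
    then have "card ?I = 1" using I fin card_gt_0_iff[of ?I] by linarith
    then obtain i where i: "?I = {i}" by (auto simp: card_1_singleton_iff)
    have ci: "c i \<in> carrier G" using c(1) i by simp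
    have "?K \<noteq> {\<one>}" using isotropy_singleton[OF R(1) i] .
    \<comment> \<open>For a single coordinate the factor \<open>c i\<close> disappears, because
      commutativity makes the fixed space of a subgroup stable under the whole group.\<close>
    moreover have "(\<exists>w\<in>Fix \<rho> ?K. x = \<rho> (c i) w) \<longleftrightarrow> x \<in> Fix \<rho> ?K" for x
    proof -
      have stable: "\<rho> g w \<in> Fix \<rho> ?K" if w: "w \<in> Fix \<rho> ?K" and g: "g \<in> carrier G" for g w
      proof -
        have "\<rho> k (\<rho> g w) = \<rho> g w" if k: "k \<in> ?K" for k
        proof -
          have kc: "k \<in> carrier G" using subgroup.mem_carrier[OF closed_subgroupD[OF K] k] .
          have "\<rho> k (\<rho> g w) = \<rho> g (\<rho> k w)"
            using rho_mult[of k g w] rho_mult[of g k w] g kc m_comm[of g k] by simp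
          then show ?thesis using w k by (simp add: Fix_def)
        qed
        then show ?thesis by (simp add: Fix_def)
      qed
      have "x = \<rho> (c i) (\<rho> (inv (c i)) x)" using ci by (simp add: rho_inv')
      then show ?thesis using stable ci by (metis inv_closed)
    qed
    then have "X = annihilator scale n {v \<in> V_pow n. v i \<in> Fix \<rho> ?K}" unfolding X i by simp
    ultimately show ?thesis unfolding building_set_def using K sub i by blast
  qed
qed

text \<open>\<open>R\<close> collects all equations valid on the intersection, and
  \<open>meet\<close> makes it connected. A common index joins the supports by composition of gains;
  isotropy \<open>carrier G\<close> on both sides makes all coordinates vanish, so that
  \<open>\<one>\<close> is a gain across.\<close>

lemma D_Int_gain:
  assumes R1: "R1 \<in> gains {1..n}" and R2: "R2 \<in> gains {1..n}"
    and meet: "supp R1 \<inter> supp R2 \<noteq> {} \<or> isotropy R1 = carrier G \<and> isotropy R2 = carrier G"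
  obtains R where "R \<in> gains {1..n}" "D n R = D n R1 \<inter> D n R2"
proof -
  let ?D = "D n R1 \<inter> D n R2" and ?I = "supp R1 \<union> supp R2"
  define R where "R = {(i, j, g). i \<in> ?I \<and> j \<in> ?I \<and> g \<in> carrier G \<and> (\<forall>v\<in>?D. v i = \<rho> g (v j))}"
  have sub: "R1 \<subseteq> R" "R2 \<subseteq> R"
    using gain_subset[OF R1] gain_subset[OF R2] D_eq unfolding R_def by fast+
  have 1: "(j, i, inv g) \<in> R" if "(i, j, g) \<in> R" for i j g
  proof -
    have *: "i \<in> ?I" "j \<in> ?I" "g \<in> carrier G" "\<And>v. v \<in> ?D \<Longrightarrow> v i = \<rho> g (v j)"
      using that unfolding R_def by blast+
    have "v j = \<rho> (inv g) (v i)" if "v \<in> ?D" for v using *(4)[OF that] rho_inv[OF *(3)] by simp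
    then show ?thesis using *(1-3) unfolding R_def by simp
  qed
  have 2: "(i, k, g \<otimes> h) \<in> R" if "(i, j, g) \<in> R" "(j, k, h) \<in> R" for i j k g h
  proof -
    have *: "i \<in> ?I" "g \<in> carrier G" "\<And>v. v \<in> ?D \<Longrightarrow> v i = \<rho> g (v j)"
      "k \<in> ?I" "h \<in> carrier G" "\<And>v. v \<in> ?D \<Longrightarrow> v j = \<rho> h (v k)"
      using that unfolding R_def by blast+
    have "v i = \<rho> (g \<otimes> h) (v k)" if "v \<in> ?D" for v
      using *(3)[OF that] *(6)[OF that] rho_mult[OF *(2,5)] by simp
    then show ?thesis using *(1,2,4,5) unfolding R_def by simp
  qed
  have zero: "v i = 0"
    if RR: "RR \<in> gains {1..n}" "isotropy RR = carrier G" "v \<in> D n RR" "i \<in> supp RR" for RR v i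
  proof -
    have "\<rho> g (v i) = v i" if "g \<in> carrier G" for g
      using D_eq[OF RR(3), of i i g] isotropy_at[OF RR(1,4)] RR(2) that by auto
    then have "v i \<in> Fix \<rho> (carrier G)" by (simp add: Fix_def)
    then show ?thesis using Fix_carrier by simp
  qed
  have cross: "\<exists>g. (i, j, g) \<in> R" if i: "i \<in> supp R1" and j: "j \<in> supp R2" for i j
  proof (cases "supp R1 \<inter> supp R2 = {}")
    case False
    then obtain k where k: "k \<in> supp R1" "k \<in> supp R2" by blast
    obtain g h where "(i, k, g) \<in> R1" "(k, j, h) \<in> R2"
      using gain_connected[OF R1 i k(1)] gain_connected[OF R2 k(2) j] by blast
    then show ?thesis using 2 sub by blast
  next
    case True
    then have G: "isotropy R1 = carrier G" "isotropy R2 = carrier G" using meet by auto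
    have "v i = \<rho> \<one> (v j)" if "v \<in> ?D" for v
      using zero[OF R1 G(1) _ i, of v] zero[OF R2 G(2) _ j, of v] that by (simp add: rho_0)
    then have "(i, j, \<one>) \<in> R" using i j by (simp add: R_def)
    then show ?thesis ..
  qed
  have 3: "\<exists>g. (i, j, g) \<in> R" if ij: "i \<in> ?I" "j \<in> ?I" for i j
  proof -
    consider "i \<in> supp R1" "j \<in> supp R1" | "i \<in> supp R2" "j \<in> supp R2"
      | "i \<in> supp R1" "j \<in> supp R2" | "i \<in> supp R2" "j \<in> supp R1" using ij by blast
    then show ?thesis
    proof cases
      case 1
      then show ?thesis using gain_connected[OF R1] sub by blast
    next
      case 2
      then show ?thesis using gain_connected[OF R2] sub by blast
    next
      case 3
      then show ?thesis by (rule cross)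
    next
      case 4
      then show ?thesis using cross[OF 4(2,1)] 1 by blast
    qed
  qed
  have supp: "supp R = ?I"
  proof
    show "?I \<subseteq> supp R" using supp_mono sub by blast
    show "supp R \<subseteq> ?I"
    proof
      fix i assume "i \<in> supp R"
      then obtain j g where "(i, j, g) \<in> R" unfolding supp_def by auto
      then show "i \<in> ?I" unfolding R_def by simp
    qed
  qed
  obtain i0 where i0: "i0 \<in> ?I" using supp_nonempty[OF R1] by blast
  \<comment> \<open>Transport from \<open>i0\<close> to \<open>i\<close> commutes with the action,
    so loops can be tested at one index. As a pointwise stabiliser the isotropy group is then
    closed.\<close>
  have "isotropy R = stab ((\<lambda>v. v i0) ` ?D)"
  proof -
    have "(i, i, g) \<in> R \<longleftrightarrow> g \<in> stab ((\<lambda>v. v i0) ` ?D)" if i: "i \<in> ?I" for i g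
    proof -
      obtain h where h: "(i, i0, h) \<in> R" using 3[OF i i0] by blast
      have hc: "h \<in> carrier G" using h by (simp add: R_def)
      have "v i = \<rho> g (v i) \<longleftrightarrow> \<rho> g (v i0) = v i0" if v: "v \<in> ?D" and g: "g \<in> carrier G" for v
      proof -
        have vi: "v i = \<rho> h (v i0)" using h v by (simp add: R_def)
        have "\<rho> g (v i) = \<rho> h (\<rho> g (v i0))"
          using rho_mult[of g h "v i0"] rho_mult[of h g "v i0"] g hc m_comm[of g h] vi by simp
        moreover have "\<rho> h x = \<rho> h y \<longleftrightarrow> x = y" for x y using rho_inv[OF hc] by metis
        ultimately show ?thesis using vi by metis
      qed
      then show ?thesis using i by (auto simp: R_def stab_def)
    qed
    moreover have "(i, i, g) \<in> R \<Longrightarrow> i \<in> ?I" for i g by (simp add: R_def)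
    ultimately show ?thesis using i0 unfolding isotropy_def by blast
  qed
  then have 7: "isotropy R \<in> closed_subgroups G \<rho>" using stab_closed by simp
  have 4: "R \<noteq> {(i, i, \<one>)}" for i
  proof
    assume "R = {(i, i, \<one>)}"
    then have "R1 = {(i, i, \<one>)}" using sub R1 by (auto simp: gains_def)
    then show False using R1 by (auto simp: gains_def)
  qed
  have 5: "R \<noteq> {}" using sub R1 by (auto simp: gains_def)
  have 6: "R \<subseteq> {1..n} \<times> {1..n} \<times> carrier G"
    using supp_subset[OF R1] supp_subset[OF R2] unfolding R_def by blast
  have "R \<in> gains {1..n}" by (rule gainsI) (use 1 2 3 4 5 6 7 supp in simp_all)
  moreover have "D n R = ?D"
  proof
    show "D n R \<subseteq> ?D" using D_mono sub by blast
    show "?D \<subseteq> D n R" using D_V_pow by (intro subsetI D_I) (auto simp: R_def)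
  qed
  ultimately show ?thesis by (rule that)
qed

section \<open>Sums of annihilators and nestedness\<close>

lemma sum_of_two_subspaces:
  assumes "A \<noteq> B"
  shows "sum_of_subspaces {A, B} = {a + b | a b. a \<in> A \<and> b \<in> B}"
proof (intro equalityI subsetI)
  fix y assume "y \<in> sum_of_subspaces {A, B}"
  then show "y \<in> {a + b | a b. a \<in> A \<and> b \<in> B}"
    using assms by (auto simp: sum_of_subspaces_def)
next
  fix y assume "y \<in> {a + b | a b. a \<in> A \<and> b \<in> B}"
  then obtain a b where ab: "y = a + b" "a \<in> A" "b \<in> B" by blast
  then show "y \<in> sum_of_subspaces {A, B}"
    unfolding sum_of_subspaces_def using assms
    by (intro CollectI exI[of _ "\<lambda>X. if X = A then a else b"]) auto
qed

lemma sum_of_ann: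
  assumes R1: "R1 \<in> gains {1..n}" and R2: "R2 \<in> gains {1..n}"
    and R: "R \<in> gains {1..n}" "D n R = D n R1 \<inter> D n R2" and ne: "ann n R1 \<noteq> ann n R2"
  shows "sum_of_subspaces {ann n R1, ann n R2} = ann n R"
  unfolding sum_of_two_subspaces[OF ne]
proof (intro equalityI subsetI)
  fix y assume "y \<in> {a + b | a b. a \<in> ann n R1 \<and> b \<in> ann n R2}"
  then obtain a b where "y = a + b" "a \<in> ann n R1" "b \<in> ann n R2" by blast
  then show "y \<in> ann n R" using annihilator_add by (simp add: ann_def R(2))
next
  fix y assume "y \<in> ann n R"
  then have "y \<in> annihilator scale n (D n R1 \<inter> D n R2)" by (simp add: ann_def R(2))
  then obtain f1 f2 where "f1 \<in> ann n R1" "f2 \<in> ann n R2" "y = f1 + f2"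
    using annihilator_Int[OF D_subspace[OF R1] D_V_pow D_subspace[OF R2]]
    unfolding ann_def by blast
  then show "y \<in> {a + b | a b. a \<in> ann n R1 \<and> b \<in> ann n R2}" by blast
qed

lemma sum_fun_at: "(\<Sum>A\<in>T. x A) v = (\<Sum>A\<in>T. x A v)"
  for x :: "'c \<Rightarrow> 'd \<Rightarrow> 'e::comm_monoid_add"
  by (induction T rule: infinite_finite_induct) auto

text \<open>An incompatible pair already violates nestedness: it is incomparable and satisfies the
  hypothesis \<open>meet\<close> of \<open>D_Int_gain\<close>, so the sum of its two annihilators
  lies in the building set.\<close>

lemma families_if_nested:
  assumes S: "S \<subseteq> gains {1..n}" and nested: "nested_set (building_set scale G \<rho> n) (ann n ` S)"
  shows "S \<in> families {1..n}"
proof -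
  have "compatible R1 R2" if R1: "R1 \<in> S" and R2: "R2 \<in> S" for R1 R2
  proof (rule ccontr)
    assume n: "\<not> compatible R1 R2"
    have g: "R1 \<in> gains {1..n}" "R2 \<in> gains {1..n}" using R1 R2 S by auto
    have inc: "\<not> R1 \<subseteq> R2" "\<not> R2 \<subseteq> R1" using n by (auto simp: compatible_def)
    then have ainc: "\<not> ann n R1 \<subseteq> ann n R2" "\<not> ann n R2 \<subseteq> ann n R1"
      using ann_subset_iff g by blast+
    then have ne: "ann n R1 \<noteq> ann n R2" by blast
    obtain R where R: "R \<in> gains {1..n}" "D n R = D n R1 \<inter> D n R2"
      using D_Int_gain[OF g] n unfolding compatible_def by blast
    let ?T = "{ann n R1, ann n R2}"
    have "?T \<subseteq> ann n ` S" "finite ?T" "card ?T \<ge> 2" using R1 R2 ne by auto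
    moreover have "pairwise (\<lambda>X Y. \<not> X \<subseteq> Y \<and> \<not> Y \<subseteq> X) ?T" using ainc by (auto simp: pairwise_def)
    ultimately have "sum_of_subspaces ?T \<notin> building_set scale G \<rho> n"
      using nested unfolding nested_set_def by blast
    then show False using sum_of_ann[OF g R ne] building_set_eq R(1) by simp
  qed
  then show ?thesis using S by (auto simp: families_def)
qed

text \<open>The part of \<open>v\<close> outside \<open>supp R\<close> solves \<open>R\<close>, so
  the functional kills it.\<close>

lemma ann_restrict:
  assumes R: "R \<in> gains {1..n}" and f: "f \<in> ann n R" and v: "v \<in> V_pow n"
  shows "f v = f (\<lambda>i. if i \<in> supp R then v i else 0)"
proof -
  let ?u = "\<lambda>i. if i \<in> supp R then v i else 0" and ?w = "\<lambda>i. if i \<in> supp R then 0 else v i"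
  have V: "?u \<in> V_pow n" "?w \<in> V_pow n" using v by (auto simp: V_pow_def)
  then have "f (\<lambda>i. ?u i + ?w i) = f ?u + f ?w"
    using f by (simp add: ann_def annihilator_def dual_V_pow_def)
  moreover have "(\<lambda>i. ?u i + ?w i) = v" by auto
  moreover have "?w \<in> D n R" by (rule in_D_outside[OF R V(2)]) simp
  then have "f ?w = 0" using f by (simp add: ann_def annihilator_def)
  ultimately show ?thesis by simp
qed

lemma ann_0: "0 \<in> ann n R"
  using dual_0 by (auto simp: ann_def annihilator_def)

lemma nested_if_families:
  assumes S: "S \<in> families {1..n}"
  shows "nested_set (building_set scale G \<rho> n) (ann n ` S)"
  unfolding nested_set_def
proof (intro conjI allI impI)
  note g = families_sub[OF S]
  show "ann n ` S \<subseteq> building_set scale G \<rho> n" using g building_set_eq by blast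
  fix T assume T: "T \<subseteq> ann n ` S \<and> finite T \<and> card T \<ge> 2 \<and>
    pairwise (\<lambda>X Y. \<not> X \<subseteq> Y \<and> \<not> Y \<subseteq> X) T"
  have inc: "supp R1 \<inter> supp R2 = {} \<and> \<not> (isotropy R1 = carrier G \<and> isotropy R2 = carrier G)"
    if R: "R1 \<in> S" "R2 \<in> S" "ann n R1 \<in> T" "ann n R2 \<in> T" "ann n R1 \<noteq> ann n R2" for R1 R2
  proof -
    have "\<not> ann n R1 \<subseteq> ann n R2 \<and> \<not> ann n R2 \<subseteq> ann n R1"
      using T R(3-5) by (auto simp: pairwise_def)
    then have "\<not> R1 \<subseteq> R2" "\<not> R2 \<subseteq> R1" using ann_subset_iff g R(1,2) by blast+
    then show ?thesis using families_compatible[OF S R(1,2)] by (simp add: compatible_def)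
  qed
  show "in_direct_sum T"
    unfolding in_direct_sum_def
  proof (intro allI impI ballI)
    fix x A assume x: "(\<forall>A\<in>T. x A \<in> A) \<and> (\<Sum>A\<in>T. x A) = 0" and A: "A \<in> T"
    obtain R where R: "R \<in> S" "A = ann n R" using T A by blast
    show "x A = 0"
    proof
      fix v
      show "x A v = 0 v"
      proof (cases "v \<in> V_pow n")
        case True
        \<comment> \<open>On this part of \<open>v\<close> every other summand vanishes, because its
          support is disjoint from \<open>supp R\<close>; the zero sum thus isolates
          \<open>x A\<close>.\<close>
        let ?u = "\<lambda>i. if i \<in> supp R then v i else 0"
        have u: "?u \<in> V_pow n" using True by (auto simp: V_pow_def)
        have "x B ?u = 0" if B: "B \<in> T - {A}" for B
        proof -
          obtain R' where R': "R' \<in> S" "B = ann n R'" using T B by blast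
          then have "supp R \<inter> supp R' = {}" using inc[OF R(1) R'(1)] R(2) A B by auto
          then have "?u \<in> D n R'" by (intro in_D_outside[OF g[OF R'(1)] u]) auto
          then show ?thesis using x B R'(2) by (auto simp: ann_def annihilator_def)
        qed
        then have "(\<Sum>B\<in>T. x B ?u) = x A ?u"
          using T A sum.remove[of T A "\<lambda>B. x B ?u"] by simp
        moreover have "(\<Sum>B\<in>T. x B ?u) = 0"
          using x sum_fun_at[of x T ?u] by simp
        moreover have "x A v = x A ?u"
          using ann_restrict[OF g[OF R(1)] _ True] x A R(2) by blast
        ultimately show ?thesis by simp
      next
        case False
        have "x A \<in> dual_V_pow scale n" using x A R(2) by (auto simp: ann_def annihilator_def)
        then show ?thesis using False by (simp add: dual_V_pow_def)
      qed
    qed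
  qed
  show "sum_of_subspaces T \<notin> building_set scale G \<rho> n"
  proof
    assume "sum_of_subspaces T \<in> building_set scale G \<rho> n"
    then obtain R where R: "R \<in> gains {1..n}" "sum_of_subspaces T = ann n R"
      using building_set_eq by blast
    have zT: "0 \<in> A" if "A \<in> T" for A using that T ann_0 by blast
    have le: "A \<subseteq> sum_of_subspaces T" if A: "A \<in> T" for A
    proof
      fix a assume "a \<in> A"
      moreover have "(\<Sum>B\<in>T. if B = A then a else 0) = a" using T A by simp
      ultimately show "a \<in> sum_of_subspaces T"
        unfolding sum_of_subspaces_def using zT
        by (intro CollectI exI[of _ "\<lambda>B. if B = A then a else 0"]) auto
    qed
    obtain A1 A2 where A: "A1 \<in> T" "A2 \<in> T" "A1 \<noteq> A2"
      using T by (metis card_le_Suc0_iff_eq not_less_eq_eq numeral_2_eq_2)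
    \<comment> \<open>Of two distinct members of \<open>T\<close> at most one has isotropy
      \<open>carrier G\<close>. \<open>R1\<close> is chosen to be the other one, so that it has
      nonzero fixed vectors.\<close>
    have "\<exists>R1\<in>S. \<exists>R2\<in>S. ann n R1 \<in> T \<and> ann n R2 \<in> T \<and> ann n R1 \<noteq> ann n R2 \<and>
      isotropy R1 \<noteq> carrier G"
    proof -
      obtain R1 R2 where "R1 \<in> S" "R2 \<in> S" "A1 = ann n R1" "A2 = ann n R2" using T A by blast
      then show ?thesis using inc[of R1 R2] A by metis
    qed
    then obtain R1 R2 where R12: "R1 \<in> S" "R2 \<in> S" "ann n R1 \<in> T" "ann n R2 \<in> T"
      "ann n R1 \<noteq> ann n R2" "isotropy R1 \<noteq> carrier G" by blast
    have sub: "R1 \<subseteq> R" "R2 \<subseteq> R"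
      using le R12(3,4) R(2) ann_subset_iff[OF g[OF R12(1)] R(1)] ann_subset_iff[OF g[OF R12(2)] R(1)]
      by auto
    obtain i1 i2 where i: "i1 \<in> supp R1" "i2 \<in> supp R2"
      using supp_nonempty[OF g[OF R12(1)]] supp_nonempty[OF g[OF R12(2)]] by blast
    \<comment> \<open>\<open>v\<close> spreads \<open>w\<close> over \<open>supp R1\<close> and
      vanishes elsewhere, so every functional in the sum kills it and it solves \<open>R\<close>.
      But \<open>R\<close> connects \<open>i1\<close> with \<open>i2\<close>, where \<open>v\<close>
      is 0, which contradicts \<open>w \<noteq> 0\<close>.\<close>
    obtain w where w: "w \<in> Fix \<rho> (isotropy R1)" "w \<noteq> 0"
      using Fix_nonzero[OF isotropy_closed[OF g[OF R12(1)]] R12(6)] by blast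
    obtain v where v: "v \<in> D n R1" "v i1 = w" "\<And>i. i \<notin> supp R1 \<Longrightarrow> v i = 0"
      using D_witness[OF g[OF R12(1)] i(1) w(1)] by blast
    have vV: "v \<in> V_pow n" using v(1) D_V_pow by blast
    have kill: "a v = 0" if A: "A \<in> T" and a: "a \<in> A" for A a
    proof -
      obtain R' where R': "R' \<in> S" "A = ann n R'" using T A by blast
      have "v \<in> D n R'"
      proof (cases "ann n R' = ann n R1")
        case True
        then have "R' = R1" using inj_onD[OF inj_on_ann True] g R'(1) R12(1) by blast
        then show ?thesis using v(1) by simp
      next
        case False
        then have "supp R1 \<inter> supp R' = {}" using inc[OF R12(1) R'(1) R12(3)] A R'(2) by simp
        then show ?thesis by (intro in_D_outside[OF g[OF R'(1)] vV]) (use v(3) in auto)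
      qed
      then show ?thesis using a R'(2) by (simp add: ann_def annihilator_def)
    qed
    have "v \<in> D n R"
    proof (rule ccontr)
      assume "v \<notin> D n R"
      then obtain f where f: "f \<in> ann n R" "f v \<noteq> 0"
        using annihilator_separates[OF D_subspace[OF R(1)] vV] unfolding ann_def by blast
      then obtain x where x: "f = (\<Sum>A\<in>T. x A)" "\<forall>A\<in>T. x A \<in> A"
        using R(2) unfolding sum_of_subspaces_def by blast
      have "f v = (\<Sum>A\<in>T. x A v)" unfolding x(1) by (rule sum_fun_at)
      also have "\<dots> = 0" using kill x(2) by (intro sum.neutral) blast
      finally show False using f(2) by simp
    qed
    moreover obtain h where h: "(i1, i2, h) \<in> R"
      using gain_connected[OF R(1)] supp_mono[OF sub(1)] supp_mono[OF sub(2)] i by blast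
    moreover have "supp R1 \<inter> supp R2 = {}" using inc[OF R12(1-5)] by simp
    then have "v i2 = 0" using v(3) i(2) by blast
    ultimately have "v i1 = 0"
      using D_eq[of v n R i1 i2 h] gain_carrier[OF R(1) h] by (simp add: rho_0)
    then show False using v(2) w(2) by simp
  qed
qed

lemma card_nested_sets:
  "card {S. nested_set (building_set scale G \<rho> n) S \<and> S \<noteq> {}} = card (families {1..n} - {{}})"
proof -
  have "bij_betw (\<lambda>S. ann n ` S) (families {1..n} - {{}})
      {S. nested_set (building_set scale G \<rho> n) S \<and> S \<noteq> {}}"
    unfolding bij_betw_def
  proof
    have sub: "S \<subseteq> gains {1..n}" if "S \<in> families {1..n} - {{}}" for S
      using that by (auto simp: families_def)
    show "inj_on (\<lambda>S. ann n ` S) (families {1..n} - {{}})"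
      by (rule inj_onI) (use inj_on_image_eq_iff[OF inj_on_ann sub sub] in blast)
    show "(\<lambda>S. ann n ` S) ` (families {1..n} - {{}}) =
        {S. nested_set (building_set scale G \<rho> n) S \<and> S \<noteq> {}}"
    proof (intro equalityI subsetI)
      fix T assume "T \<in> {S. nested_set (building_set scale G \<rho> n) S \<and> S \<noteq> {}}"
      then have T: "nested_set (building_set scale G \<rho> n) T" "T \<noteq> {}" by auto
      then have "T \<subseteq> ann n ` gains {1..n}" by (simp add: nested_set_def building_set_eq)
      then obtain S where S: "S \<subseteq> gains {1..n}" "T = ann n ` S" by (auto simp: subset_image_iff)
      then have "S \<in> families {1..n}" using families_if_nested T(1) by simp
      then show "T \<in> (\<lambda>S. ann n ` S) ` (families {1..n} - {{}})" using S(2) T(2) by blast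
    qed (use nested_if_families in auto)
  qed
  then show ?thesis by (rule bij_betw_same_card[symmetric])
qed

end

section \<open>Counting families\<close>

text \<open>The bijection is one of the whole type, equal to the identity outside
  \<open>A \<union> B\<close>, so that \<open>relabel\<close> is invertible without side conditions
  on supports.\<close>

lemma ex_bij_image:
  fixes A B :: "'a set"
  assumes "finite A" "finite B" "card A = card B"
  obtains f where "bij f" "f ` A = B"
proof -
  obtain g where g: "bij_betw g A B" using finite_same_card_bij[OF assms] by blast
  have "card (A \<union> B - A) = card (A \<union> B - B)"
    using assms by (simp add: card_Diff_subset)
  then obtain h where h: "bij_betw h (A \<union> B - A) (A \<union> B - B)"
    using finite_same_card_bij[of "A \<union> B - A" "A \<union> B - B"] assms by auto
  define f where "f x = (if x \<in> A then g x else if x \<in> A \<union> B then h x else x)" for x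
  have f1: "bij_betw f A B" using g by (subst bij_betw_cong[of A f g]) (auto simp: f_def)
  have f2: "bij_betw f (A \<union> B - A) (A \<union> B - B)"
    using h by (subst bij_betw_cong[of _ f h]) (auto simp: f_def)
  have f3: "bij_betw f (- (A \<union> B)) (- (A \<union> B))"
    using bij_betw_id by (subst bij_betw_cong[of _ f id]) (auto simp: f_def id_def)
  have "bij_betw f (A \<union> (A \<union> B - A)) (B \<union> (A \<union> B - B))"
    by (rule bij_betw_combine[OF f1 f2]) auto
  then have "bij_betw f (A \<union> B) (A \<union> B)" by (simp add: Un_Diff_cancel Un_absorb1 Un_ac)
  then have "bij_betw f ((A \<union> B) \<union> - (A \<union> B)) ((A \<union> B) \<union> - (A \<union> B))"
    by (rule bij_betw_combine[OF _ f3]) auto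
  then have "bij f" unfolding Compl_partition .
  then show ?thesis using that f1 by (auto simp: bij_betw_def)
qed

section \<open>Relabelling of indices\<close>

definition relabel :: "(nat \<Rightarrow> nat) \<Rightarrow> (nat \<times> nat \<times> 'g) set \<Rightarrow> (nat \<times> nat \<times> 'g) set" where
  "relabel f R = (\<lambda>(i, j, g). (f i, f j, g)) ` R"

lemma inj_relabel_map: "bij f \<Longrightarrow> inj (\<lambda>(i, j, g). (f i, f j, g))"
  by (auto simp: inj_on_def dest: bij_is_inj injD)

lemma relabel_iff [simp]: "bij f \<Longrightarrow> (f i, f j, g) \<in> relabel f R \<longleftrightarrow> (i, j, g) \<in> R"
  using inj_image_mem_iff[OF inj_relabel_map, of f "(i, j, g)" R] by (simp add: relabel_def)

lemma relabel_subset: "bij f \<Longrightarrow> relabel f R \<subseteq> relabel f R' \<longleftrightarrow> R \<subseteq> R'"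
  unfolding relabel_def by (rule inj_image_subset_iff[OF inj_relabel_map])

lemma relabel_inj: "bij f \<Longrightarrow> relabel f R = relabel f R' \<longleftrightarrow> R = R'"
  unfolding relabel_def by (rule inj_image_eq_iff[OF inj_relabel_map])

lemma supp_relabel: "supp (relabel f R) = f ` supp R"
  by (force simp: supp_def relabel_def)

lemma isotropy_relabel:
  assumes "bij f"
  shows "isotropy (relabel f R) = isotropy R"
proof -
  have "(\<exists>i. (i, i, g) \<in> relabel f R) \<longleftrightarrow> (\<exists>i. (f i, f i, g) \<in> relabel f R)" for g
    by (metis assms bij_pointE)
  then show ?thesis using assms by (simp add: isotropy_def)
qed

lemma relabel_inverse:
  assumes "bij f"
  shows "relabel f (relabel (inv_into UNIV f) R) = R" "relabel (inv_into UNIV f) (relabel f R) = R"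
  using assms
  by (simp_all add: relabel_def image_image case_prod_beta bij_is_surj surj_f_inv_f bij_is_inj)

context gain_setup
begin

text \<open>By \<open>card_forest\<close>, this is the number of trees of the forest that belongs to
  \<open>S\<close>: roots plus fallen leaves.\<close>

definition ncomp :: "nat set \<Rightarrow> (nat \<times> nat \<times> 'g) set set \<Rightarrow> nat" where
  "ncomp A S = card (maxes S) + card (A - \<Union> (supp ` S))"

text \<open>The empty family is included. It stands for the forest of fallen leaves only, which
  \<open>Gamma\<close> counts but \<open>Gamma_bar\<close> does not.\<close>

definition plain :: "nat set \<Rightarrow> (nat \<times> nat \<times> 'g) set set set" where
  "plain A = {S \<in> families A. \<forall>R\<in>S. isotropy R \<noteq> carrier G}"

definition plain_cover :: "nat set \<Rightarrow> (nat \<times> nat \<times> 'g) set set set" where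
  "plain_cover A = {S \<in> plain A. \<Union> (supp ` S) = A}"

text \<open>In a representation these equations say that all coordinates in \<open>A\<close> vanish,
  because Fix G is zero. By \<open>gain_full\<close> it is the only relation with support
  \<open>A\<close> and isotropy \<open>carrier G\<close>.\<close>

definition full :: "nat set \<Rightarrow> (nat \<times> nat \<times> 'g) set" where
  "full A = A \<times> A \<times> carrier G"

definition rooted :: "nat set \<Rightarrow> (nat \<times> nat \<times> 'g) set set set" where
  "rooted A = {S \<in> families A. full A \<in> S}"

definition with_carrier :: "nat set \<Rightarrow> (nat \<times> nat \<times> 'g) set set set" where
  "with_carrier A = {S \<in> families A. \<exists>R\<in>S. isotropy R = carrier G}"

lemma relabel_gains:
  assumes f: "bij f" and R: "R \<in> gains A"
  shows "relabel f R \<in> gains (f ` A)"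
proof -
  let ?R = "relabel f R"
  have ex: "\<exists>j. i = f j" for i using f by (metis bij_pointE)
  have 1: "(j, i, inv g) \<in> ?R" if "(i, j, g) \<in> ?R" for i j g
    using that ex[of i] ex[of j] f gain_sym[OF R] by auto
  have 2: "(i, k, g \<otimes> h) \<in> ?R" if "(i, j, g) \<in> ?R" "(j, k, h) \<in> ?R" for i j k g h
    using that ex[of i] ex[of j] ex[of k] f gain_trans[OF R] by auto
  have 3: "\<exists>g. (i, j, g) \<in> ?R" if "i \<in> f ` supp R" "j \<in> f ` supp R" for i j
    using that f gain_connected[OF R] by auto
  have 4: "?R \<noteq> {(i, i, \<one>)}" for i
  proof -
    obtain k where k: "i = f k" using ex by blast
    have "{(i, i, \<one>)} = relabel f {(k, k, \<one>)}" by (simp add: relabel_def k)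
    moreover have "R \<noteq> {(k, k, \<one>)}" using R by (auto simp: gains_def)
    ultimately show ?thesis by (simp add: relabel_inj[OF f])
  qed
  have 5: "?R \<noteq> {}" using R by (auto simp: relabel_def gains_def)
  have 6: "?R \<subseteq> f ` A \<times> f ` A \<times> carrier G" using R by (auto simp: relabel_def gains_def)
  have 7: "isotropy ?R \<in> closed_subgroups G \<rho>"
    using isotropy_closed[OF R] by (simp add: isotropy_relabel[OF f])
  show ?thesis by (rule gainsI) (use 1 2 3 4 5 6 7 supp_relabel[of f R] in simp_all)
qed

lemma relabel_compatible:
  assumes "bij f"
  shows "compatible (relabel f R) (relabel f R') \<longleftrightarrow> compatible R R'"
  unfolding compatible_def relabel_subset[OF assms] isotropy_relabel[OF assms] supp_relabel
    image_Int[OF bij_is_inj[OF assms], symmetric] by simp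

lemma relabel_families:
  assumes f: "bij f" and S: "S \<in> families A"
  shows "relabel f ` S \<in> families (f ` A)"
  using relabel_gains[OF f families_sub[OF S]] relabel_compatible[OF f] families_compatible[OF S]
  unfolding families_def by auto

text \<open>\<open>Q\<close> stands for any class of families that is invariant under all
  relabellings; invariance under the inverse bijection supplies the inverse map.\<close>

lemma bij_relabel:
  assumes f: "bij f" and Q: "\<And>f A S. bij f \<Longrightarrow> S \<in> Q A \<Longrightarrow> relabel f ` S \<in> Q (f ` A)"
  shows "bij_betw ((`) (relabel f)) (Q A) (Q (f ` A))"
proof -
  let ?h = "inv_into UNIV f"
  have h: "bij ?h" using bij_betw_inv_into[OF f] .
  show ?thesis
  proof (rule bij_betw_byWitness[where f' = "(`) (relabel ?h)"])
    show "(`) (relabel f) ` Q A \<subseteq> Q (f ` A)" using Q[OF f] by blast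
    have "?h ` f ` A = A" using f by (simp add: image_image bij_is_inj)
    then show "(`) (relabel ?h) ` Q (f ` A) \<subseteq> Q A" using Q[OF h, of _ "f ` A"] by auto
  qed (simp_all add: image_image relabel_inverse[OF f])
qed

lemma maxes_relabel:
  assumes "bij f"
  shows "maxes (relabel f ` S) = relabel f ` maxes S"
  by (force simp: maxes_def relabel_subset[OF assms] relabel_inj[OF assms])

lemma ncomp_relabel:
  assumes f: "bij f"
  shows "ncomp (f ` A) (relabel f ` S) = ncomp A S"
proof -
  have "card (relabel f ` maxes S) = card (maxes S)"
    by (rule card_image) (simp add: inj_on_def relabel_inj[OF f])
  moreover have "f ` A - (\<Union>R\<in>S. f ` supp R) = f ` (A - \<Union> (supp ` S))"
    using bij_is_inj[OF f] by (simp add: image_set_diff image_UN)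
  moreover have "card (f ` (A - \<Union> (supp ` S))) = card (A - \<Union> (supp ` S))"
    using bij_is_inj[OF f] by (simp add: card_image inj_on_subset)
  ultimately show ?thesis
    by (simp add: ncomp_def maxes_relabel[OF f] image_image supp_relabel)
qed

lemma relabel_plain: "bij f \<Longrightarrow> S \<in> plain A \<Longrightarrow> relabel f ` S \<in> plain (f ` A)"
  using relabel_families by (auto simp: plain_def isotropy_relabel)

lemma relabel_plain_cover: "bij f \<Longrightarrow> S \<in> plain_cover A \<Longrightarrow> relabel f ` S \<in> plain_cover (f ` A)"
  using relabel_plain[of f S A] by (auto simp: plain_cover_def supp_relabel)

lemma relabel_rooted: "bij f \<Longrightarrow> S \<in> rooted A \<Longrightarrow> relabel f ` S \<in> rooted (f ` A)"
proof -
  have "relabel f (full A) = full (f ` A)" unfolding relabel_def full_def by force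
  then show "bij f \<Longrightarrow> S \<in> rooted A \<Longrightarrow> relabel f ` S \<in> rooted (f ` A)"
    using relabel_families unfolding rooted_def by (metis (no_types, lifting) image_eqI mem_Collect_eq)
qed

text \<open>For \<open>A = {1..n}\<close> this is the coefficient of t^n/n! in the series of the
  class \<open>X\<close>, as a polynomial in s.\<close>

definition weight :: "nat set \<Rightarrow> (nat \<times> nat \<times> 'g) set set set \<Rightarrow> rat poly" where
  "weight A X = (\<Sum>S\<in>X. monom 1 (ncomp A S))"

lemma weight_relabel:
  assumes Q: "\<And>f A S. bij f \<Longrightarrow> S \<in> Q A \<Longrightarrow> relabel f ` S \<in> Q (f ` A)" and A: "finite A"
  shows "weight A (Q A) = weight {1..card A} (Q {1..card A})"
proof -
  obtain f :: "nat \<Rightarrow> nat" where f: "bij f" "f ` A = {1..card A}"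
    using ex_bij_image[OF A, of "{1..card A}"] by auto
  show ?thesis
    unfolding weight_def f(2)[symmetric]
    by (subst sum.reindex_bij_betw[OF bij_relabel[of f Q A, OF f(1) Q], symmetric])
      (simp_all add: ncomp_relabel[OF f(1)])
qed

lemma card_rooted_relabel:
  assumes "finite A"
  shows "card (rooted A) = card (rooted {1..card A})"
proof -
  obtain f :: "nat \<Rightarrow> nat" where f: "bij f" "f ` A = {1..card A}"
    using ex_bij_image[OF assms, of "{1..card A}"] by auto
  then show ?thesis
    using bij_betw_same_card[OF bij_relabel[of f rooted A, OF f(1) relabel_rooted]] by simp
qed

section \<open>Members with isotropy G and the splitting of families\<close>

lemma gain_full:
  assumes R: "R \<in> gains A" and iso: "isotropy R = carrier G"
  shows "R = full (supp R)"
proof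
  show "R \<subseteq> full (supp R)" using gain_subset[OF R] by (simp add: full_def)
  show "full (supp R) \<subseteq> R"
  proof safe
    fix i j h assume "(i, j, h) \<in> full (supp R)"
    then have ij: "i \<in> supp R" "j \<in> supp R" "h \<in> carrier G" by (auto simp: full_def)
    obtain g where g: "(i, j, g) \<in> R" using gain_connected[OF R ij(1,2)] by blast
    have "h = g \<otimes> (inv g \<otimes> h)" using gain_carrier[OF R g] ij by (simp add: m_assoc[symmetric])
    moreover have "inv g \<otimes> h \<in> carrier G" using gain_carrier[OF R g] ij by simp
    ultimately have "h \<in> g <# isotropy R" unfolding iso l_coset_def by blast
    then show "(i, j, h) \<in> R" using gain_coset[OF R g] by simp
  qed
qed

lemma supp_full: "supp (full A) = A"
  using one_closed by (force simp: supp_def full_def)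

lemma isotropy_full: "A \<noteq> {} \<Longrightarrow> isotropy (full A) = carrier G"
  by (auto simp: isotropy_def full_def)

lemma full_gains:
  assumes "A \<noteq> {}"
  shows "full A \<in> gains A"
proof -
  have "full A \<noteq> {(i, i, \<one>)}" for i
  proof
    assume *: "full A = {(i, i, \<one>)}"
    have "carrier G = {\<one>}" using isotropy_full[OF assms] by (simp add: * isotropy_def)
    then show False using carrier_nontrivial by simp
  qed
  moreover have "full A \<noteq> {}" using assms one_closed by (auto simp: full_def)
  moreover have "\<exists>g. (i, j, g) \<in> full A" if "i \<in> A" "j \<in> A" for i j
    using that one_closed unfolding full_def by blast
  ultimately show ?thesis
    unfolding gains_def mem_Collect_eq supp_full isotropy_full[OF assms]
    using carrier_closed by (simp add: full_def)
qed

lemma gain_below_full: "R \<in> gains A \<Longrightarrow> R \<subseteq> full A"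
  by (auto simp: gains_def full_def)

lemma families_mono:
  assumes "A \<subseteq> B"
  shows "families A \<subseteq> families B"
  using gains_mono[OF assms] by (auto simp: families_def)

lemma families_supp: "S \<in> families A \<Longrightarrow> R \<in> S \<Longrightarrow> supp R \<subseteq> A \<and> supp R \<noteq> {}"
  using supp_subset supp_nonempty families_sub by blast

lemma rooted_nonempty: "S \<in> rooted B \<Longrightarrow> B \<noteq> {}"
  using families_supp[of S B "full B"] by (auto simp: rooted_def supp_full)

lemma join_families:
  assumes B: "B \<subseteq> A" and S1: "S1 \<in> rooted B" and S2: "S2 \<in> plain (A - B)"
  shows "S1 \<union> S2 \<in> with_carrier A"
proof -
  have F: "S1 \<in> families B" "S2 \<in> families (A - B)" "full B \<in> S1"
    "\<And>R. R \<in> S2 \<Longrightarrow> isotropy R \<noteq> carrier G"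
    using S1 S2 by (auto simp: rooted_def plain_def)
  have "S1 \<union> S2 \<subseteq> gains A"
    using families_mono[OF B] families_mono[of "A - B" A] F(1,2) families_sub by blast
  moreover have "compatible R R'" if "R \<in> S1" "R' \<in> S2" for R R'
    using families_supp[OF F(1) that(1)] families_supp[OF F(2) that(2)] F(4)[OF that(2)]
    unfolding compatible_def by blast
  then have "\<forall>R\<in>S1 \<union> S2. \<forall>R'\<in>S1 \<union> S2. compatible R R'"
    using families_compatible[OF F(1)] families_compatible[OF F(2)] compatible_sym by blast
  ultimately have "S1 \<union> S2 \<in> families A" by (simp add: families_def)
  then show ?thesis
    unfolding with_carrier_def using F(3) isotropy_full[OF rooted_nonempty[OF S1]] by blast
qed

text \<open>A family using the label \<open>G\<close> splits along the support \<open>B\<close> of its largest \<open>G\<close>-labelled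
  member.\<close>

lemma bij_split:
  assumes A: "finite A"
  shows "bij_betw (\<lambda>(B, S1, S2). S1 \<union> S2) (SIGMA B:Pow A. rooted B \<times> plain (A - B)) (with_carrier A)"
  unfolding bij_betw_def
proof
  \<comment> \<open>\<open>full B\<close> is the greatest member with isotropy
    \<open>carrier G\<close>, and the supports tell \<open>S1\<close> from \<open>S2\<close>; so the
    union determines all three components.\<close>
  have recover: "(\<forall>R\<in>S1 \<union> S2. isotropy R = carrier G \<longrightarrow> R \<subseteq> full B) \<and> full B \<in> S1 \<union> S2 \<and>
      isotropy (full B) = carrier G \<and>
      S1 = {R \<in> S1 \<union> S2. supp R \<subseteq> B} \<and> S2 = {R \<in> S1 \<union> S2. supp R \<inter> B = {}}"
    if S: "S1 \<in> rooted B" "S2 \<in> plain (A - B)" for B S1 S2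
  proof -
    have F: "S1 \<in> families B" "S2 \<in> families (A - B)" "full B \<in> S1"
      "\<And>R. R \<in> S2 \<Longrightarrow> isotropy R \<noteq> carrier G"
      using S by (auto simp: rooted_def plain_def)
    have "\<And>R. R \<in> S1 \<Longrightarrow> supp R \<subseteq> B \<and> supp R \<noteq> {}" using families_supp[OF F(1)] .
    moreover have "\<And>R. R \<in> S2 \<Longrightarrow> supp R \<subseteq> A - B \<and> supp R \<noteq> {}" using families_supp[OF F(2)] .
    moreover have "\<And>R. R \<in> S1 \<Longrightarrow> R \<subseteq> full B" using gain_below_full families_sub[OF F(1)] by blast
    ultimately show ?thesis using F(3,4) isotropy_full[OF rooted_nonempty[OF S(1)]] by blast
  qed
  show "inj_on (\<lambda>(B, S1, S2). S1 \<union> S2) (SIGMA B:Pow A. rooted B \<times> plain (A - B))"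
  proof (rule inj_onI)
    fix x y
    assume xy: "x \<in> (SIGMA B:Pow A. rooted B \<times> plain (A - B))"
      "y \<in> (SIGMA B:Pow A. rooted B \<times> plain (A - B))"
      "(case x of (B, S1, S2) \<Rightarrow> S1 \<union> S2) = (case y of (B, S1, S2) \<Rightarrow> S1 \<union> S2)"
    obtain B S1 S2 B' S1' S2' where x: "x = (B, S1, S2)" and y: "y = (B', S1', S2')"
      by (metis prod_cases3)
    have S: "S1 \<in> rooted B" "S2 \<in> plain (A - B)" and S': "S1' \<in> rooted B'" "S2' \<in> plain (A - B')"
      and eq: "S1' \<union> S2' = S1 \<union> S2" using xy x y by auto
    have r: "\<And>R. R \<in> S1 \<union> S2 \<Longrightarrow> isotropy R = carrier G \<Longrightarrow> R \<subseteq> full B"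
      "full B \<in> S1 \<union> S2" "isotropy (full B) = carrier G"
      "S1 = {R \<in> S1 \<union> S2. supp R \<subseteq> B}" "S2 = {R \<in> S1 \<union> S2. supp R \<inter> B = {}}"
      using recover[OF S] by blast+
    have r': "\<And>R. R \<in> S1 \<union> S2 \<Longrightarrow> isotropy R = carrier G \<Longrightarrow> R \<subseteq> full B'"
      "full B' \<in> S1 \<union> S2" "isotropy (full B') = carrier G"
      "S1' = {R \<in> S1 \<union> S2. supp R \<subseteq> B'}" "S2' = {R \<in> S1 \<union> S2. supp R \<inter> B' = {}}"
      using recover[OF S'] unfolding eq by blast+
    have "full B = full B'" using r(1)[OF r'(2,3)] r'(1)[OF r(2,3)] by blast
    then have "supp (full B) = supp (full B')" by (rule arg_cong)
    then have B: "B = B'" unfolding supp_full .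
    have "S1 = S1'" by (rule trans[OF r(4) r'(4)[folded B, symmetric]])
    moreover have "S2 = S2'" by (rule trans[OF r(5) r'(5)[folded B, symmetric]])
    ultimately show "x = y" unfolding x y using B by blast
  qed
  show "(\<lambda>(B, S1, S2). S1 \<union> S2) ` (SIGMA B:Pow A. rooted B \<times> plain (A - B)) = with_carrier A"
  proof (intro equalityI subsetI)
    fix S assume "S \<in> (\<lambda>(B, S1, S2). S1 \<union> S2) ` (SIGMA B:Pow A. rooted B \<times> plain (A - B))"
    then show "S \<in> with_carrier A" using join_families by auto
  next
    fix S assume "S \<in> with_carrier A"
    then have S: "S \<in> families A" and ne: "{R \<in> S. isotropy R = carrier G} \<noteq> {}"
      by (auto simp: with_carrier_def)
    let ?C = "{R \<in> S. isotropy R = carrier G}"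
    have "finite ?C" using families_finite[OF S A] by simp
    from finite_has_maximal[OF this ne] obtain R where R0: "R \<in> ?C" "\<forall>R'\<in>?C. R \<subseteq> R' \<longrightarrow> R = R'" ..
    have R: "R \<in> S" "isotropy R = carrier G" using R0(1) by simp_all
    have R_max: "R = R'" if "R' \<in> S" "isotropy R' = carrier G" "R \<subseteq> R'" for R'
      using R0(2) that by simp
    \<comment> \<open>Members with isotropy \<open>carrier G\<close> are pairwise comparable, so a
      maximal one is the greatest.\<close>
    have top: "R' \<subseteq> R" if "R' \<in> S" "isotropy R' = carrier G" for R'
      using families_compatible[OF S R(1) that(1)] R(2) that(2) R_max[OF that]
      unfolding compatible_def by simp blast
    define B where "B = supp R"
    have RB: "R = full B" using gain_full[OF families_sub[OF S R(1)] R(2)] by (simp add: B_def)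
    let ?S1 = "{X \<in> S. supp X \<subseteq> B}" and ?S2 = "{X \<in> S. supp X \<inter> B = {}}"
    have B: "B \<subseteq> A" "B \<noteq> {}" using families_supp[OF S R(1)] by (auto simp: B_def)
    have "?S1 \<in> rooted B"
      unfolding rooted_def using R(1) RB families_subset[OF S, of ?S1 B] by (auto simp: supp_full)
    moreover have "?S2 \<in> plain (A - B)"
    proof -
      have "?S2 \<in> families (A - B)"
        by (rule families_subset[OF S]) (use families_supp[OF S] in blast)+
      moreover have "isotropy X \<noteq> carrier G" if "X \<in> ?S2" for X
        using top[of X] supp_mono[of X R] families_supp[OF S, of X] that by (auto simp: B_def)
      ultimately show ?thesis by (auto simp: plain_def)
    qed
    moreover have "?S1 \<union> ?S2 = S"
    proof -
      have "supp X \<subseteq> B \<or> supp X \<inter> B = {}" if X: "X \<in> S" for X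
      proof -
        consider "X \<subseteq> R" | "R \<subseteq> X" | "supp X \<inter> supp R = {}"
          using families_compatible[OF S X R(1)] by (auto simp: compatible_def)
        then show ?thesis
        proof cases
          case 1
          then show ?thesis using supp_mono B_def by blast
        next
          case 2
          \<comment> \<open>Isotropy grows with the relation, so a member above \<open>R\<close> has
            isotropy \<open>carrier G\<close> as well and \<open>top\<close> applies to it.\<close>
          then have "carrier G \<subseteq> isotropy X" using isotropy_mono R(2) by blast
          moreover have "isotropy X \<subseteq> carrier G"
            using subgroup.subset[OF isotropy_subgroup[OF families_sub[OF S X]]] .
          ultimately have "X \<subseteq> R" using top X by blast
          then show ?thesis using supp_mono B_def by blast
        qed (simp add: B_def)
      qed
      then show ?thesis by blast
    qed
    ultimately have "(B, ?S1, ?S2) \<in> (SIGMA B:Pow A. rooted B \<times> plain (A - B))" using B by blast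
    then show "S \<in> (\<lambda>(B, S1, S2). S1 \<union> S2) ` (SIGMA B:Pow A. rooted B \<times> plain (A - B))"
      using \<open>?S1 \<union> ?S2 = S\<close> by (intro image_eqI[of _ _ "(B, ?S1, ?S2)"]) simp_all
  qed
qed

text \<open>The part over \<open>B\<close> is a single tree with root \<open>full B\<close>: this
  relation lies above all of \<open>S1\<close> and leaves no index of \<open>B\<close>
  uncovered.\<close>

lemma ncomp_join:
  assumes A: "finite A" and B: "B \<subseteq> A" and S1: "S1 \<in> rooted B" and S2: "S2 \<in> plain (A - B)"
  shows "ncomp A (S1 \<union> S2) = Suc (ncomp (A - B) S2)"
proof -
  have F: "S1 \<in> families B" "S2 \<in> families (A - B)" "full B \<in> S1"
    using S1 S2 by (auto simp: rooted_def plain_def)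
  have s1: "supp R \<subseteq> B \<and> supp R \<noteq> {}" if "R \<in> S1" for R using families_supp[OF F(1) that] .
  have s2: "supp R \<subseteq> A - B \<and> supp R \<noteq> {}" if "R \<in> S2" for R using families_supp[OF F(2) that] .
  have le: "R \<subseteq> full B" if "R \<in> S1" for R using gain_below_full families_sub[OF F(1) that] by blast
  have no12: "\<not> R \<subseteq> R'" if "R \<in> S1" "R' \<in> S2" for R R'
    using supp_mono[of R R'] s1[OF that(1)] s2[OF that(2)] by blast
  have no21: "\<not> R' \<subseteq> R" if "R \<in> S1" "R' \<in> S2" for R R'
    using supp_mono[of R' R] s1[OF that(1)] s2[OF that(2)] by blast
  have max: "maxes (S1 \<union> S2) = insert (full B) (maxes S2)"
  proof (intro equalityI subsetI)
    fix R assume "R \<in> maxes (S1 \<union> S2)"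
    then have R: "R \<in> S1 \<union> S2" "\<And>R'. R' \<in> S1 \<union> S2 \<Longrightarrow> R \<subseteq> R' \<Longrightarrow> R' = R"
      by (auto simp: maxes_def)
    show "R \<in> insert (full B) (maxes S2)"
    proof (cases "R \<in> S1")
      case True
      then show ?thesis using R(2)[of "full B"] F(3) le by auto
    next
      case False
      then show ?thesis using R by (auto simp: maxes_def)
    qed
  next
    fix R assume "R \<in> insert (full B) (maxes S2)"
    then consider "R = full B" | "R \<in> maxes S2" by blast
    then show "R \<in> maxes (S1 \<union> S2)"
    proof cases
      case 1
      then have "R' = R" if "R' \<in> S1 \<union> S2" "R \<subseteq> R'" for R'
        using le[of R'] no12[OF F(3), of R'] that by blast
      then show ?thesis using 1 F(3) by (simp add: maxes_def)
    next
      case 2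
      then have R: "R \<in> S2" "\<And>R'. R' \<in> S2 \<Longrightarrow> R \<subseteq> R' \<Longrightarrow> R' = R" by (auto simp: maxes_def)
      then have "R' = R" if "R' \<in> S1 \<union> S2" "R \<subseteq> R'" for R'
        using no21[of R' R] that by blast
      then show ?thesis using R(1) by (simp add: maxes_def)
    qed
  qed
  have "full B \<notin> maxes S2" using no12[OF F(3), of "full B"] by (auto simp: maxes_def)
  moreover have "finite (maxes S2)"
    using families_finite[OF F(2)] A by (simp add: maxes_def)
  ultimately have "card (maxes (S1 \<union> S2)) = Suc (card (maxes S2))" by (simp add: max)
  moreover have "\<Union> (supp ` S1) = B" using s1 F(3) supp_full by blast
  then have "A - \<Union> (supp ` (S1 \<union> S2)) = (A - B) - \<Union> (supp ` S2)" by auto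
  ultimately show ?thesis by (simp add: ncomp_def)
qed

lemma finite_plain: "finite A \<Longrightarrow> finite (plain A)"
  using finite_families by (simp add: plain_def)

lemma finite_rooted: "finite A \<Longrightarrow> finite (rooted A)"
  using finite_families by (simp add: rooted_def)

text \<open>The part over \<open>B\<close> is always one tree, so it enters through its number and a
  single factor s, and only the plain part records further components. Hence the fraction in the
  final formula is evaluated at s = 1 while \<open>Gamma\<close> next to it keeps both
  variables.\<close>

lemma weight_with_carrier:
  assumes A: "finite A"
  shows "weight A (with_carrier A) =
    (\<Sum>B\<in>Pow A. [:0, 1:] * [:of_nat (card (rooted B)):] * weight (A - B) (plain (A - B)))"
proof -
  have fin: "finite (rooted B)" "finite (plain (A - B))" if "B \<in> Pow A" for B
    using that A finite_rooted[OF finite_subset[of B A]] finite_plain[of "A - B"] by auto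
  have "weight A (with_carrier A) =
      (\<Sum>(B, S1, S2)\<in>(SIGMA B:Pow A. rooted B \<times> plain (A - B)). monom 1 (ncomp A (S1 \<union> S2)))"
    unfolding weight_def
    by (subst sum.reindex_bij_betw[OF bij_split[OF A], symmetric]) (simp add: case_prod_beta)
  also have "\<dots> = (\<Sum>(B, S1, S2)\<in>(SIGMA B:Pow A. rooted B \<times> plain (A - B)).
      [:0, 1:] * monom 1 (ncomp (A - B) S2))"
    by (rule sum.cong) (auto simp: ncomp_join[OF A] monom_Suc)
  also have "\<dots> = (\<Sum>B\<in>Pow A. \<Sum>(S1, S2)\<in>rooted B \<times> plain (A - B).
      [:0, 1:] * monom 1 (ncomp (A - B) S2))"
    by (subst sum.Sigma) (use A fin in \<open>auto simp: case_prod_beta\<close>)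
  also have "\<dots> = (\<Sum>B\<in>Pow A. \<Sum>S1\<in>rooted B. \<Sum>S2\<in>plain (A - B).
      [:0, 1:] * monom 1 (ncomp (A - B) S2))"
    by (subst sum.cartesian_product) (rule refl)
  also have "\<dots> = (\<Sum>B\<in>Pow A. [:0, 1:] * [:of_nat (card (rooted B)):] * weight (A - B) (plain (A - B)))"
  proof (rule sum.cong[OF refl])
    fix B
    have "(\<Sum>S1\<in>rooted B. \<Sum>S2\<in>plain (A - B). [:0, 1:] * monom 1 (ncomp (A - B) S2)) =
        of_nat (card (rooted B)) * ([:0, 1:] * weight (A - B) (plain (A - B)))"
      unfolding weight_def sum_distrib_left[symmetric] sum_constant by (rule mult.left_commute)
    then show "(\<Sum>S1\<in>rooted B. \<Sum>S2\<in>plain (A - B). [:0, 1:] * monom 1 (ncomp (A - B) S2)) =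
        [:0, 1:] * [:of_nat (card (rooted B)):] * weight (A - B) (plain (A - B))"
      unfolding of_nat_poly by (simp only: mult_ac)
  qed
  finally show ?thesis .
qed

lemma card_families_split:
  assumes "finite A"
  shows "card (families A) = card (plain A) + card (with_carrier A)"
proof -
  have "families A = plain A \<union> with_carrier A" by (auto simp: plain_def with_carrier_def)
  moreover have "plain A \<inter> with_carrier A = {}" by (auto simp: plain_def with_carrier_def)
  ultimately show ?thesis
    using finite_families[OF assms] by (metis card_Un_disjoint finite_Un)
qed

lemma weight_families_split:
  assumes "finite A"
  shows "weight A (families A - {{}}) = weight A (plain A - {{}}) + weight A (with_carrier A)"
proof -
  have "families A - {{}} = (plain A - {{}}) \<union> with_carrier A"
    by (auto simp: plain_def with_carrier_def)
  moreover have "(plain A - {{}}) \<inter> with_carrier A = {}" by (auto simp: plain_def with_carrier_def)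
  moreover have "finite (plain A - {{}})" "finite (with_carrier A)"
    using finite_families[OF assms] by (auto simp: plain_def with_carrier_def)
  ultimately show ?thesis by (simp add: weight_def sum.union_disjoint)
qed

text \<open>Adding \<open>full A\<close> matches the families without it to those with it.\<close>

lemma twice_card_rooted:
  assumes A: "finite A" "A \<noteq> {}"
  shows "2 * card (rooted A) = card (families A)"
proof -
  let ?N = "{S \<in> families A. full A \<notin> S}"
  have ins: "insert (full A) S \<in> families A" if S: "S \<in> families A" for S
    using full_gains[OF A(2)] S gain_below_full families_sub[OF S]
    unfolding families_def by (auto simp: compatible_def)
  have del: "S - {full A} \<in> families A" if "S \<in> families A" for S
    using that by (auto simp: families_def)
  have "bij_betw (insert (full A)) ?N (rooted A)"
    by (rule bij_betw_byWitness[where f' = "\<lambda>S. S - {full A}"])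
      (use ins del in \<open>auto simp: rooted_def\<close>)
  then have "card ?N = card (rooted A)" by (rule bij_betw_same_card)
  moreover have "families A = rooted A \<union> ?N" by (auto simp: rooted_def)
  moreover have "rooted A \<inter> ?N = {}" by (auto simp: rooted_def)
  moreover have "finite (rooted A)" "finite ?N" using finite_families[OF A(1)] by (auto simp: rooted_def)
  ultimately show ?thesis using card_Un_disjoint[of "rooted A" ?N] by simp
qed

text \<open>Plain families are grouped by the set \<open>B\<close> that their supports cover. Each
  remaining index is a fallen leaf and contributes a factor s, which amounts to multiplication by
  \<open>exp_st\<close>.\<close>

lemma weight_plain:
  assumes A: "finite A"
  shows "weight A (plain A) = (\<Sum>B\<in>Pow A. weight B (plain_cover B) * monom 1 (card (A - B)))"
proof -
  have eq: "{S \<in> plain A. \<Union> (supp ` S) = B} = plain_cover B" if B: "B \<in> Pow A" for B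
  proof (intro equalityI subsetI)
    fix S assume S: "S \<in> {S \<in> plain A. \<Union> (supp ` S) = B}"
    then have "S \<in> families B" using families_subset[of S A S B] by (auto simp: plain_def)
    then show "S \<in> plain_cover B" using S by (auto simp: plain_cover_def plain_def)
  next
    fix S assume "S \<in> plain_cover B"
    then show "S \<in> {S \<in> plain A. \<Union> (supp ` S) = B}"
      using families_mono[of B A] B by (auto simp: plain_cover_def plain_def)
  qed
  have "(\<lambda>S. \<Union> (supp ` S)) ` plain A \<subseteq> Pow A" using families_supp by (auto simp: plain_def)
  from sum.group[OF finite_plain[OF A] _ this, of "\<lambda>S. monom 1 (ncomp A S) :: rat poly"]
  have "weight A (plain A) = (\<Sum>B\<in>Pow A. \<Sum>S\<in>plain_cover B. monom 1 (ncomp A S))"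
    using A eq by (simp add: weight_def)
  also have "\<dots> = (\<Sum>B\<in>Pow A. \<Sum>S\<in>plain_cover B. monom 1 (ncomp B S) * monom 1 (card (A - B)))"
  proof (intro sum.cong refl)
    fix B S assume "B \<in> Pow A" "S \<in> plain_cover B"
    then have "ncomp A S = ncomp B S + card (A - B)" by (simp add: ncomp_def plain_cover_def)
    then show "(monom 1 (ncomp A S) :: rat poly) = monom 1 (ncomp B S) * monom 1 (card (A - B))"
      by (simp add: mult_monom)
  qed
  finally show ?thesis by (simp add: weight_def sum_distrib_right)
qed

end

section \<open>Exponential generating series\<close>

definition egf :: "(nat \<Rightarrow> rat) \<Rightarrow> rat fps" where
  "egf a = Abs_fps (\<lambda>n. a n / fact n)"

definition pegf :: "(nat \<Rightarrow> rat poly) \<Rightarrow> rat poly fps" where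
  "pegf a = Abs_fps (\<lambda>n. smult (1 / fact n) (a n))"

text \<open>Covers \<open>egf\<close> and \<open>pegf\<close> at once: \<open>c n\<close> is 1/n!,
  either as a rational number or as a constant polynomial.\<close>

lemma fps_mult_weighted:
  fixes c :: "nat \<Rightarrow> 'a::comm_semiring_1"
  assumes c: "\<And>n k. k \<le> n \<Longrightarrow> c k * c (n - k) = of_nat (n choose k) * c n"
  shows "Abs_fps (\<lambda>n. c n * a n) * Abs_fps (\<lambda>n. c n * b n) =
    Abs_fps (\<lambda>n. c n * (\<Sum>k\<le>n. of_nat (n choose k) * (a k * b (n - k))))"
proof (rule fps_ext)
  fix n
  have "fps_nth (Abs_fps (\<lambda>n. c n * a n) * Abs_fps (\<lambda>n. c n * b n)) n =
      (\<Sum>k\<le>n. (c k * c (n - k)) * (a k * b (n - k)))"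
    by (simp add: fps_mult_nth atMost_atLeast0 mult_ac)
  also have "\<dots> = (\<Sum>k\<le>n. c n * (of_nat (n choose k) * (a k * b (n - k))))"
    by (rule sum.cong) (simp_all add: c mult_ac)
  finally show "fps_nth (Abs_fps (\<lambda>n. c n * a n) * Abs_fps (\<lambda>n. c n * b n)) n =
      fps_nth (Abs_fps (\<lambda>n. c n * (\<Sum>k\<le>n. of_nat (n choose k) * (a k * b (n - k))))) n"
    by (simp add: sum_distrib_left)
qed

lemma inverse_fact_mult:
  "k \<le> n \<Longrightarrow> (1 / fact k) * (1 / fact (n - k)) = of_nat (n choose k) * (1 / fact n :: rat)"
  by (simp add: binomial_fact field_simps)

lemma egf_mult: "egf a * egf b = egf (\<lambda>n. \<Sum>k\<le>n. of_nat (n choose k) * (a k * b (n - k)))"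
  using fps_mult_weighted[of "\<lambda>n. 1 / fact n :: rat" a b, OF inverse_fact_mult]
  by (simp add: egf_def)

lemma pegf_mult: "pegf a * pegf b = pegf (\<lambda>n. \<Sum>k\<le>n. of_nat (n choose k) * (a k * b (n - k)))"
proof -
  have "[:1 / fact k:] * [:1 / fact (n - k):] = of_nat (n choose k) * [:1 / fact n :: rat:]"
    if "k \<le> n" for n k
    using inverse_fact_mult[OF that] by (simp add: of_nat_poly mult.commute)
  from fps_mult_weighted[of "\<lambda>n. [:1 / fact n :: rat:]" a b, OF this]
  show ?thesis by (simp add: pegf_def)
qed

lemma pegf_add: "pegf a + pegf b = pegf (\<lambda>n. a n + b n)"
  by (simp add: pegf_def fps_eq_iff smult_add_right)

lemma at_s_1_pegf: "at_s_1 (pegf a) = egf (\<lambda>n. poly (a n) 1)"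
  by (simp add: at_s_1_def pegf_def egf_def)

lemma var_s_fps_in_t_egf: "var_s * fps_in_t (egf a) = pegf (\<lambda>n. [:0, 1:] * [:a n:])"
  by (simp add: var_s_def fps_in_t_def egf_def pegf_def fps_eq_iff)

text \<open>The sum in \<open>series\<close> would be 0 by convention over an infinite index set;
  the degree of \<open>p n\<close> bounds that set.\<close>

lemma series_eq_pegf:
  assumes "\<And>j n. c j n = coeff (p n) j / fact n"
  shows "series c = pegf p"
proof -
  have "(\<Sum>j | c j n \<noteq> 0. monom (c j n) j) = smult (1 / fact n) (p n)" for n
  proof (rule poly_eqI)
    fix i
    have "{j. c j n \<noteq> 0} \<subseteq> {..degree (p n)}" using le_degree by (auto simp: assms)
    then have "finite {j. c j n \<noteq> 0}" by (rule finite_subset) simp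
    then show "coeff (\<Sum>j | c j n \<noteq> 0. monom (c j n) j) i = coeff (smult (1 / fact n) (p n)) i"
      by (simp add: coeff_sum assms[of i n, symmetric] sum.delta if_distrib cong: if_cong)
  qed
  then show ?thesis by (simp add: series_def pegf_def)
qed

text \<open>Subsets of equal size contribute equally. This turns a sum over splittings of the index
  set into the binomial convolution of a product of exponential series.\<close>

lemma sum_Pow_card:
  fixes f :: "nat \<Rightarrow> nat \<Rightarrow> 'a::comm_semiring_1"
  assumes A: "finite A"
  shows "(\<Sum>B\<in>Pow A. f (card B) (card (A - B))) =
    (\<Sum>k\<le>card A. of_nat (card A choose k) * f k (card A - k))"
proof -
  have "card ` Pow A \<subseteq> {..card A}" using card_mono[OF A] by auto
  from sum.group[OF _ _ this, of "\<lambda>B. f (card B) (card (A - B))"]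
  have "(\<Sum>B\<in>Pow A. f (card B) (card (A - B))) =
      (\<Sum>k\<le>card A. \<Sum>B\<in>{B \<in> Pow A. card B = k}. f (card B) (card (A - B)))"
    using A by simp
  also have "\<dots> = (\<Sum>k\<le>card A. \<Sum>B\<in>{B \<in> Pow A. card B = k}. f k (card A - k))"
    using A finite_subset[OF _ A] by (intro sum.cong refl) (auto simp: card_Diff_subset)
  also have "\<dots> = (\<Sum>k\<le>card A. of_nat (card A choose k) * f k (card A - k))"
    using n_subsets[OF A] by (simp add: Pow_def)
  finally show ?thesis .
qed

lemma card_fibers:
  assumes "finite X" "finite T" "f ` X \<subseteq> T"
  shows "(\<Sum>a\<in>T. card {x \<in> X. f x = a}) = card X"
  using sum.group[OF assms, of "\<lambda>_. 1 :: nat"] by simp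

section \<open>Product formulas for the weight series\<close>

context gain_setup
begin

lemma coeff_weight:
  assumes "finite X"
  shows "coeff (weight A X) j = of_nat (card {S \<in> X. ncomp A S = j})"
proof -
  have "coeff (weight A X) j = (\<Sum>S\<in>X. if ncomp A S = j then 1 else 0)"
    by (simp add: weight_def coeff_sum)
  also have "\<dots> = of_nat (card {S \<in> X. ncomp A S = j})"
    using assms by (simp add: sum.If_cases Int_def)
  finally show ?thesis .
qed

lemma poly_weight: "poly (weight A X) 1 = of_nat (card X)"
  by (simp add: weight_def poly_sum poly_monom)

lemma families_empty: "families {} = {{}}"
  by (auto simp: families_def gains_def)

lemma plain_empty: "plain {} = {{}}"
  by (auto simp: plain_def families_empty)

lemma plain_cover_empty: "plain_cover {} = {{}}"
  by (auto simp: plain_cover_def plain_empty)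

lemma rooted_empty: "rooted {} = {}"
  using rooted_nonempty by blast

lemma weight_empty: "weight {} {{}} = 1"
  by (simp add: weight_def ncomp_def maxes_def)

lemma pegf_weight_plain:
  "pegf (\<lambda>n. weight {1..n} (plain {1..n})) =
    pegf (\<lambda>n. weight {1..n} (plain_cover {1..n})) * pegf (\<lambda>n. monom 1 n)"
proof -
  have "weight {1..n} (plain {1..n}) = (\<Sum>k\<le>n. of_nat (n choose k) *
      (weight {1..k} (plain_cover {1..k}) * monom 1 (n - k)))" for n :: nat
  proof -
    have "weight {1..n} (plain {1..n}) =
        (\<Sum>B\<in>Pow {1..n}. weight {1..card B} (plain_cover {1..card B}) * monom 1 (card ({1..n} - B)))"
      unfolding weight_plain[OF finite_atLeastAtMost]
      by (intro sum.cong refl arg_cong2[where f = "(*)"] weight_relabel relabel_plain_cover)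
        (auto intro: finite_subset)
    also have "\<dots> = (\<Sum>k\<le>n. of_nat (n choose k) *
        (weight {1..k} (plain_cover {1..k}) * monom 1 (n - k)))"
      using sum_Pow_card[of "{1..n}" "\<lambda>k l. weight {1..k} (plain_cover {1..k}) * monom 1 l"] by simp
    finally show ?thesis .
  qed
  then show ?thesis unfolding pegf_mult by simp
qed

lemma weight_with_carrier_upto:
  fixes n :: nat
  shows "weight {1..n} (with_carrier {1..n}) = (\<Sum>k\<le>n. of_nat (n choose k) *
      ([:0, 1:] * [:of_nat (card (rooted {1..k})):] * weight {1..n - k} (plain {1..n - k})))"
proof -
  have "weight {1..n} (with_carrier {1..n}) =
      (\<Sum>B\<in>Pow {1..n}. [:0, 1:] * [:of_nat (card (rooted {1..card B})):] *
        weight {1..card ({1..n} - B)} (plain {1..card ({1..n} - B)}))"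
    unfolding weight_with_carrier[OF finite_atLeastAtMost]
  proof (rule sum.cong[OF refl])
    fix B assume "B \<in> Pow {1..n}"
    then have fin: "finite B" "finite ({1..n} - B)" by (auto intro: finite_subset)
    show "[:0, 1:] * [:of_nat (card (rooted B)):] * weight ({1..n} - B) (plain ({1..n} - B)) =
      [:0, 1:] * [:of_nat (card (rooted {1..card B})):] *
        weight {1..card ({1..n} - B)} (plain {1..card ({1..n} - B)})"
      by (simp only: card_rooted_relabel[OF fin(1)] weight_relabel[of plain, OF relabel_plain fin(2)])
  qed
  also have "\<dots> = (\<Sum>k\<le>n. of_nat (n choose k) *
      ([:0, 1:] * [:of_nat (card (rooted {1..k})):] * weight {1..n - k} (plain {1..n - k})))"
    using sum_Pow_card[of "{1..n}" "\<lambda>k l. [:0, 1:] * [:of_nat (card (rooted {1..k})):] *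
      weight {1..l} (plain {1..l})"] by simp
  finally show ?thesis .
qed

lemma pegf_weight_with_carrier:
  "pegf (\<lambda>n. weight {1..n} (with_carrier {1..n})) =
    var_s * fps_in_t (egf (\<lambda>n. of_nat (card (rooted {1..n})))) *
    pegf (\<lambda>n. weight {1..n} (plain {1..n}))"
  unfolding var_s_fps_in_t_egf pegf_mult weight_with_carrier_upto ..

text \<open>Families on a nonempty index set are counted in two ways: as twice the rooted ones, and
  as the plain ones plus those using the label G. The last number is a convolution of rooted and
  plain counts, whence a linear equation for \<open>M\<close>.\<close>

lemma egf_rooted:
  defines "M \<equiv> egf (\<lambda>n. of_nat (card (rooted {1..n})))"
    and "P \<equiv> egf (\<lambda>n. of_nat (card (plain {1..n})))"
  shows "M = 1 / (2 - P) - 1"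
proof -
  let ?r = "\<lambda>n. of_nat (card (rooted {1..n})) :: rat" and ?p = "\<lambda>n. of_nat (card (plain {1..n})) :: rat"
  have rec: "2 * ?r n = ?p n + (\<Sum>k\<le>n. of_nat (n choose k) * (?r k * ?p (n - k)))" if "n > 0" for n
  proof -
    have "of_nat (card (with_carrier {1..n})) =
        (\<Sum>k\<le>n. of_nat (n choose k) * (?r k * ?p (n - k)))"
      using arg_cong[OF weight_with_carrier_upto[of n], of "\<lambda>p. poly p 1"]
      by (simp add: poly_weight poly_sum mult.left_commute)
    moreover have "2 * card (rooted {1..n}) = card (plain {1..n}) + card (with_carrier {1..n})"
      using twice_card_rooted[of "{1..n}"] card_families_split[of "{1..n}"] that by simp
    then have "2 * ?r n = ?p n + of_nat (card (with_carrier {1..n}))"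
      by (metis of_nat_add of_nat_mult of_nat_numeral)
    ultimately show ?thesis by simp
  qed
  have "2 * M = P - 1 + M * P"
  proof (rule fps_ext)
    fix n
    show "fps_nth (2 * M) n = fps_nth (P - 1 + M * P) n"
    proof (cases "n = 0")
      \<comment> \<open>On the empty index set there is no rooted family but one plain family, the
        empty one; this is why \<open>P - 1\<close> appears in the equation.\<close>
      case True
      then show ?thesis
        by (simp add: M_def P_def egf_def rooted_empty plain_empty numeral_fps_const)
    next
      case False
      have "fps_nth (P - 1 + M * P) n = 2 * ?r n / fact n"
        unfolding M_def P_def egf_mult using rec[of n] False
        by (simp add: egf_def add_divide_distrib)
      then show ?thesis by (simp add: M_def egf_def numeral_fps_const)
    qed
  qed
  then have "(M + 1) * (2 - P) = 1" by (simp add: algebra_simps)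
  \<comment> \<open>The quotient is obtained by cancelling a nonzero factor; \<open>2 - P\<close> is
    nonzero because its product with \<open>M + 1\<close> is 1.\<close>
  moreover have "2 - P \<noteq> 0"
  proof
    assume "2 - P = 0"
    then show False using calculation by simp
  qed
  ultimately have "M + 1 = 1 / (2 - P)" by (metis nonzero_mult_div_cancel_right)
  then show ?thesis by (simp add: algebra_simps)
qed

section \<open>Counting forests\<close>

lemma forest_family_empty_iff:
  assumes "forest_on A F"
  shows "forest_family F \<noteq> {} \<longleftrightarrow> (\<exists>t\<in>F. \<exists>K. has_vertex_labelled K t)"
proof -
  have "(\<exists>K. has_vertex_labelled K t) \<longleftrightarrow> fam t \<noteq> {}" if "t \<in> F" for t
    using labelled_iff_fam[OF forest_onD(1)[OF assms that]] by auto
  then show ?thesis by (auto simp: forest_family_def)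
qed

lemma forests_eq: "forests n G \<rho> = {F. forest_on {1..n} F \<and> forest_family F \<noteq> {}}"
proof -
  have "forests n G \<rho> = {F. forest_on {1..n} F \<and> (\<exists>t\<in>F. \<exists>K. has_vertex_labelled K t)}"
    by (auto simp: forests_def forest_on_def)
  also have "\<dots> = {F. forest_on {1..n} F \<and> forest_family F \<noteq> {}}"
    by (intro Collect_cong conj_cong refl forest_family_empty_iff[symmetric])
  finally show ?thesis .
qed

lemma forests'_eq: "forests' n G \<rho> =
  {F. forest_on {1..n} F \<and> forest_family F \<noteq> {} \<and>
    (\<forall>R\<in>forest_family F. isotropy R \<noteq> carrier G)}"
proof -
  have "(\<forall>t\<in>F. \<not> has_vertex_labelled (carrier G) t) \<longleftrightarrow>
      (\<forall>R\<in>forest_family F. isotropy R \<noteq> carrier G)" if "forest_on {1..n} F" for F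
    using labelled_iff_fam[OF forest_onD(1)[OF that]] by (auto simp: forest_family_def)
  then have "forest_on {1..n} F \<and> (\<forall>t\<in>F. \<not> has_vertex_labelled (carrier G) t) \<longleftrightarrow>
      forest_on {1..n} F \<and> (\<forall>R\<in>forest_family F. isotropy R \<noteq> carrier G)" for F by meson
  then show ?thesis unfolding forests'_def forests_eq by auto
qed

lemma forests''_eq: "forests'' n G \<rho> =
  {F. forest_on {1..n} F \<and> forest_family F \<noteq> {} \<and>
    (\<forall>R\<in>forest_family F. isotropy R \<noteq> carrier G) \<and> \<Union> (supp ` forest_family F) = {1..n}}"
proof -
  have "fallen_leaves F = {} \<longleftrightarrow> \<Union> (supp ` forest_family F) = {1..n}" if "forest_on {1..n} F" for F
    using fallen_leaves_family[OF that] families_supp[OF forest_family_in_families[OF that]] by blast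
  then show ?thesis unfolding forests''_def forests'_eq by auto
qed

lemma finite_forests_on: "finite A \<Longrightarrow> finite {F. forest_on A F}"
  using bij_betw_finite[OF bij_forest_family] finite_families by blast

text \<open>Each count of forests by their number of components is reduced to a count of families
  here, with \<open>Q\<close> for the extra conditions.\<close>

lemma card_forests_where:
  assumes A: "finite A"
  shows "card {F. forest_on A F \<and> Q (forest_family F) \<and> card F = j} =
    card {S \<in> families A. Q S \<and> ncomp A S = j}"
proof -
  have "card F = ncomp A (forest_family F)" if "forest_on A F" for F
    using card_forest[OF that A] by (simp add: ncomp_def)
  then have "{F. forest_on A F \<and> Q (forest_family F) \<and> card F = j} =
      {F \<in> {F. forest_on A F}. Q (forest_family F) \<and> ncomp A (forest_family F) = j}" by auto
  moreover have "bij_betw forest_family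
      {F \<in> {F. forest_on A F}. Q (forest_family F) \<and> ncomp A (forest_family F) = j}
      {S \<in> families A. Q S \<and> ncomp A S = j}"
  proof (rule bij_betw_subset[OF bij_forest_family[OF A]])
    show "forest_family ` {F \<in> {F. forest_on A F}. Q (forest_family F) \<and>
        ncomp A (forest_family F) = j} = {S \<in> families A. Q S \<and> ncomp A S = j}"
    proof (intro equalityI subsetI)
      fix S assume S: "S \<in> {S \<in> families A. Q S \<and> ncomp A S = j}"
      then obtain F where "forest_on A F" "forest_family F = S" using forest_family_surj[OF A] by blast
      then show "S \<in> forest_family ` {F \<in> {F. forest_on A F}. Q (forest_family F) \<and>
          ncomp A (forest_family F) = j}" using S by blast
    qed (use forest_family_in_families in auto)
  qed blast
  ultimately show ?thesis by (simp add: bij_betw_same_card)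
qed

lemma ncomp_pos:
  assumes "finite A" "S \<in> families A" "S \<noteq> {}"
  shows "ncomp A S > 0"
proof -
  have fin: "finite S" using families_finite assms by blast
  then have "maxes S \<noteq> {}" using below_maxes[OF fin] assms(3) by blast
  moreover have "finite (maxes S)" using fin by (simp add: maxes_def)
  ultimately show ?thesis by (simp add: ncomp_def card_gt_0_iff)
qed

lemma gamma_eq: "gamma G \<rho> j n = card {S \<in> families {1..n} - {{}}. ncomp {1..n} S = j}"
  using card_forests_where[of "{1..n}" "\<lambda>S. S \<noteq> {}" j]
  by (simp add: gamma_def forests_eq conj_ac)

lemma card_forests': "card {F \<in> forests' n G \<rho>. card F = j} =
  card {S \<in> plain {1..n} - {{}}. ncomp {1..n} S = j}"
  using card_forests_where[of "{1..n}" "\<lambda>S. S \<noteq> {} \<and> (\<forall>R\<in>S. isotropy R \<noteq> carrier G)" j]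
  by (simp add: forests'_eq plain_def conj_ac)

text \<open>For \<open>n = 0\<close> and \<open>j = 0\<close> the two sides differ: the empty family
  covers the empty index set, but \<open>forests''\<close> requires an internal vertex. The constant
  term 1 of \<open>Gamma_tilde\<close> makes up for this.\<close>

lemma card_forests'':
  assumes "n > 0"
  shows "card {F \<in> forests'' n G \<rho>. card F = j} =
    card {S \<in> plain_cover {1..n}. ncomp {1..n} S = j}"
proof -
  have "card {F \<in> forests'' n G \<rho>. card F = j} =
      card {F. forest_on {1..n} F \<and> (forest_family F \<noteq> {} \<and>
        (\<forall>R\<in>forest_family F. isotropy R \<noteq> carrier G) \<and>
        \<Union> (supp ` forest_family F) = {1..n}) \<and> card F = j}"
    by (simp add: forests''_eq conj_assoc)
  also have "\<dots> = card {S \<in> families {1..n}. (S \<noteq> {} \<and> (\<forall>R\<in>S. isotropy R \<noteq> carrier G) \<and>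
      \<Union> (supp ` S) = {1..n}) \<and> ncomp {1..n} S = j}"
    by (rule card_forests_where) simp
  also have "{S \<in> families {1..n}. (S \<noteq> {} \<and> (\<forall>R\<in>S. isotropy R \<noteq> carrier G) \<and>
      \<Union> (supp ` S) = {1..n}) \<and> ncomp {1..n} S = j} =
      {S \<in> plain_cover {1..n}. ncomp {1..n} S = j}"
    using assms by (auto simp: plain_def plain_cover_def)
  finally show ?thesis .
qed

text \<open>Parents of the leaf \<open>i\<close> in different child subtrees would put
  \<open>i\<close> into two disjoint leaf sets; inside a common child the induction hypothesis
  applies.\<close>

lemma parent_unique:
  "admissible_tree G \<rho> t \<Longrightarrow> Node H C \<in> subtrees t \<Longrightarrow> (c, Leaf i) \<in> fset C \<Longrightarrow>
    Node H' C' \<in> subtrees t \<Longrightarrow> (c', Leaf i) \<in> fset C' \<Longrightarrow> H' = H"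
proof (induction t rule: ltree_induct)
  case (Node K D)
  note t = Node.prems(1)
  have leaf: "i \<in> leaves u" if "Node P E \<in> subtrees u" "(e, Leaf i) \<in> fset E" for P E e u
    using subtrees.child[OF that] by (simp add: leaves_def)
  \<comment> \<open>A leaf directly below the root lies in no other child subtree, and the child
    \<open>Leaf i\<close> itself has no internal vertex.\<close>
  have clash: False
    if D: "(d, Leaf i) \<in> fset D" and u: "(e, u) \<in> fset D" "Node P E \<in> subtrees u"
      "(f, Leaf i) \<in> fset E" for d e f u P E
    using children_disjoint(2)[OF t D u(1), of i] leaf[OF u(2,3)] u(2) by simp
  consider "Node H C = Node K D" | d u where "(d, u) \<in> fset D" "Node H C \<in> subtrees u"
    using Node.prems(2) unfolding subtrees_Node by blast
  then show ?case
  proof cases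
    case 1
    consider "Node H' C' = Node K D" | e v where "(e, v) \<in> fset D" "Node H' C' \<in> subtrees v"
      using Node.prems(4) unfolding subtrees_Node by blast
    then show ?thesis
    proof cases
      case (2 e v)
      have "(c, Leaf i) \<in> fset D" using Node.prems(3) 1 by simp
      from clash[OF this 2 Node.prems(5)] show ?thesis ..
    qed (use 1 in simp)
  next
    case (2 d u)
    consider "Node H' C' = Node K D" | e v where "(e, v) \<in> fset D" "Node H' C' \<in> subtrees v"
      using Node.prems(4) unfolding subtrees_Node by blast
    then show ?thesis
    proof cases
      case 1
      then have "(c', Leaf i) \<in> fset D" using Node.prems(5) by simp
      from clash[OF this \<open>(d, u) \<in> fset D\<close> \<open>Node H C \<in> subtrees u\<close> Node.prems(3)]
      show ?thesis ..
    next
      case (2 e v)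
      have "v = u"
        using children_disjoint(2)[OF t \<open>(d, u) \<in> fset D\<close> 2(1)]
          leaf[OF \<open>Node H C \<in> subtrees u\<close> Node.prems(3)] leaf[OF 2(2) Node.prems(5)] by blast
      then show ?thesis
        using Node.IH[OF \<open>(d, u) \<in> fset D\<close> admissible_child[OF t \<open>(d, u) \<in> fset D\<close>]
            \<open>Node H C \<in> subtrees u\<close> Node.prems(3) _ Node.prems(5)] 2(2) by simp
    qed
  qed
qed simp

section \<open>Leaf counts, exponent vectors and the three series\<close>

lemma finite_proper: "finite (proper_closed_subgroups G \<rho>)"
proof (rule finite_subset)
  show "proper_closed_subgroups G \<rho> \<subseteq> Pow (carrier G)"
    using subgroup.subset by (auto simp: proper_closed_subgroups_def closed_subgroups_def)
qed (use finite_carrier in simp)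

text \<open>A leaf that is not fallen has exactly one parent, and without the label G this parent
  has a proper closed label. So the monomial of a forest has total degree \<open>n\<close> in the
  variables other than s.\<close>

lemma sum_leaves_under:
  assumes "F \<in> forests' n G \<rho>"
  shows "card (fallen_leaves F) + (\<Sum>H\<in>proper_closed_subgroups G \<rho>. card (leaves_under F H)) = n"
proof -
  let ?P = "proper_closed_subgroups G \<rho>"
  have F: "forest_on {1..n} F" using assms by (simp add: forests'_eq)
  have noG: "\<And>t. t \<in> F \<Longrightarrow> \<not> has_vertex_labelled (carrier G) t"
    using assms by (simp add: forests'_def)
  have leaf: "i \<in> leaves t" if "Node H C \<in> subtrees t" "(c, Leaf i) \<in> fset C" for H C c i t
    using subtrees.child[OF that] by (simp add: leaves_def)

  have U: "(\<Union>H\<in>?P. leaves_under F H) = {1..n} - fallen_leaves F"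
  proof (intro equalityI subsetI)
    fix i assume "i \<in> (\<Union>H\<in>?P. leaves_under F H)"
    then obtain t H C c where t: "t \<in> F" "Node H C \<in> subtrees t" "(c, Leaf i) \<in> fset C"
      unfolding leaves_under_def by blast
    have i: "i \<in> leaves t" using leaf[OF t(2,3)] .
    have "Leaf i \<notin> F"
    proof
      assume "Leaf i \<in> F"
      then have "t = Leaf i" using forest_unique[OF F _ t(1), of "Leaf i" i] i by simp
      then show False using t(2) by simp
    qed
    then show "i \<in> {1..n} - fallen_leaves F"
      using i forest_onD(2)[OF F t(1)] by (auto simp: fallen_leaves_def)
  next
    fix i assume i: "i \<in> {1..n} - fallen_leaves F"
    then obtain t where t: "t \<in> F" "i \<in> leaves t" using forest_obtain[OF F] by blast
    have "Leaf i \<in> subtrees t" using t(2) by (simp add: leaves_def)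
    then show "i \<in> (\<Union>H\<in>?P. leaves_under F H)"
    proof cases
      case self
      then show ?thesis using i t(1) by (simp add: fallen_leaves_def)
    next
      case (child H C c)
      have a: "admissible_tree G \<rho> (Node H C)"
        using admissible_subtree[OF forest_onD(1)[OF F t(1)] child(1)] .
      have "H \<noteq> carrier G" using noG[OF t(1)] child(1) by (auto simp: has_vertex_labelled_def)
      then have "H \<in> ?P" using admissible_NodeD(2)[OF a] by (simp add: proper_closed_subgroups_def)
      then show ?thesis using t(1) child unfolding leaves_under_def by blast
    qed
  qed
  have fin: "finite (leaves_under F H)" if "H \<in> ?P" for H
    by (rule finite_subset[of _ "{1..n}"]) (use U that in auto)
  have disj: "leaves_under F H \<inter> leaves_under F H' = {}" if "H \<noteq> H'" for H H'
  proof (rule ccontr)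
    assume "leaves_under F H \<inter> leaves_under F H' \<noteq> {}"
    then obtain i t C c t' C' c' where t: "t \<in> F" "Node H C \<in> subtrees t" "(c, Leaf i) \<in> fset C"
      and t': "t' \<in> F" "Node H' C' \<in> subtrees t'" "(c', Leaf i) \<in> fset C'"
      unfolding leaves_under_def by blast
    have "t' = t" using forest_unique[OF F t(1) t'(1) leaf[OF t(2,3)] leaf[OF t'(2,3)]] .
    then have "H' = H"
      using parent_unique[OF forest_onD(1)[OF F t(1)] t(2,3) _ t'(3)] t'(2) by simp
    then show False using that by simp
  qed
  have "(\<Sum>H\<in>?P. card (leaves_under F H)) = card (\<Union>H\<in>?P. leaves_under F H)"
    using card_UN_disjoint[of ?P "leaves_under F"] finite_proper fin disj by simp
  also have "\<dots> = n - card (fallen_leaves F)"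
    unfolding U using fallen_leaves_family[OF F]
    by (subst card_Diff_subset) (auto intro: finite_subset)
  finally show ?thesis
    using fallen_leaves_family[OF F] card_mono[of "{1..n}" "fallen_leaves F"] by simp
qed

text \<open>Restriction makes the vector a member of the extensional function space
  \<open>exponents\<close>, so that a sum over exponent vectors is a sum over the fibres of this
  map.\<close>

definition leaf_vector :: "'g ltree set \<Rightarrow> 'g set \<Rightarrow> nat" where
  "leaf_vector F = restrict (\<lambda>H. card (leaves_under F H)) (proper_closed_subgroups G \<rho>)"

lemma leaf_vector_exponents: "leaf_vector F \<in> exponents G \<rho>"
  by (simp add: leaf_vector_def exponents_def)

lemma leaf_vector_eq_iff:
  assumes "a \<in> exponents G \<rho>"
  shows "(\<forall>H\<in>proper_closed_subgroups G \<rho>. card (leaves_under F H) = a H) \<longleftrightarrow> leaf_vector F = a"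
proof
  assume "\<forall>H\<in>proper_closed_subgroups G \<rho>. card (leaves_under F H) = a H"
  then show "leaf_vector F = a"
    using assms unfolding leaf_vector_def exponents_def
    by (intro extensionalityI[of _ "proper_closed_subgroups G \<rho>"]) (auto simp: PiE_def)
qed (auto simp: leaf_vector_def)

lemma sum_leaf_vector:
  "(\<Sum>H\<in>proper_closed_subgroups G \<rho>. leaf_vector F H) =
    (\<Sum>H\<in>proper_closed_subgroups G \<rho>. card (leaves_under F H))"
  by (simp add: leaf_vector_def)

lemma finite_exponents:
  "finite {a \<in> exponents G \<rho>. (\<Sum>H\<in>proper_closed_subgroups G \<rho>. a H) \<le> n}"
proof (rule finite_subset)
  show "{a \<in> exponents G \<rho>. (\<Sum>H\<in>proper_closed_subgroups G \<rho>. a H) \<le> n} \<subseteq>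
      (proper_closed_subgroups G \<rho> \<rightarrow>\<^sub>E {..n})"
  proof
    fix a assume a: "a \<in> {a \<in> exponents G \<rho>. (\<Sum>H\<in>proper_closed_subgroups G \<rho>. a H) \<le> n}"
    have "a H \<le> n" if "H \<in> proper_closed_subgroups G \<rho>" for H
      using member_le_sum[of H _ a, OF that _ finite_proper] a by simp
    then show "a \<in> proper_closed_subgroups G \<rho> \<rightarrow>\<^sub>E {..n}"
      using a by (auto simp: exponents_def PiE_def)
  qed
  show "finite (proper_closed_subgroups G \<rho> \<rightarrow>\<^sub>E {..n})"
    using finite_proper by (simp add: finite_PiE)
qed

lemma finite_forests': "finite (forests' n G \<rho>)"
  by (rule finite_subset[OF _ finite_forests_on[of "{1..n}"]]) (auto simp: forests'_eq)

lemma Gamma_tilde_eq: "Gamma_tilde G \<rho> = pegf (\<lambda>n. weight {1..n} (plain_cover {1..n}))"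
  unfolding Gamma_tilde_def
proof (rule series_eq_pegf)
  fix j n
  let ?P = "proper_closed_subgroups G \<rho>"
  let ?T = "{a. a \<in> exponents G \<rho> \<and> (\<Sum>H\<in>?P. a H) = n}"
  have fin_cover: "finite (plain_cover {1..n})" using finite_plain by (simp add: plain_cover_def)
  show "(\<Sum>a | a \<in> exponents G \<rho> \<and> (\<Sum>H\<in>?P. a H) = n. Gamma_tilde_coeff G \<rho> j a) =
      coeff (weight {1..n} (plain_cover {1..n})) j / fact n"
  proof (cases "n = 0")
    \<comment> \<open>The only exponent vector is 0. Its coefficient, 1 at s^0 by definition,
      accounts for the empty family on the empty index set.\<close>
    case True
    have "?T = {restrict (\<lambda>_. 0) ?P}"
    proof (intro equalityI subsetI)
      fix a assume a: "a \<in> ?T"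
      then have "a H = 0" if "H \<in> ?P" for H using that True finite_proper by simp
      then show "a \<in> {restrict (\<lambda>_. 0) ?P}"
        using a by (auto simp: exponents_def PiE_def intro!: extensionalityI[of _ ?P])
    qed (use True in \<open>auto simp: exponents_def\<close>)
    then show ?thesis
      using True by (simp add: Gamma_tilde_coeff_def plain_cover_empty weight_empty)
  next
    case False
    let ?X = "{F \<in> forests'' n G \<rho>. card F = j}"
    have finX: "finite ?X" using finite_forests'[of n] by (simp add: forests''_def)
    have finT: "finite ?T" by (rule finite_subset[OF _ finite_exponents[of n]]) auto
    have img: "leaf_vector ` ?X \<subseteq> ?T"
    proof
      fix a assume "a \<in> leaf_vector ` ?X"
      then obtain F where F: "F \<in> forests' n G \<rho>" "fallen_leaves F = {}" "a = leaf_vector F"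
        by (auto simp: forests''_def)
      then show "a \<in> ?T"
        using sum_leaves_under[OF F(1)] leaf_vector_exponents sum_leaf_vector by simp
    qed
    have "(\<Sum>a\<in>?T. Gamma_tilde_coeff G \<rho> j a) =
        (\<Sum>a\<in>?T. of_nat (card {F \<in> ?X. leaf_vector F = a}) / fact n)"
    proof (rule sum.cong[OF refl])
      fix a assume a: "a \<in> ?T"
      have "gamma'' G \<rho> j a = card {F \<in> ?X. leaf_vector F = a}"
        using a leaf_vector_eq_iff[of a] by (simp add: gamma''_def conj_assoc)
      then show "Gamma_tilde_coeff G \<rho> j a = of_nat (card {F \<in> ?X. leaf_vector F = a}) / fact n"
        using a False by (simp add: Gamma_tilde_coeff_def)
    qed
    also have "\<dots> = of_nat (\<Sum>a\<in>?T. card {F \<in> ?X. leaf_vector F = a}) / fact n"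
      by (simp add: sum_divide_distrib)
    also have "\<dots> = of_nat (card ?X) / fact n" unfolding card_fibers[OF finX finT img] ..
    finally show ?thesis
      using card_forests''[of n j] False coeff_weight[OF fin_cover] by simp
  qed
qed

lemma Gamma_bar_eq: "Gamma_bar G \<rho> = pegf (\<lambda>n. weight {1..n} (plain {1..n} - {{}}))"
  unfolding Gamma_bar_def
proof (rule series_eq_pegf)
  fix j n
  let ?P = "proper_closed_subgroups G \<rho>"
  let ?T = "{(h, a). a \<in> exponents G \<rho> \<and> h + (\<Sum>H\<in>?P. a H) = n}"
  let ?X = "{F \<in> forests' n G \<rho>. card F = j}"
  let ?f = "\<lambda>F. (card (fallen_leaves F), leaf_vector F)"
  have finX: "finite ?X" using finite_forests'[of n] by simp
  have finT: "finite ?T"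
    by (rule finite_subset[OF _ finite_cartesian_product[OF finite_atMost[of n] finite_exponents[of n]]])
      auto
  have img: "?f ` ?X \<subseteq> ?T"
    using sum_leaves_under leaf_vector_exponents sum_leaf_vector by auto
  \<comment> \<open>The guard in \<open>Gamma_bar_coeff\<close> loses no forest: a nonempty family
    has a maximal member, which is a component other than a fallen leaf, and it covers some
    index.\<close>
  have valid: "card (fallen_leaves F) < j \<and> (\<Sum>H\<in>?P. card (leaves_under F H)) \<ge> 1"
    if F: "F \<in> ?X" for F
  proof -
    have F': "F \<in> forests' n G \<rho>" "forest_on {1..n} F" "forest_family F \<noteq> {}" "card F = j"
      using F by (auto simp: forests'_eq)
    note fam = forest_family_in_families[OF F'(2)]
    have fin: "finite (forest_family F)" using families_finite[OF fam] by simp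
    have "maxes (forest_family F) \<noteq> {}" using below_maxes[OF fin] F'(3) by blast
    then have "card (maxes (forest_family F)) > 0" using fin by (simp add: maxes_def card_gt_0_iff)
    then have "card (fallen_leaves F) < j"
      using card_forest[OF F'(2)] fallen_leaves_family[OF F'(2)] F'(4) by simp
    moreover have "card (fallen_leaves F) < n"
    proof -
      obtain R where "R \<in> forest_family F" using F'(3) by blast
      then have "fallen_leaves F \<subset> {1..n}"
        using fallen_leaves_family[OF F'(2)] families_supp[OF fam] by blast
      then show ?thesis using psubset_card_mono[of "{1..n}"] by simp
    qed
    ultimately show ?thesis using sum_leaves_under[OF F'(1)] by linarith
  qed
  have "(\<Sum>(h, a)\<in>?T. Gamma_bar_coeff G \<rho> h j a) =
      (\<Sum>x\<in>?T. of_nat (card {F \<in> ?X. ?f F = x}) / fact n)"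
  proof (rule sum.cong[OF refl])
    fix x assume "x \<in> ?T"
    then obtain h a where x: "x = (h, a)" and a: "a \<in> exponents G \<rho>" "h + (\<Sum>H\<in>?P. a H) = n" by auto
    have g: "gamma' G \<rho> h j a = card {F \<in> ?X. ?f F = x}"
      using leaf_vector_eq_iff[OF a(1)] a(2) by (simp add: gamma'_def x conj_ac)
    have "(case x of (h, a) \<Rightarrow> Gamma_bar_coeff G \<rho> h j a) = of_nat (gamma' G \<rho> h j a) / fact n"
    proof (cases "j > h \<and> (\<Sum>H\<in>?P. a H) \<ge> 1")
      case True
      then show ?thesis using a(2) by (simp add: Gamma_bar_coeff_def x Let_def)
    next
      case False
      have "{F \<in> ?X. ?f F = x} = {}"
      proof (rule ccontr)
        assume "{F \<in> ?X. ?f F = x} \<noteq> {}"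
        then obtain F where F: "F \<in> ?X" "?f F = x" by blast
        then have "h = card (fallen_leaves F)"
          "(\<Sum>H\<in>?P. a H) = (\<Sum>H\<in>?P. card (leaves_under F H))"
          using x sum_leaf_vector by auto
        then show False using valid[OF F(1)] False by simp
      qed
      then have "gamma' G \<rho> h j a = 0" unfolding g by (simp only: card.empty)
      then show ?thesis using False by (auto simp: Gamma_bar_coeff_def x Let_def)
    qed
    then show "(case x of (h, a) \<Rightarrow> Gamma_bar_coeff G \<rho> h j a) =
        of_nat (card {F \<in> ?X. ?f F = x}) / fact n" using g by simp
  qed
  also have "\<dots> = of_nat (\<Sum>x\<in>?T. card {F \<in> ?X. ?f F = x}) / fact n"
    by (simp add: sum_divide_distrib)
  also have "\<dots> = of_nat (card ?X) / fact n" unfolding card_fibers[OF finX finT img] ..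
  also have "\<dots> = coeff (weight {1..n} (plain {1..n} - {{}})) j / fact n"
    using card_forests'[of n j] coeff_weight[of "plain {1..n} - {{}}"] finite_plain by simp
  finally show "(\<Sum>(h, a)\<in>?T. Gamma_bar_coeff G \<rho> h j a) =
      coeff (weight {1..n} (plain {1..n} - {{}})) j / fact n" .
qed

lemma G_series_eq: "G_series G \<rho> = pegf (\<lambda>n. weight {1..n} (families {1..n} - {{}}))"
  unfolding G_series_def
proof (rule series_eq_pegf)
  fix j n
  have fin: "finite (families {1..n} - {{}})" using finite_families by simp
  \<comment> \<open>The restriction to positive \<open>j\<close> and \<open>n\<close> cuts off only
    zeros: a nonempty family has at least one component, and there is none on the empty index
    set.\<close>
  have "gamma G \<rho> j n = 0" if "j = 0 \<or> n = 0"
  proof -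
    have "ncomp {1..n} S > 0" if "S \<in> families {1..n} - {{}}" for S using ncomp_pos that by simp
    moreover have "families {1..0::nat} - {{}} = {}" by (simp add: families_empty)
    ultimately have "{S \<in> families {1..n} - {{}}. ncomp {1..n} S = j} = {}" using that by force
    then show ?thesis by (simp only: gamma_eq card.empty)
  qed
  then show "(if 0 < j \<and> 0 < n then of_nat (gamma G \<rho> j n) / fact n else 0) =
      coeff (weight {1..n} (families {1..n} - {{}})) j / fact n"
    using gamma_eq[of j n] coeff_weight[OF fin] by auto
qed

lemma exp_st_eq: "exp_st = pegf (\<lambda>n. monom 1 n)"
  unfolding exp_st_def by (rule series_eq_pegf) auto

lemma Gamma_eq: "Gamma G \<rho> = pegf (\<lambda>n. weight {1..n} (plain {1..n}))"
  unfolding Gamma_def Gamma_tilde_eq exp_st_eq pegf_weight_plain by (rule mult.commute)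

theorem G_series_formula:
  "G_series G \<rho> =
    var_s * fps_in_t (1 / (2 - at_s_1 (Gamma G \<rho>)) - 1) * Gamma G \<rho> + Gamma_bar G \<rho>"
proof -
  have "at_s_1 (Gamma G \<rho>) = egf (\<lambda>n. of_nat (card (plain {1..n})))"
    by (simp add: Gamma_eq at_s_1_pegf poly_weight)
  then have M: "1 / (2 - at_s_1 (Gamma G \<rho>)) - 1 = egf (\<lambda>n. of_nat (card (rooted {1..n})))"
    using egf_rooted by simp
  have "var_s * fps_in_t (1 / (2 - at_s_1 (Gamma G \<rho>)) - 1) * Gamma G \<rho> + Gamma_bar G \<rho> =
      pegf (\<lambda>n. weight {1..n} (with_carrier {1..n})) + pegf (\<lambda>n. weight {1..n} (plain {1..n} - {{}}))"
    unfolding M unfolding pegf_weight_with_carrier Gamma_eq Gamma_bar_eq ..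
  also have "\<dots> = G_series G \<rho>"
    unfolding G_series_eq pegf_add
    by (simp add: weight_families_split[OF finite_atLeastAtMost] add.commute)
  finally show ?thesis ..
qed

lemma G_series_at_1:
  "fact n * fps_nth (at_s_1 (G_series G \<rho>)) n = of_nat (card (families {1..n} - {{}}))"
  by (simp add: G_series_eq at_s_1_pegf egf_def poly_weight)

end

theorem theorem6p2:
  fixes G :: "('g, 'b) monoid_scheme"
    and scale :: "complex \<Rightarrow> 'v::ab_group_add \<Rightarrow> 'v"
    and Basis :: "'v set"
    and \<rho> :: "'g \<Rightarrow> 'v \<Rightarrow> 'v"
  assumes "comm_group G"
    and "finite (carrier G)"
    and "finite_dimensional_vector_space scale Basis"
    and "(UNIV :: 'v set) \<noteq> {0}"
    and "\<rho> \<in> hom G (GL scale)"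
    and "inj_on \<rho> (carrier G)"
    and "Fix \<rho> (carrier G) = {0}"
  shows "G_series G \<rho> =
           var_s * fps_in_t (1 / (2 - at_s_1 (Gamma G \<rho>)) - 1) * Gamma G \<rho> + Gamma_bar G \<rho>
       \<and> (\<forall>n\<ge>1. of_nat (card {S. nested_set (building_set scale G \<rho> n) S \<and> S \<noteq> {}})
            = fact n * fps_nth (at_s_1 (G_series G \<rho>)) n)"
proof -
  have "representation G scale \<rho>"
    unfolding representation_def representation_axioms_def
    using assms finite_dimensional_vector_space.axioms(1) by blast
  then interpret representation G scale \<rho> .
  show ?thesis using G_series_formula G_series_at_1 card_nested_sets by simp
qed

end
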